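(* Consider the Rician block-fading channel and codes defined in the context, with parameters $\ell,n_c\ge 1$, $\epsilon\in(0,1)$, $\rho>0$, $\kappa\ge 0$. Then \[ R^*\ \ge\ \max\Big\{\tfrac{\log_2 M}{n_c\ell}:\ M\ge 2 \text{ integer},\ \epsilon_{\mathrm{ub}}(M)\le\epsilon\Big\}, \] where \[ \epsilon_{\mathrm{ub}}(M)=\mathbb{E}\Big[\exp\Big\{-\Big[\sum_{k=1}^{\ell}S_k-\ln\tfrac{M-1}{2}\Big]^+\Big\}\Big], \] with $S_1,\dots,S_\ell$ the i.i.d. random variables defined in the context (with $\mu=\mu_H$, $\sigma^2=\sigma_H^2$).
   Context: Channel model: fix integers $\ell\ge1$ (number of coherence blocks) and $n_c\ge1$ (block length of each coherence block), a Rician factor $\kappa\ge0$, and $\rho>0$. Set $\mu_H=\sqrt{\kappa/(1+\kappa)}$ and $\sigma_H^2=1/(1+\kappa)$. The channel maps an input $(\mathbf{x}_1,\dots,\mathbf{x}_\ell)\in(\mathbb{C}^{n_c})^\ell$ to $\mathbf{Y}_k=H_k\mathbf{x}_k+\mathbf{W}_k$, $k=1,\dots,\ell$, where $H_k\sim\mathcal{CN}(\mu_H,\sigma_H^2)$ (i.e., $\mu_H$ plus a circularly-symmetric complex Gaussian of variance $\sigma_H^2$) and $\mathbf{W}_k\sim\mathcal{CN}(\mathbf{0},\mathbf{I}_{n_c})$, all of $H_1,\dots,H_\ell,\mathbf{W}_1,\dots,\mathbf{W}_\ell$ mutually independent and independent of the input; neither transmitter nor receiver knows the realizations of $H_k$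 (the receiver knows $\mu_H,\sigma_H^2$). Codes: an $(\ell,n_c,M,\epsilon,\rho)$-code consists of an encoder mapping each message $j\in\{1,\dots,M\}$ to a codeword $\mathbf{c}_j=(\mathbf{c}_{j,1},\dots,\mathbf{c}_{j,\ell})$ with $\mathbf{c}_{j,k}\in\mathbb{C}^{n_c}$ and $\|\mathbf{c}_{j,k}\|^2=n_c\rho$ for every $k$, and a decoder $g:\mathbb{C}^{n_c\ell}\to\{1,\dots,M\}$ such that, with message $J$ uniform on $\{1,\dots,M\}$, $\frac1M\sum_{j=1}^M\Pr\{g(\mathbf{Y}_1,\dots,\mathbf{Y}_\ell)\ne J\mid J=j\}\le\epsilon$. The maximum coding rate is $R^*=\sup\{\log_2(M)/(\ell n_c):\exists\ (\ell,n_c,M,\epsilon,\rho)\text{-code}\}$. Definition of $S_k$ (for given $\mu\in\mathbb{C}$, $\sigma^2>0$, and block length $n_c$): let $\mathbf{e}_1=[1,0,\dots,0]^{T}\in\mathbb{C}^{n_c}$; let $f_{\mathbf{Y}\mid\mathbf{e}_1}$ be the density of $\mathcal{CN}\big(\mu\sqrt{n_c\rho}\,\mathbf{e}_1,\ \sigma^2 n_c\rho\,\mathbf{e}_1\mathbf{e}_1^{H}+\mathbf{I}_{n_c}\big)$, and let \[ f_{\mathbf{Y}}(\mathbf{y})=\frac{\Gamma(n_c)}{\sigma^2\pi^{n_c}}e^{-\|\mathbf{y}\|^2}e^{-|\mu|^2/\sigma^2}\int_0^\infty\frac{e^{-(\rho n_c+\sigma^{-2})z}}{(\sqrt{\|\mathbf{y}\|^2\rho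 n_c z})^{n_c-1}}I_0\big(2\sqrt{z|\mu|^2/\sigma^4}\big)I_{n_c-1}\big(2\sqrt{\|\mathbf{y}\|^2\rho n_c z}\big)\,\mathrm{d}z \] (the output density when the input is uniform on the sphere of radius $\sqrt{n_c\rho}$ and the fading is $\mathcal{CN}(\mu,\sigma^2)$). With $\mathbf{W}_1,\dots,\mathbf{W}_\ell$ i.i.d. $\mathcal{CN}(\mathbf{0},\mathbf{I}_{n_c})$, set $\widetilde{\mathbf{W}}_k=\begin{bmatrix}\mu\sqrt{n_c\rho}\\ \mathbf{0}_{n_c-1}\end{bmatrix}+\begin{bmatrix}\sqrt{\sigma^2n_c\rho+1}\\ \mathbf{1}_{n_c-1}\end{bmatrix}\odot\mathbf{W}_k$ (where $\odot$ is the entrywise product and $\mathbf{0}_{m},\mathbf{1}_m$ are the all-zero/all-one vectors of length $m$) and $S_k=\ln\dfrac{f_{\mathbf{Y}\mid\mathbf{e}_1}(\widetilde{\mathbf{W}}_k)}{f_{\mathbf{Y}}(\widetilde{\mathbf{W}}_k)}$. Explicitly, $S_k=\frac{|\mu|^2}{\sigma^2}+\|\widetilde{\mathbf{W}}_k\|^2-\|\mathbf{W}_k\|^2-\ln\Gamma(n_c)-\ln\frac{\sigma^2n_c\rho+1}{\sigma^2}-\ln\int_0^\infty\frac{e^{-(\rho n_c+\sigma^{-2})z}}{(\sqrt{\|\widetilde{\mathbf{W}}_k\|^2\rho n_cz})^{n_c-1}}I_0\big(2\sqrt{z|\mu|^2/\sigma^4}\big)I_{n_c-1}\big(2\sqrt{\|\widetilde{\mathbf{W}}_k\|^2\rho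 n_cz}\big)\mathrm{d}z$. Also $[a]^+=\max\{0,a\}$ and $\ln$ is the natural logarithm. *)

theory Defs
  imports "HOL-Probability.Probability"
begin

definition besselI :: "nat \<Rightarrow> real \<Rightarrow> real" where
  "besselI \<nu> x = (\<Sum>m. (x / 2) ^ (2 * m + \<nu>) / (fact m * fact (m + \<nu>)))"

definition CN :: "complex \<Rightarrow> real \<Rightarrow> complex measure" where
  "CN m s2 = density lborel (\<lambda>z. ennreal (exp (- (cmod (z - m))\<^sup>2 / s2) / (pi * s2)))"

text \<open>Vectors in C^n are functions nat => complex on the index set {..<n}
  (index 0 is the first coordinate). CN(0, I_n):\<close>
definition CN_std_vec :: "nat \<Rightarrow> (nat \<Rightarrow> complex) measure" where
  "CN_std_vec n = PiM {..<n} (\<lambda>_. CN 0 1)"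

definition sqnorm :: "nat \<Rightarrow> (nat \<Rightarrow> complex) \<Rightarrow> real" where
  "sqnorm n y = (\<Sum>i<n. (cmod (y i))\<^sup>2)"

definition muH :: "real \<Rightarrow> complex" where
  "muH \<kappa> = complex_of_real (sqrt (\<kappa> / (1 + \<kappa>)))"

definition sigma2H :: "real \<Rightarrow> real" where
  "sigma2H \<kappa> = 1 / (1 + \<kappa>)"

text \<open>Probability space of the channel randomness: for each block k < l the pair
  (H_k, W_k), with H_k ~ CN(muH, sigma2H), W_k ~ CN(0, I_nc), all independent.\<close>
definition chan_space :: "real \<Rightarrow> nat \<Rightarrow> nat \<Rightarrow> (nat \<Rightarrow> complex \<times> (nat \<Rightarrow> complex)) measure" where
  "chan_space \<kappa> l nc = PiM {..<l} (\<lambda>_. CN (muH \<kappa>) (sigma2H \<kappa>) \<Otimes>\<^sub>M CN_std_vec nc)"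

definition chan_out :: "nat \<Rightarrow> nat \<Rightarrow> (nat \<Rightarrow> nat \<Rightarrow> complex)
    \<Rightarrow> (nat \<Rightarrow> complex \<times> (nat \<Rightarrow> complex)) \<Rightarrow> (nat \<Rightarrow> nat \<Rightarrow> complex)" where
  "chan_out l nc x \<omega> = (\<lambda>k\<in>{..<l}. \<lambda>i\<in>{..<nc}. fst (\<omega> k) * x k i + snd (\<omega> k) i)"

definition out_space :: "nat \<Rightarrow> nat \<Rightarrow> (nat \<Rightarrow> nat \<Rightarrow> complex) measure" where
  "out_space l nc = PiM {..<l} (\<lambda>_. PiM {..<nc} (\<lambda>_. borel))"

definition is_code :: "real \<Rightarrow> nat \<Rightarrow> nat \<Rightarrow> nat \<Rightarrow> real \<Rightarrow> real \<Rightarrow> bool" where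
  "is_code \<kappa> l nc M \<epsilon> \<rho> \<longleftrightarrow>
     (\<exists>(c :: nat \<Rightarrow> nat \<Rightarrow> nat \<Rightarrow> complex) (g :: (nat \<Rightarrow> nat \<Rightarrow> complex) \<Rightarrow> nat).
        (\<forall>j\<in>{1..M}. \<forall>k<l. sqnorm nc (c j k) = real nc * \<rho>) \<and>
        g \<in> measurable (out_space l nc) (count_space UNIV) \<and>
        (1 / real M) * (\<Sum>j=1..M. measure (chan_space \<kappa> l nc)
            {\<omega> \<in> space (chan_space \<kappa> l nc). g (chan_out l nc (c j) \<omega>) \<noteq> j}) \<le> \<epsilon>)"

definition Rstar :: "real \<Rightarrow> nat \<Rightarrow> nat \<Rightarrow> real \<Rightarrow> real \<Rightarrow> ereal" where
  "Rstar \<kappa> l nc \<epsilon> \<rho> =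
     Sup {ereal (log 2 (real M) / (real l * real nc)) | M. M \<ge> 1 \<and> is_code \<kappa> l nc M \<epsilon> \<rho>}"

text \<open>Density of CN(mu sqrt(nc rho) e1, sigma2 nc rho e1 e1^H + I_nc), written out
  (the covariance is diagonal).\<close>
definition f_Y_e1 :: "complex \<Rightarrow> real \<Rightarrow> nat \<Rightarrow> real \<Rightarrow> (nat \<Rightarrow> complex) \<Rightarrow> real" where
  "f_Y_e1 \<mu> \<sigma>2 nc \<rho> y =
     exp (- ((cmod (y 0 - \<mu> * complex_of_real (sqrt (real nc * \<rho>))))\<^sup>2 / (\<sigma>2 * real nc * \<rho> + 1)
             + (\<Sum>i\<in>{1..<nc}. (cmod (y i))\<^sup>2)))
     / (pi ^ nc * (\<sigma>2 * real nc * \<rho> + 1))"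

definition f_Y :: "complex \<Rightarrow> real \<Rightarrow> nat \<Rightarrow> real \<Rightarrow> (nat \<Rightarrow> complex) \<Rightarrow> real" where
  "f_Y \<mu> \<sigma>2 nc \<rho> y =
     Gamma (real nc) / (\<sigma>2 * pi ^ nc) * exp (- sqnorm nc y) * exp (- (cmod \<mu>)\<^sup>2 / \<sigma>2) *
     (LBINT z:{0..}. exp (- (\<rho> * real nc + 1 / \<sigma>2) * z)
        / (sqrt (sqnorm nc y * \<rho> * real nc * z)) ^ (nc - 1)
        * besselI 0 (2 * sqrt (z * (cmod \<mu>)\<^sup>2 / \<sigma>2 ^ 2))
        * besselI (nc - 1) (2 * sqrt (sqnorm nc y * \<rho> * real nc * z)))"

definition W_tilde :: "complex \<Rightarrow> real \<Rightarrow> nat \<Rightarrow> real \<Rightarrow> (nat \<Rightarrow> complex) \<Rightarrow> (nat \<Rightarrow> complex)" where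
  "W_tilde \<mu> \<sigma>2 nc \<rho> w =
     (\<lambda>i. if i = 0 then \<mu> * complex_of_real (sqrt (real nc * \<rho>))
                        + complex_of_real (sqrt (\<sigma>2 * real nc * \<rho> + 1)) * w 0
          else w i)"

definition S_fun :: "complex \<Rightarrow> real \<Rightarrow> nat \<Rightarrow> real \<Rightarrow> (nat \<Rightarrow> complex) \<Rightarrow> real" where
  "S_fun \<mu> \<sigma>2 nc \<rho> w =
     ln (f_Y_e1 \<mu> \<sigma>2 nc \<rho> (W_tilde \<mu> \<sigma>2 nc \<rho> w) / f_Y \<mu> \<sigma>2 nc \<rho> (W_tilde \<mu> \<sigma>2 nc \<rho> w))"

definition eps_ub :: "real \<Rightarrow> nat \<Rightarrow> nat \<Rightarrow> real \<Rightarrow> nat \<Rightarrow> real" where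
  "eps_ub \<kappa> l nc \<rho> M =
     (\<integral>W. exp (- max 0 ((\<Sum>k<l. S_fun (muH \<kappa>) (sigma2H \<kappa>) nc \<rho> (W k)) - ln ((real M - 1) / 2)))
       \<partial>(PiM {..<l} (\<lambda>_. CN_std_vec nc)))"

end

theory Submission
  imports Defs
begin

text \<open>
  The dependence-testing bound. Draw codewords independently, each block uniformly on the sphere,
  and decode to the first codeword whose likelihood exceeds \<open>(M - 1) / 2\<close> times the output density
  for a random codeword. A missed codeword and an earlier false alarm together contribute, averaged
  over the messages, the expectation of \<open>min 1 (\<beta> * exp (- i))\<close> with \<open>\<beta> = (M - 1) / 2\<close> and \<open>i\<close> the
  information density, so some codebook does at least as well. Given the codeword \<open>x\<close>, the density
  of a block depends on \<open>y\<close> only through \<open>(|y|\<^sup>2, \<langle>x, y\<rangle>)\<close>, whose law is the same for all \<open>x\<close> on the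
  sphere by unitary invariance of the Gaussian; taking \<open>x\<close> proportional to the first basis vector
  identifies the law of \<open>i\<close> with that of the sum of the \<open>S_k\<close>. The density for a uniform \<open>x\<close> is
  \<open>f_Y\<close>: integrating out first the direction of \<open>x\<close> and then the phase of the fading coefficient
  produces the two Bessel functions.
\<close>

section \<open>Products of measures and rotation invariance of Lebesgue measure\<close>

text \<open>Integrals stay in \<open>ennreal\<close> for as long as possible. Tonelli then asks for
  no integrability, and the output density \<open>Phi\<close> is allowed to be infinite at some
  points; its finiteness almost everywhere follows from its total mass. Only the comparison with the
  real-valued \<open>f_Y\<close> and \<open>S_fun\<close> has to set null sets aside.

  The uniform law on the sphere is encoded as the direction of a standard complex Gaussian vector,
  so random codewords live on a product measure and no surface measure is built. The price is
  division by a random norm, which has to be removed before the coordinates separate.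

  The constant \<open>(M - 1) / 2\<close> is the average number of codewords that precede a given
  one in the list. With exactly this threshold the miss term and the weighted false-alarm term add
  up pointwise to a minimum of two densities.

  In place of the logarithm \<open>i\<close> the argument carries the ratio \<open>tau\<close>, that
  is \<open>exp (- i)\<close>: it is multiplicative over blocks and makes sense in
  \<open>ennreal\<close>.\<close>

lemma density_PiM_prod:
  assumes "finite I" "product_sigma_finite M" "\<And>i. f i \<in> borel_measurable (M i)"
    and "product_sigma_finite (\<lambda>i. density (M i) (f i))"
  shows "density (PiM I M) (\<lambda>x. \<Prod>i\<in>I. f i (x i)) = PiM I (\<lambda>i. density (M i) (f i))"
proof -
  interpret M: product_sigma_finite M by fact
  interpret D: product_sigma_finite "\<lambda>i. density (M i) (f i)" by fact
  note assms(1,3)[measurable]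
  show ?thesis
  proof (rule D.PiM_eqI)
    show "sets (density (PiM I M) (\<lambda>x. \<Prod>i\<in>I. f i (x i))) = sets (PiM I (\<lambda>i. density (M i) (f i)))"
      by (auto intro!: sets_PiM_cong)
    fix A assume "\<And>i. i \<in> I \<Longrightarrow> A i \<in> sets (density (M i) (f i))"
    then have A[measurable]: "i \<in> I \<Longrightarrow> A i \<in> sets (M i)" for i by simp
    have "emeasure (density (PiM I M) (\<lambda>x. \<Prod>i\<in>I. f i (x i))) (Pi\<^sub>E I A)
        = (\<integral>\<^sup>+x. (\<Prod>i\<in>I. f i (x i)) * indicator (Pi\<^sub>E I A) x \<partial>PiM I M)"
      using assms(1) by (intro emeasure_density) (auto intro!: borel_measurable_prod)
    also have "\<dots> = (\<integral>\<^sup>+x. (\<Prod>i\<in>I. f i (x i) * indicator (A i) (x i)) \<partial>PiM I M)"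
    proof (rule nn_integral_cong)
      fix x assume "x \<in> space (PiM I M)"
      then have "indicator (Pi\<^sub>E I A) x = (\<Prod>i\<in>I. indicator (A i) (x i) :: ennreal)"
        using assms(1) by (auto simp: indicator_def space_PiM PiE_iff prod.If_cases prod_zero_iff
            intro!: prod_zero split: if_splits)
      then show "(\<Prod>i\<in>I. f i (x i)) * indicator (Pi\<^sub>E I A) x = (\<Prod>i\<in>I. f i (x i) * indicator (A i) (x i))"
        by (simp add: prod.distrib)
    qed
    also have "\<dots> = (\<Prod>i\<in>I. \<integral>\<^sup>+x. f i x * indicator (A i) x \<partial>M i)"
      using assms(1) by (intro M.product_nn_integral_prod) auto
    also have "\<dots> = (\<Prod>i\<in>I. emeasure (density (M i) (f i)) (A i))"
      by (intro prod.cong) (auto simp: emeasure_density)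
    finally show "emeasure (density (PiM I M) (\<lambda>x. \<Prod>i\<in>I. f i (x i))) (Pi\<^sub>E I A)
        = (\<Prod>i\<in>I. emeasure (density (M i) (f i)) (A i))" .
  qed (use assms in auto)
qed

text \<open>The restriction to \<open>I\<close> keeps the image among the extensional functions that
  carry \<open>PiM\<close>. The preimage of a box is then a box, which suffices by uniqueness of
  product measures.\<close>

lemma distr_PiM_componentwise:
  assumes "finite I" "\<And>i. prob_space (M i)" "\<And>i. f i \<in> M i \<rightarrow>\<^sub>M M' i"
  shows "distr (PiM I M) (PiM I M') (\<lambda>x. \<lambda>i\<in>I. f i (x i)) = PiM I (\<lambda>i. distr (M i) (M' i) (f i))"
proof -
  interpret M: product_prob_space M
    using assms(2) by (rule product_prob_spaceI)
  interpret D: product_prob_space "\<lambda>i. distr (M i) (M' i) (f i)"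
    using assms by (intro product_prob_spaceI prob_space.prob_space_distr)
  note assms(1,3)[measurable]
  show ?thesis
  proof (rule D.PiM_eqI)
    fix A assume "\<And>i. i \<in> I \<Longrightarrow> A i \<in> sets (distr (M i) (M' i) (f i))"
    then have A[measurable]: "i \<in> I \<Longrightarrow> A i \<in> sets (M' i)" for i by simp
    have m: "(\<lambda>x. \<lambda>i\<in>I. f i (x i)) \<in> PiM I M \<rightarrow>\<^sub>M PiM I M'"
      by measurable
    have "emeasure (distr (PiM I M) (PiM I M') (\<lambda>x. \<lambda>i\<in>I. f i (x i))) (Pi\<^sub>E I A)
       = emeasure (PiM I M) ((\<lambda>x. \<lambda>i\<in>I. f i (x i)) -` Pi\<^sub>E I A \<inter> space (PiM I M))"
      using assms(1) m by (intro emeasure_distr) auto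
    also have "(\<lambda>x. \<lambda>i\<in>I. f i (x i)) -` Pi\<^sub>E I A \<inter> space (PiM I M)
       = Pi\<^sub>E I (\<lambda>i. f i -` A i \<inter> space (M i))"
      by (auto simp: space_PiM PiE_iff)
    also have "emeasure (PiM I M) \<dots> = (\<Prod>i\<in>I. emeasure (M i) (f i -` A i \<inter> space (M i)))"
      using assms(1,3) A by (intro M.emeasure_PiM) (auto intro!: measurable_sets[of _ "M _" "M' _"])
    also have "\<dots> = (\<Prod>i\<in>I. emeasure (distr (M i) (M' i) (f i)) (A i))"
      using assms(3) by (intro prod.cong) (auto simp: emeasure_distr)
    finally show "emeasure (distr (PiM I M) (PiM I M') (\<lambda>x. \<lambda>i\<in>I. f i (x i))) (Pi\<^sub>E I A)
       = (\<Prod>i\<in>I. emeasure (distr (M i) (M' i) (f i)) (A i))" .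
  qed (use assms(1) in \<open>auto intro!: sets_PiM_cong\<close>)
qed

lemma nn_integral_lborel_plus:
  fixes f :: "'a::euclidean_space \<Rightarrow> ennreal"
  assumes [measurable]: "f \<in> borel_measurable borel"
  shows "(\<integral>\<^sup>+x. f (x + c) \<partial>lborel) = (\<integral>\<^sup>+x. f x \<partial>lborel)"
proof -
  have "(\<integral>\<^sup>+x. f x \<partial>lborel) = (\<integral>\<^sup>+x. f x \<partial>distr lborel borel ((+) c))"
    by (simp add: lborel_distr_plus)
  then show ?thesis
    by (simp add: nn_integral_distr add.commute)
qed

section \<open>Lebesgue measure under translations, shears and rotations\<close>

lemma nn_integral_lborel_shear_fst:
  fixes f :: "'a::euclidean_space \<Rightarrow> 'a \<Rightarrow> ennreal"
  assumes [measurable]: "case_prod f \<in> borel_measurable borel"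
  shows "(\<integral>\<^sup>+x. \<integral>\<^sup>+y. f (x + t *\<^sub>R y) y \<partial>lborel \<partial>lborel) = (\<integral>\<^sup>+x. \<integral>\<^sup>+y. f x y \<partial>lborel \<partial>lborel)"
proof -
  have [measurable]: "case_prod f \<in> borel_measurable (borel \<Otimes>\<^sub>M borel)"
    by (simp add: borel_prod)
  have "(\<integral>\<^sup>+x. \<integral>\<^sup>+y. f (x + t *\<^sub>R y) y \<partial>lborel \<partial>lborel) = (\<integral>\<^sup>+y. \<integral>\<^sup>+x. f (x + t *\<^sub>R y) y \<partial>lborel \<partial>lborel)"
    by (rule lborel_pair.Fubini') measurable
  also have "\<dots> = (\<integral>\<^sup>+y. \<integral>\<^sup>+x. f x y \<partial>lborel \<partial>lborel)"
    by (intro nn_integral_cong nn_integral_lborel_plus) measurable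
  also have "\<dots> = (\<integral>\<^sup>+x. \<integral>\<^sup>+y. f x y \<partial>lborel \<partial>lborel)"
    by (rule lborel_pair.Fubini') measurable
  finally show ?thesis .
qed

lemma nn_integral_lborel_shear_snd:
  fixes f :: "'a::euclidean_space \<Rightarrow> 'a \<Rightarrow> ennreal"
  assumes [measurable]: "case_prod f \<in> borel_measurable borel"
  shows "(\<integral>\<^sup>+x. \<integral>\<^sup>+y. f x (y + t *\<^sub>R x) \<partial>lborel \<partial>lborel) = (\<integral>\<^sup>+x. \<integral>\<^sup>+y. f x y \<partial>lborel \<partial>lborel)"
proof -
  have [measurable]: "case_prod f \<in> borel_measurable (borel \<Otimes>\<^sub>M borel)"
    by (simp add: borel_prod)
  show ?thesis
    by (intro nn_integral_cong nn_integral_lborel_plus) measurable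
qed

text \<open>A rotation is a product of three shears, and shears preserve Lebesgue measure by translation
  invariance and Tonelli.\<close>
lemma nn_integral_lborel_rotation_nonzero:
  fixes f :: "'a::euclidean_space \<Rightarrow> 'a \<Rightarrow> ennreal"
  assumes [measurable]: "case_prod f \<in> borel_measurable borel"
    and cs: "c\<^sup>2 + s\<^sup>2 = 1" "s \<noteq> 0"
  shows "(\<integral>\<^sup>+x. \<integral>\<^sup>+y. f (c *\<^sub>R x - s *\<^sub>R y) (s *\<^sub>R x + c *\<^sub>R y) \<partial>lborel \<partial>lborel)
       = (\<integral>\<^sup>+x. \<integral>\<^sup>+y. f x y \<partial>lborel \<partial>lborel)"
proof -
  have [measurable]: "case_prod f \<in> borel_measurable (borel \<Otimes>\<^sub>M borel)"
    by (simp add: borel_prod)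
  \<comment> \<open>For \<open>c = cos \<theta>\<close> and \<open>s = sin \<theta>\<close> this is
    \<open>- tan (\<theta> / 2)\<close>. The three shears move the first coordinate by
    \<open>t\<close>, the second by \<open>s\<close>, and the first by \<open>t\<close>
    again.\<close>
  define t where "t = (c - 1) / s"
  define f1 where "f1 = (\<lambda>x y. f (x + t *\<^sub>R y) y)"
  define f2 where "f2 = (\<lambda>x y. f1 x (y + s *\<^sub>R x))"
  have m: "case_prod f1 \<in> borel_measurable borel" "case_prod f2 \<in> borel_measurable borel"
    unfolding f2_def f1_def borel_prod[symmetric] by measurable
  have st: "t * s = c - 1" using cs by (simp add: t_def)
  \<comment> \<open>The coefficient of \<open>y\<close> after the three shears has to be
    \<open>- s\<close>. Multiplied by \<open>s\<close>, the difference is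
    \<open>(1 + t * s)\<^sup>2 + s\<^sup>2 - 1\<close>, which vanishes because
    \<open>1 + t * s = c\<close>.\<close>
  have "s * (t + (1 + t * s) * t + s) = s * t * 2 + (s * t) * (t * s) + s\<^sup>2"
    by (simp add: power2_eq_square algebra_simps)
  also have "\<dots> = c\<^sup>2 + s\<^sup>2 - 1"
    unfolding mult.commute[of s t] st by (simp add: power2_eq_square algebra_simps)
  finally have "t + (1 + t * s) * t + s = 0" using cs by simp
  then have s: "t + c * t = - s" using st by simp
  have "f2 (x + t *\<^sub>R y) y = f (c *\<^sub>R x - s *\<^sub>R y) (s *\<^sub>R x + c *\<^sub>R y)" for x y
  proof -
    have "x + t *\<^sub>R y + t *\<^sub>R (y + s *\<^sub>R (x + t *\<^sub>R y)) = (1 + t * s) *\<^sub>R x + (t + (1 + t * s) * t) *\<^sub>R y"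
      by (simp add: scaleR_add_left scaleR_add_right distrib_right mult.assoc) (simp flip: scaleR_add_left)
    also have "\<dots> = c *\<^sub>R x - s *\<^sub>R y" using st s by simp
    finally have 1: "x + t *\<^sub>R y + t *\<^sub>R (y + s *\<^sub>R (x + t *\<^sub>R y)) = c *\<^sub>R x - s *\<^sub>R y" .
    have "y + s *\<^sub>R (x + t *\<^sub>R y) = s *\<^sub>R x + (1 + t * s) *\<^sub>R y"
      by (simp add: algebra_simps)
    then have 2: "y + s *\<^sub>R (x + t *\<^sub>R y) = s *\<^sub>R x + c *\<^sub>R y" using st by simp
    show ?thesis unfolding f2_def f1_def 1 unfolding 2 ..
  qed
  then have "(\<integral>\<^sup>+x. \<integral>\<^sup>+y. f (c *\<^sub>R x - s *\<^sub>R y) (s *\<^sub>R x + c *\<^sub>R y) \<partial>lborel \<partial>lborel)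
     = (\<integral>\<^sup>+x. \<integral>\<^sup>+y. f2 (x + t *\<^sub>R y) y \<partial>lborel \<partial>lborel)" by simp
  also have "\<dots> = (\<integral>\<^sup>+x. \<integral>\<^sup>+y. f2 x y \<partial>lborel \<partial>lborel)"
    by (rule nn_integral_lborel_shear_fst[OF m(2)])
  also have "\<dots> = (\<integral>\<^sup>+x. \<integral>\<^sup>+y. f1 x y \<partial>lborel \<partial>lborel)"
    unfolding f2_def by (rule nn_integral_lborel_shear_snd[OF m(1)])
  also have "\<dots> = (\<integral>\<^sup>+x. \<integral>\<^sup>+y. f x y \<partial>lborel \<partial>lborel)"
    unfolding f1_def by (rule nn_integral_lborel_shear_fst) fact
  finally show ?thesis .
qed

lemma nn_integral_lborel_rotation:
  fixes f :: "'a::euclidean_space \<Rightarrow> 'a \<Rightarrow> ennreal"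
  assumes [measurable]: "case_prod f \<in> borel_measurable borel"
    and cs: "c\<^sup>2 + s\<^sup>2 = 1"
  shows "(\<integral>\<^sup>+x. \<integral>\<^sup>+y. f (c *\<^sub>R x - s *\<^sub>R y) (s *\<^sub>R x + c *\<^sub>R y) \<partial>lborel \<partial>lborel)
       = (\<integral>\<^sup>+x. \<integral>\<^sup>+y. f x y \<partial>lborel \<partial>lborel)"
proof (cases "s = 0")
  case False
  then show ?thesis using nn_integral_lborel_rotation_nonzero[OF assms] by simp
next
  case True
  then have c: "c\<^sup>2 = 1" using cs by simp
  have [measurable]: "case_prod f \<in> borel_measurable (borel \<Otimes>\<^sub>M borel)"
    by (simp add: borel_prod)
  define g where "g x y = f (- y) x" for x y
  have g: "case_prod g \<in> borel_measurable borel"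
    unfolding g_def borel_prod[symmetric] by measurable
  \<comment> \<open>compose a quarter turn with a second quarter turn, which is clockwise if \<open>c = 1\<close>\<close>
  have "(\<integral>\<^sup>+x. \<integral>\<^sup>+y. f (c *\<^sub>R x) (c *\<^sub>R y) \<partial>lborel \<partial>lborel)
      = (\<integral>\<^sup>+x. \<integral>\<^sup>+y. g (0 *\<^sub>R x - (- c) *\<^sub>R y) ((- c) *\<^sub>R x + 0 *\<^sub>R y) \<partial>lborel \<partial>lborel)"
    by (simp add: g_def)
  also have "\<dots> = (\<integral>\<^sup>+x. \<integral>\<^sup>+y. g x y \<partial>lborel \<partial>lborel)"
    using c by (intro nn_integral_lborel_rotation_nonzero[OF g]) auto
  also have "\<dots> = (\<integral>\<^sup>+x. \<integral>\<^sup>+y. f (0 *\<^sub>R x - 1 *\<^sub>R y) (1 *\<^sub>R x + 0 *\<^sub>R y) \<partial>lborel \<partial>lborel)"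
    by (simp add: g_def)
  also have "\<dots> = (\<integral>\<^sup>+x. \<integral>\<^sup>+y. f x y \<partial>lborel \<partial>lborel)"
    by (intro nn_integral_lborel_rotation_nonzero) auto
  finally show ?thesis using True by simp
qed

text \<open>\<open>complex\<close> and \<open>real \<times> real\<close> are different types, so
  Lebesgue measure on the first is identified as an image of that on the second by comparing
  boxes.\<close>

lemma nn_integral_lborel_complex:
  fixes f :: "complex \<Rightarrow> ennreal"
  assumes [measurable]: "f \<in> borel_measurable borel"
  shows "(\<integral>\<^sup>+z. f z \<partial>lborel) = (\<integral>\<^sup>+x. \<integral>\<^sup>+y. f (Complex x y) \<partial>lborel \<partial>lborel)"
proof -
  have [measurable]: "case_prod Complex \<in> borel \<rightarrow>\<^sub>M borel"
    by (intro borel_measurable_continuous_onI)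
       (auto simp: case_prod_beta Complex_eq intro!: continuous_intros)
  have "lborel = distr (lborel :: (real \<times> real) measure) borel (case_prod Complex)"
  proof (rule lborel_eqI)
    fix l u :: complex
    assume le: "\<And>b. b \<in> Basis \<Longrightarrow> l \<bullet> b \<le> u \<bullet> b"
    then have le': "Re l \<le> Re u" "Im l \<le> Im u"
      using le[of 1] le[of \<i>] by (auto simp: Basis_complex_def)
    have "(case_prod Complex) -` box l u = box (Re l, Im l) (Re u, Im u)"
      by (auto simp: box_def Basis_complex_def Basis_prod_def)
    then show "emeasure (distr lborel borel (case_prod Complex)) (box l u) = ennreal (\<Prod>b\<in>Basis. (u - l) \<bullet> b)"
      using le' by (simp add: emeasure_distr emeasure_lborel_box_eq Basis_complex_def Basis_prod_def
          prod.union_disjoint prod.reindex)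
  qed simp
  then have "(\<integral>\<^sup>+z. f z \<partial>lborel) = (\<integral>\<^sup>+z. f z \<partial>distr (lborel :: (real \<times> real) measure) borel (case_prod Complex))"
    by simp
  also have "\<dots> = (\<integral>\<^sup>+p. f (case_prod Complex p) \<partial>(lborel \<Otimes>\<^sub>M lborel))"
    by (simp add: nn_integral_distr lborel_prod)
  also have "\<dots> = (\<integral>\<^sup>+x. \<integral>\<^sup>+y. f (Complex x y) \<partial>lborel \<partial>lborel)"
    by (subst lborel.nn_integral_fst[symmetric]) (auto simp: lborel_prod)
  finally show ?thesis .
qed

text \<open>Multiplication by a unit complex number rotates the pair of real and imaginary parts:
  the case \<open>'a = real\<close> of the rotation lemma. The case \<open>'a = complex\<close> is
  used later to mix two coordinates of a vector.\<close>

lemma nn_integral_lborel_complex_rotate: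
  fixes f :: "complex \<Rightarrow> ennreal"
  assumes [measurable]: "f \<in> borel_measurable borel" and u: "cmod u = 1"
  shows "(\<integral>\<^sup>+z. f (u * z) \<partial>lborel) = (\<integral>\<^sup>+z. f z \<partial>lborel)"
proof -
  have m: "(\<lambda>(x, y). f (Complex x y)) \<in> borel_measurable borel"
    unfolding Complex_eq borel_prod[symmetric] by measurable
  have "(Re u)\<^sup>2 + (Im u)\<^sup>2 = 1" using u by (simp add: cmod_def)
  note rot = nn_integral_lborel_rotation[OF m this]
  have "(\<integral>\<^sup>+z. f (u * z) \<partial>lborel) = (\<integral>\<^sup>+x. \<integral>\<^sup>+y. f (u * Complex x y) \<partial>lborel \<partial>lborel)"
    by (intro nn_integral_lborel_complex) measurable
  also have "\<dots> = (\<integral>\<^sup>+x. \<integral>\<^sup>+y. f (Complex x y) \<partial>lborel \<partial>lborel)"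
    using rot by (simp add: times_complex.code add.commute)
  also have "\<dots> = (\<integral>\<^sup>+z. f z \<partial>lborel)"
    by (intro nn_integral_lborel_complex[symmetric]) measurable
  finally show ?thesis .
qed

section \<open>Complex Gaussian measures and their unitary invariance\<close>

lemma nn_integral_gauss_moment:
  assumes c: "c > 0"
  shows "(\<integral>\<^sup>+x. ennreal (x ^ (2 * m) * exp (- c * x\<^sup>2)) \<partial>lborel)
       = ennreal (sqrt (pi / c) * (fact (2 * m) / ((4 * c) ^ m * fact m)))"
proof -
  \<comment> \<open>The standard deviation for which \<open>exp (- c * x\<^sup>2)\<close> is
    \<open>sqrt (pi / c)\<close> times a normal density.\<close>
  define \<sigma> where "\<sigma> = sqrt (1 / (2 * c))"
  have \<sigma>: "\<sigma> > 0" "\<sigma>\<^sup>2 = 1 / (2 * c)" using c by (auto simp: \<sigma>_def)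
  have d: "x ^ (2 * m) * exp (- c * x\<^sup>2) = sqrt (pi / c) * (normal_density 0 \<sigma> x * (x - 0) ^ (2 * m))" for x
    using c by (simp add: normal_density_def \<sigma> real_sqrt_divide field_simps)
  have "has_bochner_integral lborel (\<lambda>x. x ^ (2 * m) * exp (- c * x\<^sup>2))
      (sqrt (pi / c) * (fact (2 * m) / ((2 / \<sigma>\<^sup>2) ^ m * fact m)))"
    unfolding d by (intro has_bochner_integral_mult_right) (rule normal_moment_even[OF \<sigma>(1)])
  also have "2 / \<sigma>\<^sup>2 = 4 * c" using \<sigma> c by simp
  finally have b: "has_bochner_integral lborel (\<lambda>x. x ^ (2 * m) * exp (- c * x\<^sup>2))
      (sqrt (pi / c) * (fact (2 * m) / ((4 * c) ^ m * fact m)))" .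
  have "(\<integral>\<^sup>+x. ennreal (x ^ (2 * m) * exp (- c * x\<^sup>2)) \<partial>lborel)
      = ennreal (integral\<^sup>L lborel (\<lambda>x. x ^ (2 * m) * exp (- c * x\<^sup>2)))"
    by (intro nn_integral_eq_integral) (use b in \<open>auto simp: has_bochner_integral_iff\<close>)
  then show ?thesis using b by (simp add: has_bochner_integral_iff)
qed

text \<open>Only the real part carries a power, so the integral is a moment times a total mass. The
  factor 2 in \<open>2 * Re z\<close> anticipates the exponent of the sphere average; its
  \<open>4 ^ m\<close> cancels the one in the real moment.\<close>

lemma nn_integral_complex_gauss_moment:
  assumes c: "c > 0"
  shows "(\<integral>\<^sup>+z. ennreal ((2 * Re z) ^ (2 * m) * exp (- c * (cmod z)\<^sup>2)) \<partial>lborel)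
       = ennreal (pi * fact (2 * m) / (fact m * c ^ (m + 1)))"
proof -
  have ss: "sqrt (pi / c) * sqrt (pi / c) = pi / c"
    using c by (simp only: real_sqrt_mult_self) simp
  have e3: "ennreal (a * b * d) = ennreal a * ennreal b * ennreal d" if "b \<ge> 0" "d \<ge> 0" for a b d
    using that by (simp only: ennreal_mult'')
  have "(\<integral>\<^sup>+z. ennreal ((2 * Re z) ^ (2 * m) * exp (- c * (cmod z)\<^sup>2)) \<partial>lborel)
      = (\<integral>\<^sup>+x. \<integral>\<^sup>+y. ennreal ((2 * x) ^ (2 * m) * exp (- c * (x\<^sup>2 + y\<^sup>2))) \<partial>lborel \<partial>lborel)"
    by (subst nn_integral_lborel_complex) (auto simp: cmod_def)
  also have "\<dots> = (\<integral>\<^sup>+x. \<integral>\<^sup>+y. ennreal (4 ^ m) * ennreal (x ^ (2 * m) * exp (- c * x\<^sup>2)) *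
      ennreal (y ^ (2 * 0) * exp (- c * y\<^sup>2)) \<partial>lborel \<partial>lborel)"
  proof (intro nn_integral_cong)
    fix x y :: real
    have "(2 * x) ^ (2 * m) = 4 ^ m * x ^ (2 * m)"
      by (simp add: power_mult power_mult_distrib)
    then have "(2 * x) ^ (2 * m) * exp (- c * (x\<^sup>2 + y\<^sup>2)) = 4 ^ m * (x ^ (2 * m) * exp (- c * x\<^sup>2)) * (y ^ (2 * 0) * exp (- c * y\<^sup>2))"
      by (simp add: ring_distribs exp_add exp_diff exp_minus field_simps)
    then show "ennreal ((2 * x) ^ (2 * m) * exp (- c * (x\<^sup>2 + y\<^sup>2))) = ennreal (4 ^ m) * ennreal (x ^ (2 * m) * exp (- c * x\<^sup>2)) *
      ennreal (y ^ (2 * 0) * exp (- c * y\<^sup>2))"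
      by (simp only: e3 zero_le_mult_iff zero_le_even_power' exp_ge_zero simp_thms)
  qed
  also have "\<dots> = ennreal (4 ^ m) * ennreal (sqrt (pi / c) * (fact (2 * m) / ((4 * c) ^ m * fact m))) *
      ennreal (sqrt (pi / c) * (fact (2 * 0) / ((4 * c) ^ 0 * fact 0)))"
    by (simp add: nn_integral_cmult nn_integral_multc nn_integral_gauss_moment[OF c, of m, simplified]
         nn_integral_gauss_moment[OF c, of 0, simplified] del: ennreal_power)
  also have "\<dots> = ennreal (4 ^ m * (sqrt (pi / c) * (fact (2 * m) / ((4 * c) ^ m * fact m))) * sqrt (pi / c))"
    using c by (subst e3) auto
  also have "4 ^ m * (sqrt (pi / c) * (fact (2 * m) / ((4 * c) ^ m * fact m))) * sqrt (pi / c)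
     = (sqrt (pi / c) * sqrt (pi / c)) * (fact (2 * m) / (c ^ m * fact m))"
    by (simp add: power_mult_distrib del: real_sqrt_mult_self)
  also have "\<dots> = pi * fact (2 * m) / (fact m * c ^ (m + 1))"
    unfolding ss using c by (simp add: field_simps)
  finally show ?thesis .
qed

lemma nn_integral_CN:
  assumes [measurable]: "f \<in> borel_measurable borel"
  shows "(\<integral>\<^sup>+z. f z \<partial>CN m s2) = (\<integral>\<^sup>+z. ennreal (exp (- (cmod (z - m))\<^sup>2 / s2) / (pi * s2)) * f z \<partial>lborel)"
  unfolding CN_def by (subst nn_integral_density) auto

lemma sets_CN[measurable_cong, simp]: "sets (CN m s2) = sets borel"
  by (simp add: CN_def)

lemma space_CN[simp]: "space (CN m s2) = UNIV"
  by (simp add: CN_def)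

lemma nn_integral_complex_gauss:
  fixes m :: complex
  assumes c: "c > 0"
  shows "(\<integral>\<^sup>+z. ennreal (exp (- c * (cmod (z - m))\<^sup>2)) \<partial>lborel) = ennreal (pi / c)"
  using nn_integral_lborel_plus[of "\<lambda>z. ennreal (exp (- c * (cmod z)\<^sup>2))" "- m"]
    nn_integral_complex_gauss_moment[OF c, of 0] by simp

lemma prob_space_CN:
  assumes "s2 > 0"
  shows "prob_space (CN m s2)"
proof
  have "emeasure (CN m s2) (space (CN m s2)) = (\<integral>\<^sup>+z. 1 \<partial>CN m s2)"
    by simp
  also have "\<dots> = (\<integral>\<^sup>+z. ennreal (1 / (pi * s2)) * ennreal (exp (- (1 / s2) * (cmod (z - m))\<^sup>2)) \<partial>lborel)"
    using assms by (subst nn_integral_CN) (auto intro!: nn_integral_cong simp flip: ennreal_mult')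
  also have "\<dots> = ennreal (1 / (pi * s2)) * ennreal (pi / (1 / s2))"
    using assms nn_integral_complex_gauss[of "1 / s2" m] by (subst nn_integral_cmult) auto
  also have "\<dots> = 1"
    using assms by (simp flip: ennreal_mult')
  finally show "emeasure (CN m s2) (space (CN m s2)) = 1" .
qed

lemma prob_space_CN01: "prob_space (CN 0 1)"
  by (rule prob_space_CN) simp

interpretation CN01: prob_space "CN 0 1"
  by (rule prob_space_CN01)

interpretation CN01_prod: product_sigma_finite "\<lambda>_::nat. CN 0 1"
  by unfold_locales

lemma sets_CN_std_vec[measurable_cong, simp]: "sets (CN_std_vec n) = sets (PiM {..<n} (\<lambda>_. borel))"
  unfolding CN_std_vec_def by (auto intro!: sets_PiM_cong)

lemma prob_space_CN_std_vec: "prob_space (CN_std_vec n)"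
  unfolding CN_std_vec_def by (rule prob_space_PiM) (rule prob_space_CN01)

lemma nn_integral_CN01_rotate:
  assumes [measurable]: "f \<in> borel_measurable borel" and u: "cmod u = 1"
  shows "(\<integral>\<^sup>+z. f (u * z) \<partial>CN 0 1) = (\<integral>\<^sup>+z. f z \<partial>CN 0 1)"
  using nn_integral_lborel_complex_rotate[OF _ u, of "\<lambda>z. ennreal (exp (- (cmod z)\<^sup>2) / pi) * f z"]
  by (simp add: nn_integral_CN norm_mult u)

text \<open>The joint density depends on the pair only through its squared norm, which is what makes
  it invariant under rotations.\<close>

lemma nn_integral_CN01_pair:
  assumes [measurable]: "case_prod f \<in> borel_measurable (borel \<Otimes>\<^sub>M borel)"
  shows "(\<integral>\<^sup>+x. \<integral>\<^sup>+y. f x y \<partial>CN 0 1 \<partial>CN 0 1)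
       = (\<integral>\<^sup>+x. \<integral>\<^sup>+y. ennreal (exp (- ((cmod x)\<^sup>2 + (cmod y)\<^sup>2)) / pi\<^sup>2) * f x y \<partial>lborel \<partial>lborel)"
proof -
  have e: "ennreal (exp (- ((cmod x)\<^sup>2 + (cmod y)\<^sup>2)) / pi\<^sup>2)
      = ennreal (exp (- (cmod x)\<^sup>2) / pi) * ennreal (exp (- (cmod y)\<^sup>2) / pi)" for x y
    by (simp add: exp_add exp_diff exp_minus power2_eq_square field_simps flip: ennreal_mult')
  show ?thesis
    unfolding e by (simp add: nn_integral_CN nn_integral_cmult mult.assoc)
qed

lemma cmod_sq_rotation:
  fixes x y :: complex and c s :: real
  assumes "c\<^sup>2 + s\<^sup>2 = 1"
  shows "(cmod (c *\<^sub>R x - s *\<^sub>R y))\<^sup>2 + (cmod (s *\<^sub>R x + c *\<^sub>R y))\<^sup>2 = (cmod x)\<^sup>2 + (cmod y)\<^sup>2"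
proof -
  have "(cmod (c *\<^sub>R x - s *\<^sub>R y))\<^sup>2 + (cmod (s *\<^sub>R x + c *\<^sub>R y))\<^sup>2
     = (c\<^sup>2 + s\<^sup>2) * ((cmod x)\<^sup>2 + (cmod y)\<^sup>2)"
    by (simp add: cmod_power2) (simp add: power2_eq_square algebra_simps)
  then show ?thesis using assms by simp
qed

lemma complex_cmod_times_unit: "\<exists>u. cmod u = 1 \<and> z = complex_of_real (cmod z) * u"
proof (cases "z = 0")
  case True
  then show ?thesis by (intro exI[of _ 1]) simp
next
  case False
  then show ?thesis by (intro exI[of _ "sgn z"]) (auto simp: sgn_eq norm_divide)
qed

text \<open>The phases of \<open>a\<close> and \<open>b\<close> are absorbed into \<open>x\<close>
  and \<open>y\<close>. What remains is \<open>r\<close> times a real unit combination of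
  \<open>x\<close> and \<open>y\<close>, and a rotation of the pair turns it into
  \<open>r * x\<close> while the squared norm of the pair is kept.\<close>

lemma nn_integral_CN01_pair_rotate:
  assumes [measurable]: "case_prod f \<in> borel_measurable (borel \<Otimes>\<^sub>M borel)"
  shows "(\<integral>\<^sup>+x. \<integral>\<^sup>+y. f ((cmod x)\<^sup>2 + (cmod y)\<^sup>2) (a * x + b * y) \<partial>CN 0 1 \<partial>CN 0 1)
    = (\<integral>\<^sup>+x. \<integral>\<^sup>+y. f ((cmod x)\<^sup>2 + (cmod y)\<^sup>2) (complex_of_real (sqrt ((cmod a)\<^sup>2 + (cmod b)\<^sup>2)) * x) \<partial>CN 0 1 \<partial>CN 0 1)"
proof -
  obtain u v where u: "cmod u = 1" "a = complex_of_real (cmod a) * u"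
    and v: "cmod v = 1" "b = complex_of_real (cmod b) * v"
    using complex_cmod_times_unit by metis
  define \<alpha> \<beta> r where "\<alpha> = cmod a" and "\<beta> = cmod b" and "r = sqrt (\<alpha>\<^sup>2 + \<beta>\<^sup>2)"
  define F where "F x y = f ((cmod x)\<^sup>2 + (cmod y)\<^sup>2) (complex_of_real \<alpha> * x + complex_of_real \<beta> * y)" for x y
  have [measurable]: "case_prod F \<in> borel_measurable (borel \<Otimes>\<^sub>M borel)"
    unfolding F_def by measurable
  have "(\<integral>\<^sup>+x. \<integral>\<^sup>+y. f ((cmod x)\<^sup>2 + (cmod y)\<^sup>2) (a * x + b * y) \<partial>CN 0 1 \<partial>CN 0 1)
      = (\<integral>\<^sup>+x. \<integral>\<^sup>+y. F (u * x) (v * y) \<partial>CN 0 1 \<partial>CN 0 1)"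
    unfolding F_def \<alpha>_def \<beta>_def using u v by (simp add: norm_mult flip: mult.assoc)
  also have "\<dots> = (\<integral>\<^sup>+x. \<integral>\<^sup>+y. F (u * x) y \<partial>CN 0 1 \<partial>CN 0 1)"
    by (intro nn_integral_cong nn_integral_CN01_rotate v) measurable
  also have "\<dots> = (\<integral>\<^sup>+x. \<integral>\<^sup>+y. F x y \<partial>CN 0 1 \<partial>CN 0 1)"
    by (rule nn_integral_CN01_rotate[OF _ u(1), of "\<lambda>x. \<integral>\<^sup>+y. F x y \<partial>CN 0 1"]) measurable
  also have "\<dots> = (\<integral>\<^sup>+x. \<integral>\<^sup>+y. f ((cmod x)\<^sup>2 + (cmod y)\<^sup>2) (complex_of_real r * x) \<partial>CN 0 1 \<partial>CN 0 1)"
  proof (cases "r = 0")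
    \<comment> \<open>No angle is defined here, but both coefficients vanish.\<close>
    case True
    then have "\<alpha> = 0" "\<beta> = 0" by (auto simp: r_def sum_power2_eq_zero_iff)
    then show ?thesis using True by (simp add: F_def)
  next
    case False
    define c s where "c = \<alpha> / r" and "s = \<beta> / r"
    have r2: "r\<^sup>2 = \<alpha>\<^sup>2 + \<beta>\<^sup>2" by (simp add: r_def)
    have "c\<^sup>2 + s\<^sup>2 = r\<^sup>2 / r\<^sup>2"
      by (simp add: c_def s_def power_divide r2 flip: add_divide_distrib)
    then have cs: "c\<^sup>2 + s\<^sup>2 = 1" using False by simp
    define D where "D x y = ennreal (exp (- ((cmod x)\<^sup>2 + (cmod y)\<^sup>2)) / pi\<^sup>2)" for x y :: complex
    have [measurable]: "case_prod D \<in> borel_measurable (borel \<Otimes>\<^sub>M borel)"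
      unfolding D_def by measurable
    have Frot: "F (c *\<^sub>R x - s *\<^sub>R y) (s *\<^sub>R x + c *\<^sub>R y) = f ((cmod x)\<^sup>2 + (cmod y)\<^sup>2) (complex_of_real r * x)" for x y
    proof -
      have "\<alpha> = r * c" "\<beta> = r * s" using False by (auto simp: c_def s_def)
      then have "complex_of_real \<alpha> * (c *\<^sub>R x - s *\<^sub>R y) + complex_of_real \<beta> * (s *\<^sub>R x + c *\<^sub>R y)
         = complex_of_real (c\<^sup>2 + s\<^sup>2) * (complex_of_real r * x)"
        by (simp add: scaleR_conv_of_real algebra_simps power2_eq_square)
      then show ?thesis unfolding F_def cs cmod_sq_rotation[OF cs] by simp
    qed
    have Drot: "D (c *\<^sub>R x - s *\<^sub>R y) (s *\<^sub>R x + c *\<^sub>R y) = D x y" for x y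
      unfolding D_def cmod_sq_rotation[OF cs] ..
    have "(\<integral>\<^sup>+x. \<integral>\<^sup>+y. F x y \<partial>CN 0 1 \<partial>CN 0 1) = (\<integral>\<^sup>+x. \<integral>\<^sup>+y. D x y * F x y \<partial>lborel \<partial>lborel)"
      unfolding D_def by (rule nn_integral_CN01_pair) measurable
    also have "\<dots> = (\<integral>\<^sup>+x. \<integral>\<^sup>+y. D (c *\<^sub>R x - s *\<^sub>R y) (s *\<^sub>R x + c *\<^sub>R y) * F (c *\<^sub>R x - s *\<^sub>R y) (s *\<^sub>R x + c *\<^sub>R y) \<partial>lborel \<partial>lborel)"
      by (rule nn_integral_lborel_rotation[OF _ cs, of "\<lambda>x y. D x y * F x y", symmetric])
         (unfold borel_prod[symmetric], measurable)
    also have "\<dots> = (\<integral>\<^sup>+x. \<integral>\<^sup>+y. D x y * f ((cmod x)\<^sup>2 + (cmod y)\<^sup>2) (complex_of_real r * x) \<partial>lborel \<partial>lborel)"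
      by (simp add: Drot Frot)
    also have "\<dots> = (\<integral>\<^sup>+x. \<integral>\<^sup>+y. f ((cmod x)\<^sup>2 + (cmod y)\<^sup>2) (complex_of_real r * x) \<partial>CN 0 1 \<partial>CN 0 1)"
      unfolding D_def by (rule nn_integral_CN01_pair[symmetric]) measurable
    finally show ?thesis .
  qed
  finally show ?thesis by (simp add: r_def \<alpha>_def \<beta>_def)
qed

section \<open>Squared norm and inner product of coordinate vectors\<close>

lemma measurable_cnj[measurable]: "cnj \<in> borel_measurable borel"
  by (intro borel_measurable_continuous_onI continuous_intros)

lemma measurable_sqnorm[measurable]: "sqnorm n \<in> borel_measurable (PiM {..<n} (\<lambda>_. borel))"
  unfolding sqnorm_def[abs_def] by measurable

lemma sqnorm_nonneg: "sqnorm n y \<ge> 0"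
  by (simp add: sqnorm_def sum_nonneg)

definition cinner :: "nat \<Rightarrow> (nat \<Rightarrow> complex) \<Rightarrow> (nat \<Rightarrow> complex) \<Rightarrow> complex" where
  "cinner n x y = (\<Sum>i<n. cnj (x i) * y i)"

lemma measurable_cinner[measurable (raw)]:
  assumes f: "f \<in> M \<rightarrow>\<^sub>M PiM {..<n} (\<lambda>_. borel)" and g: "g \<in> M \<rightarrow>\<^sub>M PiM {..<n} (\<lambda>_. borel)"
  shows "(\<lambda>a. cinner n (f a) (g a)) \<in> borel_measurable M"
proof -
  have 1: "(\<lambda>a. f a i) \<in> borel_measurable M" "(\<lambda>a. g a i) \<in> borel_measurable M" if "i < n" for i
    using that by (auto intro!: measurable_compose[OF f] measurable_compose[OF g] measurable_component_singleton)
  show ?thesis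
    unfolding cinner_def using 1
    by (auto intro!: borel_measurable_sum borel_measurable_times measurable_compose[OF _ measurable_cnj])
qed

lemma measurable_cinner_const[measurable]:
  "cinner n u \<in> borel_measurable (PiM {..<n} (\<lambda>_. borel))"
  unfolding cinner_def by measurable

lemma cinner_lincomb_right:
  "cinner n x (\<lambda>i. h * y i + z i) = h * cinner n x y + cinner n x z"
  by (simp add: cinner_def sum.distrib sum_distrib_left algebra_simps)

lemma cinner_self: "cinner n x x = complex_of_real (sqnorm n x)"
  unfolding cinner_def sqnorm_def of_real_sum
  by (intro sum.cong refl) (simp only: complex_norm_square mult.commute)

text \<open>Rearranges the integral so that coordinate 0 and the added coordinate \<open>y\<close>
  are innermost and adjacent, ready for a two-coordinate rotation, while the energy of the other
  coordinates is held fixed outside.\<close>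

lemma nn_integral_CN_std_vec_split:
  assumes [measurable]: "g \<in> borel_measurable (borel \<Otimes>\<^sub>M borel \<Otimes>\<^sub>M borel)" and n: "n \<ge> 1"
  shows "(\<integral>\<^sup>+y. \<integral>\<^sup>+w. g (sqnorm n w + (cmod y)\<^sup>2, w 0, y) \<partial>CN_std_vec n \<partial>CN 0 1)
    = (\<integral>\<^sup>+w. \<integral>\<^sup>+x. \<integral>\<^sup>+y. g ((\<Sum>i\<in>{1..<n}. (cmod (w i))\<^sup>2) + ((cmod x)\<^sup>2 + (cmod y)\<^sup>2), x, y)
          \<partial>CN 0 1 \<partial>CN 0 1 \<partial>PiM {1..<n} (\<lambda>_. CN 0 1))"
proof -
  have I: "{..<n} = insert 0 {1..<n}" using n by auto
  interpret P: prob_space "PiM {1..<n} (\<lambda>_::nat. CN 0 1)"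
    by (rule prob_space_PiM) (rule prob_space_CN01)
  have [measurable_cong]: "sets (PiM {1..<n} (\<lambda>_. CN 0 1)) = sets (PiM {1..<n} (\<lambda>_. borel :: complex measure))"
    by (auto intro!: sets_PiM_cong)
  have [simp]: "0 < n" using n by simp
  define T where "T w = (\<Sum>i\<in>{1..<n}. (cmod (w i :: complex))\<^sup>2)" for w
  have [measurable]: "T \<in> borel_measurable (PiM {1..<n} (\<lambda>_. borel))"
    unfolding T_def by measurable
  have "(\<integral>\<^sup>+w. g (sqnorm n w + (cmod y)\<^sup>2, w 0, y) \<partial>CN_std_vec n)
      = (\<integral>\<^sup>+w. \<integral>\<^sup>+x. g (T w + ((cmod x)\<^sup>2 + (cmod y)\<^sup>2), x, y) \<partial>CN 0 1 \<partial>PiM {1..<n} (\<lambda>_. CN 0 1))" for y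
  proof -
    have m: "(\<lambda>w. g (sqnorm n w + (cmod y)\<^sup>2, w 0, y)) \<in> borel_measurable (PiM (insert 0 {1..<n}) (\<lambda>_. CN 0 1))"
      unfolding I[symmetric] CN_std_vec_def[symmetric]
      by measurable
    have s: "sqnorm n (w(0 := x)) = (cmod x)\<^sup>2 + T w" for w x
      unfolding sqnorm_def I T_def by simp
    show ?thesis
      unfolding CN_std_vec_def I
      by (subst CN01_prod.product_nn_integral_insert[OF _ _ m])
         (auto simp: s ac_simps)
  qed
  then have "(\<integral>\<^sup>+y. \<integral>\<^sup>+w. g (sqnorm n w + (cmod y)\<^sup>2, w 0, y) \<partial>CN_std_vec n \<partial>CN 0 1)
    = (\<integral>\<^sup>+y. \<integral>\<^sup>+w. \<integral>\<^sup>+x. g (T w + ((cmod x)\<^sup>2 + (cmod y)\<^sup>2), x, y) \<partial>CN 0 1 \<partial>PiM {1..<n} (\<lambda>_. CN 0 1) \<partial>CN 0 1)"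
    by simp
  also have "\<dots> = (\<integral>\<^sup>+w. \<integral>\<^sup>+y. \<integral>\<^sup>+x. g (T w + ((cmod x)\<^sup>2 + (cmod y)\<^sup>2), x, y) \<partial>CN 0 1 \<partial>CN 0 1 \<partial>PiM {1..<n} (\<lambda>_. CN 0 1))"
    by (rule pair_sigma_finite.Fubini') (unfold_locales, measurable)
  also have "\<dots> = (\<integral>\<^sup>+w. \<integral>\<^sup>+x. \<integral>\<^sup>+y. g (T w + ((cmod x)\<^sup>2 + (cmod y)\<^sup>2), x, y) \<partial>CN 0 1 \<partial>CN 0 1 \<partial>PiM {1..<n} (\<lambda>_. CN 0 1))"
    by (rule nn_integral_cong, rule pair_sigma_finite.Fubini') (unfold_locales, measurable)
  finally show ?thesis unfolding T_def .
qed

text \<open>Unitary invariance of the standard complex Gaussian. Each induction step is a rotation that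
  merges one more coordinate into coordinate 0.\<close>
lemma nn_integral_CN_std_vec_rotate:
  assumes "case_prod f \<in> borel_measurable (borel \<Otimes>\<^sub>M borel)" and "n \<ge> 1"
  shows "(\<integral>\<^sup>+w. f (sqnorm n w) (cinner n u w) \<partial>CN_std_vec n)
       = (\<integral>\<^sup>+w. f (sqnorm n w) (complex_of_real (sqrt (sqnorm n u)) * w 0) \<partial>CN_std_vec n)"
  using assms(2,1)
proof (induction n arbitrary: f rule: nat_induct_at_least)
  \<comment> \<open>In dimension one only the phase of \<open>u 0\<close> has to be removed.\<close>
  case base
  note [measurable] = base
  have *: "{..<1::nat} = {0}" by auto
  obtain v where v: "cmod v = 1" "cnj (u 0) = complex_of_real (cmod (u 0)) * v"
    using complex_cmod_times_unit[of "cnj (u 0)"] by auto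
  define F where "F x = f ((cmod x)\<^sup>2) (complex_of_real (cmod (u 0)) * x)" for x
  have [measurable]: "F \<in> borel_measurable borel"
    unfolding F_def by measurable
  have vF: "f ((cmod x)\<^sup>2) (cnj (u 0) * x) = F (v * x)" for x
    unfolding F_def using v by (simp add: norm_mult flip: mult.assoc)
  have "(\<integral>\<^sup>+w. F (v * w 0) \<partial>PiM {0::nat} (\<lambda>_. CN 0 1)) = (\<integral>\<^sup>+w. F (w 0) \<partial>PiM {0::nat} (\<lambda>_. CN 0 1))"
    by (subst (1 2) CN01_prod.product_nn_integral_singleton) (simp_all add: nn_integral_CN01_rotate v)
  then show ?case
    by (simp add: CN_std_vec_def sqnorm_def cinner_def *[simplified] vF) (simp add: F_def)
next
  case (Suc n)
  note [measurable] = Suc.prems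
  have I: "{..<Suc n} = insert n {..<n}" by auto
  define r where "r = complex_of_real (sqrt (sqnorm n u))"
  have cr: "cmod r = sqrt (sqnorm n u)" by (simp add: r_def sqnorm_nonneg)
  have split: "(\<integral>\<^sup>+w. h w \<partial>CN_std_vec (Suc n)) = (\<integral>\<^sup>+y. \<integral>\<^sup>+w. h (w(n := y)) \<partial>CN_std_vec n \<partial>CN 0 1)"
    if "h \<in> borel_measurable (CN_std_vec (Suc n))" for h
    using that unfolding CN_std_vec_def I
    by (subst CN01_prod.product_nn_integral_insert_rev) auto
  have sq: "sqnorm (Suc n) (w(n := y)) = sqnorm n w + (cmod y)\<^sup>2" for w y
    by (simp add: sqnorm_def)
  have ip: "cinner (Suc n) u (w(n := y)) = cinner n u w + cnj (u n) * y" for w y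
    by (simp add: cinner_def)
  have "(\<integral>\<^sup>+w. f (sqnorm (Suc n) w) (cinner (Suc n) u w) \<partial>CN_std_vec (Suc n))
    = (\<integral>\<^sup>+y. \<integral>\<^sup>+w. f (sqnorm n w + (cmod y)\<^sup>2) (cinner n u w + cnj (u n) * y) \<partial>CN_std_vec n \<partial>CN 0 1)"
    by (subst split) (measurable, simp add: sq ip)
  \<comment> \<open>The induction hypothesis, applied with the last coordinate frozen, concentrates
    the first \<open>n\<close> coordinates of \<open>u\<close> in coordinate 0 with weight
    \<open>r\<close>.\<close>
  also have "\<dots> = (\<integral>\<^sup>+y. \<integral>\<^sup>+w. f (sqnorm n w + (cmod y)\<^sup>2) (r * w 0 + cnj (u n) * y) \<partial>CN_std_vec n \<partial>CN 0 1)"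
    unfolding r_def by (intro nn_integral_cong Suc.IH[of "\<lambda>t z. f (t + (cmod y)\<^sup>2) (z + cnj (u n) * y)" for y]) measurable
  also have "\<dots> = (\<integral>\<^sup>+w. \<integral>\<^sup>+x. \<integral>\<^sup>+y. f ((\<Sum>i\<in>{1..<n}. (cmod (w i))\<^sup>2) + ((cmod x)\<^sup>2 + (cmod y)\<^sup>2)) (r * x + cnj (u n) * y)
          \<partial>CN 0 1 \<partial>CN 0 1 \<partial>PiM {1..<n} (\<lambda>_. CN 0 1))"
    by (rule nn_integral_CN_std_vec_split[OF _ Suc.hyps, of "\<lambda>(t, x, y). f t (r * x + cnj (u n) * y)", unfolded prod.case]) measurable
  also have "\<dots> = (\<integral>\<^sup>+w. \<integral>\<^sup>+x. \<integral>\<^sup>+y. f ((\<Sum>i\<in>{1..<n}. (cmod (w i))\<^sup>2) + ((cmod x)\<^sup>2 + (cmod y)\<^sup>2))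
            (complex_of_real (sqrt ((cmod r)\<^sup>2 + (cmod (u n))\<^sup>2)) * x)
          \<partial>CN 0 1 \<partial>CN 0 1 \<partial>PiM {1..<n} (\<lambda>_. CN 0 1))"
  proof (rule nn_integral_cong)
    fix w :: "nat \<Rightarrow> complex"
    define S where "S = (\<Sum>i\<in>{1..<n}. (cmod (w i))\<^sup>2)"
    show "(\<integral>\<^sup>+x. \<integral>\<^sup>+y. f ((\<Sum>i\<in>{1..<n}. (cmod (w i))\<^sup>2) + ((cmod x)\<^sup>2 + (cmod y)\<^sup>2)) (r * x + cnj (u n) * y)
          \<partial>CN 0 1 \<partial>CN 0 1) = (\<integral>\<^sup>+x. \<integral>\<^sup>+y. f ((\<Sum>i\<in>{1..<n}. (cmod (w i))\<^sup>2) + ((cmod x)\<^sup>2 + (cmod y)\<^sup>2))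
            (complex_of_real (sqrt ((cmod r)\<^sup>2 + (cmod (u n))\<^sup>2)) * x) \<partial>CN 0 1 \<partial>CN 0 1)"
      unfolding S_def[symmetric]
      using nn_integral_CN01_pair_rotate[of "\<lambda>t z. f (S + t) z" r "cnj (u n)"] by simp
  qed
  also have "\<dots> = (\<integral>\<^sup>+y. \<integral>\<^sup>+w. f (sqnorm n w + (cmod y)\<^sup>2) (complex_of_real (sqrt ((cmod r)\<^sup>2 + (cmod (u n))\<^sup>2)) * w 0) \<partial>CN_std_vec n \<partial>CN 0 1)"
    by (rule nn_integral_CN_std_vec_split[OF _ Suc.hyps, of "\<lambda>(t, x, y). f t (complex_of_real (sqrt ((cmod r)\<^sup>2 + (cmod (u n))\<^sup>2)) * x)", unfolded prod.case, symmetric])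
       measurable
  also have "\<dots> = (\<integral>\<^sup>+w. f (sqnorm (Suc n) w) (complex_of_real (sqrt ((cmod r)\<^sup>2 + (cmod (u n))\<^sup>2)) * w 0) \<partial>CN_std_vec (Suc n))"
    using Suc.hyps by (subst split) (measurable, auto simp: sq)
  also have "(cmod r)\<^sup>2 + (cmod (u n))\<^sup>2 = sqnorm (Suc n) u"
    by (simp add: cr sqnorm_def sum_nonneg)
  finally show ?case .
qed

section \<open>Exponential moments on the sphere\<close>

lemma nn_integral_Gamma_scaled:
  assumes c: "c > 0"
  shows "(\<integral>\<^sup>+x. ennreal (x ^ k * exp (- c * x)) * indicator {0<..} x \<partial>lborel) = ennreal (fact k / c ^ (k + 1))"
proof -
  \<comment> \<open>The point 0 is null, so the closed half-line of the factorial integral may be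
    exchanged for the open one.\<close>
  have ind: "(\<integral>\<^sup>+x. ennreal (f x) * indicator {0<..} x \<partial>lborel) = (\<integral>\<^sup>+x. ennreal (f x) * indicator {0..} x \<partial>lborel)"
    for f :: "real \<Rightarrow> real"
    using AE_lborel_singleton[of "0::real"]
    by (intro nn_integral_cong_AE) (auto elim!: eventually_mono split: split_indicator)
  define I where "I = (\<integral>\<^sup>+x. ennreal (x ^ k * exp (- c * x)) * indicator {0..} x \<partial>lborel)"
  have "ennreal (fact k) = (\<integral>\<^sup>+x. ennreal (x ^ k * exp (- x)) * indicator {0..} x \<partial>lborel)"
    using nn_intergal_power_times_exp_Ici[of k] by simp
  also have "\<dots> = ennreal c * (\<integral>\<^sup>+x. ennreal ((0 + c * x) ^ k * exp (- (0 + c * x))) * indicator {0..} (0 + c * x) \<partial>lborel)"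
    using c by (subst nn_integral_real_affine[of _ c 0]) auto
  also have "(\<integral>\<^sup>+x. ennreal ((0 + c * x) ^ k * exp (- (0 + c * x))) * indicator {0..} (0 + c * x) \<partial>lborel)
      = (\<integral>\<^sup>+x. ennreal (c ^ k) * (ennreal (x ^ k * exp (- c * x)) * indicator {0..} x) \<partial>lborel)"
  proof (rule nn_integral_cong)
    fix x
    show "ennreal ((0 + c * x) ^ k * exp (- (0 + c * x))) * indicator {0..} (0 + c * x)
       = ennreal (c ^ k) * (ennreal (x ^ k * exp (- c * x)) * indicator {0..} x)"
      using c by (auto simp: indicator_def zero_le_mult_iff power_mult_distrib ennreal_mult'[symmetric] mult.assoc
          simp del: ennreal_power)
  qed
  also have "\<dots> = ennreal (c ^ k) * I"
    unfolding I_def by (subst nn_integral_cmult) auto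
  finally have e: "ennreal (fact k) = ennreal (c ^ (k + 1)) * I"
    using c by (simp add: ennreal_mult mult.assoc del: ennreal_power)
  have "ennreal (fact k / c ^ (k + 1)) = ennreal (1 / c ^ (k + 1)) * ennreal (fact k)"
    using c by (simp flip: ennreal_mult')
  also have "\<dots> = (ennreal (1 / c ^ (k + 1)) * ennreal (c ^ (k + 1))) * I"
    unfolding e by (simp add: mult.assoc)
  also have "ennreal (1 / c ^ (k + 1)) * ennreal (c ^ (k + 1)) = 1"
    using c by (subst ennreal_mult'[symmetric]) auto
  finally show ?thesis unfolding ind I_def by simp
qed

text \<open>The Beta integral, from two Gamma integrals and Tonelli.\<close>
lemma nn_integral_Beta_prime:
  "(\<integral>\<^sup>+s. ennreal (s ^ k / (1 + s) ^ (k + n + 2)) * indicator {0<..} s \<partial>lborel)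
    = ennreal (fact k * fact n / fact (k + n + 1))"
proof -
  \<comment> \<open>The denominator has exponent \<open>?N + 1\<close>, so it is a Gamma integral in
    a new variable \<open>u\<close> with power \<open>u ^ ?N\<close>. After the exchange, the
    integral over \<open>s\<close> contributes \<open>fact k / u ^ (k + 1)\<close> and leaves
    \<open>u ^ n\<close>.\<close>
  let ?N = "k + n + 1"
  have "(\<integral>\<^sup>+s. ennreal (s ^ k / (1 + s) ^ (k + n + 2)) * indicator {0<..} s \<partial>lborel)
     = (\<integral>\<^sup>+s. (\<integral>\<^sup>+u. ennreal (1 / fact ?N) * (ennreal (s ^ k * exp (- u * s)) * indicator {0<..} s)
          * (ennreal (u ^ ?N * exp (- u)) * indicator {0<..} u) \<partial>lborel) \<partial>lborel)"
  proof (rule nn_integral_cong)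
    fix s :: real
    show "ennreal (s ^ k / (1 + s) ^ (k + n + 2)) * indicator {0<..} s
       = (\<integral>\<^sup>+u. ennreal (1 / fact ?N) * (ennreal (s ^ k * exp (- u * s)) * indicator {0<..} s)
          * (ennreal (u ^ ?N * exp (- u)) * indicator {0<..} u) \<partial>lborel)"
    proof (cases "s > 0")
      case True
      have "(\<integral>\<^sup>+u. ennreal (1 / fact ?N) * (ennreal (s ^ k * exp (- u * s)) * indicator {0<..} s)
          * (ennreal (u ^ ?N * exp (- u)) * indicator {0<..} u) \<partial>lborel)
        = (\<integral>\<^sup>+u. ennreal (s ^ k / fact ?N) * (ennreal (u ^ ?N * exp (- (1 + s) * u)) * indicator {0<..} u) \<partial>lborel)"
        using True
        by (intro nn_integral_cong)
           (auto simp: indicator_def ennreal_mult'[symmetric] ring_distribs exp_add exp_diff exp_minus field_simps)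
      also have "\<dots> = ennreal (s ^ k / fact ?N) * ennreal (fact ?N / (1 + s) ^ (?N + 1))"
        using True by (subst nn_integral_cmult) (auto simp only: nn_integral_Gamma_scaled, measurable)
      also have "\<dots> = ennreal (s ^ k / (1 + s) ^ (k + n + 2))"
        using True by (subst ennreal_mult'[symmetric]) (auto simp del: fact_Suc power_Suc)
      finally show ?thesis using True by simp
    qed simp
  qed
  also have "\<dots> = (\<integral>\<^sup>+u. (\<integral>\<^sup>+s. ennreal (1 / fact ?N) * (ennreal (s ^ k * exp (- u * s)) * indicator {0<..} s)
          * (ennreal (u ^ ?N * exp (- u)) * indicator {0<..} u) \<partial>lborel) \<partial>lborel)"
    by (rule lborel_pair.Fubini') measurable
  also have "\<dots> = (\<integral>\<^sup>+u. ennreal (fact k / fact ?N) * (ennreal (u ^ n * exp (- 1 * u)) * indicator {0<..} u) \<partial>lborel)"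
  proof (rule nn_integral_cong)
    fix u :: real
    show "(\<integral>\<^sup>+s. ennreal (1 / fact ?N) * (ennreal (s ^ k * exp (- u * s)) * indicator {0<..} s)
          * (ennreal (u ^ ?N * exp (- u)) * indicator {0<..} u) \<partial>lborel)
       = ennreal (fact k / fact ?N) * (ennreal (u ^ n * exp (- 1 * u)) * indicator {0<..} u)"
    proof (cases "u > 0")
      case True
      have "(\<integral>\<^sup>+s. ennreal (1 / fact ?N) * (ennreal (s ^ k * exp (- u * s)) * indicator {0<..} s)
          * (ennreal (u ^ ?N * exp (- u)) * indicator {0<..} u) \<partial>lborel)
        = ennreal (1 / fact ?N) * ennreal (fact k / u ^ (k + 1)) * ennreal (u ^ ?N * exp (- u))"
        using True by (subst nn_integral_multc, measurable, subst nn_integral_cmult, measurable)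
                      (simp only: nn_integral_Gamma_scaled, simp)
      also have "\<dots> = ennreal (1 / fact ?N * (fact k / u ^ (k + 1)) * (u ^ ?N * exp (- u)))"
        using True by (simp only: ennreal_mult'' zero_le_divide_iff zero_le_mult_iff zero_le_power less_imp_le exp_ge_zero fact_ge_zero simp_thms)
      also have "1 / fact ?N * (fact k / u ^ (k + 1)) * (u ^ ?N * exp (- u)) = fact k / fact ?N * (u ^ n * exp (- 1 * u))"
        using True by (simp add: power_add field_simps del: fact_Suc)
      also have "ennreal \<dots> = ennreal (fact k / fact ?N) * ennreal (u ^ n * exp (- 1 * u))"
        by (rule ennreal_mult') simp
      finally show ?thesis using True by simp
    qed simp
  qed
  also have "\<dots> = ennreal (fact k / fact ?N) * ennreal (fact n / 1 ^ (n + 1))"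
    by (subst nn_integral_cmult, measurable) (simp only: nn_integral_Gamma_scaled zero_less_one)
  also have "\<dots> = ennreal (fact k * fact n / fact (k + n + 1))"
    by (subst ennreal_mult'[symmetric]) auto
  finally show ?thesis .
qed

text \<open>The hypergeometric function 0F1(; n; x). It is the modified Bessel function of order
  \<open>n - 1\<close> at \<open>2 * sqrt x\<close>, freed from its leading power, so that no
  quotient degenerates at \<open>x = 0\<close>.\<close>

definition sph_exp :: "nat \<Rightarrow> real \<Rightarrow> real" where
  "sph_exp n x = (\<Sum>m. x ^ m * fact (n - 1) / (fact m * fact (m + n - 1)))"

lemma summable_sph_exp:
  fixes x :: real
  assumes "x \<ge> 0"
  shows "summable (\<lambda>m. x ^ m * fact (n - 1) / (fact m * fact (m + n - 1)))"
proof (rule summable_comparison_test')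
  show "summable (\<lambda>m. fact (n - 1) * (inverse (fact m) * x ^ m))"
    by (intro summable_mult summable_exp)
  fix m :: nat
  have "x ^ m * fact (n - 1) / (fact m * fact (m + n - 1)) \<le> x ^ m * fact (n - 1) / (fact m * 1)"
    using assms by (intro divide_left_mono mult_left_mono) auto
  then show "norm (x ^ m * fact (n - 1) / (fact m * fact (m + n - 1))) \<le> fact (n - 1) * (inverse (fact m) * x ^ m)"
    using assms by (simp add: field_simps)
qed

lemma sph_exp_nonneg: "x \<ge> 0 \<Longrightarrow> sph_exp n x \<ge> 0"
  unfolding sph_exp_def by (intro suminf_nonneg summable_sph_exp) auto

lemma measurable_sph_exp[measurable]: "sph_exp n \<in> borel_measurable borel"
  unfolding sph_exp_def[abs_def] by measurable

text \<open>The weight merges with the density of \<open>CN 0 1\<close> into a Gaussian with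
  coefficient \<open>1 + s\<close>.\<close>

lemma nn_integral_CN_gauss_weight:
  assumes s: "s \<ge> 0"
  shows "(\<integral>\<^sup>+z. ennreal ((2 * Re z) ^ (2 * m) * exp (- s * (cmod z)\<^sup>2)) \<partial>CN 0 1)
       = ennreal (fact (2 * m) / (fact m * (1 + s) ^ (m + 1)))"
proof -
  have "(\<integral>\<^sup>+z. ennreal ((2 * Re z) ^ (2 * m) * exp (- s * (cmod z)\<^sup>2)) \<partial>CN 0 1)
     = (\<integral>\<^sup>+z. ennreal (1 / pi) * ennreal ((2 * Re z) ^ (2 * m) * exp (- (1 + s) * (cmod z)\<^sup>2)) \<partial>lborel)"
  proof (subst nn_integral_CN, measurable, rule nn_integral_cong)
    fix z
    have e: "exp (- (1 + s) * (cmod z)\<^sup>2) = exp (- (cmod z)\<^sup>2) * exp (- s * (cmod z)\<^sup>2)"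
      by (simp add: algebra_simps flip: exp_add)
    show "ennreal (exp (- (cmod (z - 0))\<^sup>2 / 1) / (pi * 1)) * ennreal ((2 * Re z) ^ (2 * m) * exp (- s * (cmod z)\<^sup>2))
        = ennreal (1 / pi) * ennreal ((2 * Re z) ^ (2 * m) * exp (- (1 + s) * (cmod z)\<^sup>2))"
      unfolding e by (subst (1 2) ennreal_mult'[symmetric]) (auto simp: mult_ac)
  qed
  also have "\<dots> = ennreal (1 / pi) * ennreal (pi * fact (2 * m) / (fact m * (1 + s) ^ (m + 1)))"
    using s by (subst nn_integral_cmult, measurable) (subst nn_integral_complex_gauss_moment, auto)
  also have "\<dots> = ennreal (fact (2 * m) / (fact m * (1 + s) ^ (m + 1)))"
    by (subst ennreal_mult'[symmetric]) auto
  finally show ?thesis .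
qed

lemma nn_integral_CN_std_vec_gauss_weight:
  assumes s: "s \<ge> 0" and n: "n \<ge> 1"
  shows "(\<integral>\<^sup>+g. ennreal ((2 * Re (g 0)) ^ (2 * m) * exp (- s * sqnorm n g)) \<partial>CN_std_vec n)
       = ennreal (fact (2 * m) / (fact m * (1 + s) ^ (m + n)))"
proof -
  \<comment> \<open>A single formula for all coordinates, with the power attached to coordinate 0
    only, so that the integral of a product applies.\<close>
  define f where "f i z = ennreal ((2 * Re z) ^ (2 * (if i = 0 then m else 0)) * exp (- s * (cmod z)\<^sup>2))" for i :: nat and z
  have I: "{..<n} = insert 0 {1..<n}" using n by auto
  have [measurable]: "f i \<in> borel_measurable borel" for i unfolding f_def by measurable
  have "ennreal ((2 * Re (g 0)) ^ (2 * m) * exp (- s * sqnorm n g)) = (\<Prod>i<n. f i (g i))" for g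
  proof -
    have "(\<Prod>i<n. f i (g i)) = ennreal (\<Prod>i<n. (2 * Re (g i)) ^ (2 * (if i = 0 then m else 0)) * exp (- s * (cmod (g i))\<^sup>2))"
      unfolding f_def by (intro prod_ennreal) auto
    also have "(\<Prod>i<n. (2 * Re (g i)) ^ (2 * (if i = 0 then m else 0)) * exp (- s * (cmod (g i))\<^sup>2))
        = (\<Prod>i<n. (2 * Re (g i)) ^ (2 * (if i = 0 then m else 0))) * exp (- s * sqnorm n g)"
      by (simp add: prod.distrib sqnorm_def sum_distrib_left flip: exp_sum sum_negf)
    also have "(\<Prod>i<n. (2 * Re (g i)) ^ (2 * (if i = 0 then m else 0))) = (2 * Re (g 0)) ^ (2 * m)"
      unfolding I by (simp add: prod.If_cases)
    finally show ?thesis by simp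
  qed
  then have "(\<integral>\<^sup>+g. ennreal ((2 * Re (g 0)) ^ (2 * m) * exp (- s * sqnorm n g)) \<partial>CN_std_vec n)
     = (\<integral>\<^sup>+g. (\<Prod>i<n. f i (g i)) \<partial>PiM {..<n} (\<lambda>_. CN 0 1))"
    unfolding CN_std_vec_def by simp
  also have "\<dots> = (\<Prod>i<n. \<integral>\<^sup>+z. f i z \<partial>CN 0 1)"
    by (rule CN01_prod.product_nn_integral_prod) auto
  also have "\<dots> = (\<Prod>i<n. ennreal (fact (2 * (if i = 0 then m else 0)) / (fact (if i = 0 then m else 0) * (1 + s) ^ ((if i = 0 then m else 0) + 1))))"
    unfolding f_def by (intro prod.cong refl nn_integral_CN_gauss_weight s)
  also have "\<dots> = ennreal (\<Prod>i<n. (fact (2 * (if i = 0 then m else 0)) / (fact (if i = 0 then m else 0) * (1 + s) ^ ((if i = 0 then m else 0) + 1))))"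
    using s by (intro prod_ennreal) auto
  also have "(\<Prod>i<n. (fact (2 * (if i = 0 then m else 0)) / (fact (if i = 0 then m else 0) * (1 + s) ^ ((if i = 0 then m else 0) + 1))))
      = fact (2 * m) / (fact m * (1 + s) ^ (m + 1)) * (1 / (1 + s)) ^ (n - 1)"
    unfolding I by (simp add: prod.If_cases)
  also have "\<dots> = fact (2 * m) / (fact m * (1 + s) ^ (m + n))"
    using n s by (cases n) (simp_all add: power_divide power_add)
  finally show ?thesis .
qed

text \<open>Negative powers of the norm are Laplace transforms, which makes the integrand a product over
  coordinates.\<close>
lemma nn_integral_CN_std_vec_direction_moment:
  assumes n: "n \<ge> 1"
  shows "(\<integral>\<^sup>+g. ennreal ((2 * Re (g 0)) ^ (2 * m) / sqnorm n g ^ m) \<partial>CN_std_vec n)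
       = ennreal (fact (2 * m) / fact m * (fact (n - 1) / fact (m + n - 1)))"
proof (cases m)
  case 0
  interpret prob_space "CN_std_vec n" by (rule prob_space_CN_std_vec)
  show ?thesis by (simp add: 0 emeasure_space_1)
next
  \<comment> \<open>The inverse power of order \<open>k + 1\<close> is the Laplace transform of
    \<open>s ^ k / fact k\<close>; order 0 has no such form and is the total mass above.\<close>
  case (Suc k)
  interpret prob_space "CN_std_vec n" by (rule prob_space_CN_std_vec)
  have [simp]: "0 < n" using n by simp
  have "(\<integral>\<^sup>+g. ennreal ((2 * Re (g 0)) ^ (2 * m) / sqnorm n g ^ m) \<partial>CN_std_vec n)
     = (\<integral>\<^sup>+g. \<integral>\<^sup>+s. ennreal (s ^ k / fact k) * indicator {0<..} s * ennreal ((2 * Re (g 0)) ^ (2 * m) * exp (- s * sqnorm n g)) \<partial>lborel \<partial>CN_std_vec n)"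
  proof (rule nn_integral_cong)
    fix g :: "nat \<Rightarrow> complex"
    show "ennreal ((2 * Re (g 0)) ^ (2 * m) / sqnorm n g ^ m)
      = (\<integral>\<^sup>+s. ennreal (s ^ k / fact k) * indicator {0<..} s * ennreal ((2 * Re (g 0)) ^ (2 * m) * exp (- s * sqnorm n g)) \<partial>lborel)"
    proof (cases "sqnorm n g = 0")
      \<comment> \<open>The Laplace integral has no decay at the origin, but \<open>g 0 = 0\<close>
        and \<open>m > 0\<close> make both integrands 0.\<close>
      case True
      then have "\<forall>i<n. g i = 0"
        by (auto simp: sqnorm_def sum_nonneg_eq_0_iff)
      then have "g 0 = 0" by simp
      then show ?thesis using Suc by simp
    next
      case False
      then have pos: "sqnorm n g > 0" using sqnorm_nonneg[of n g] by simp
      have "(\<integral>\<^sup>+s. ennreal (s ^ k / fact k) * indicator {0<..} s * ennreal ((2 * Re (g 0)) ^ (2 * m) * exp (- s * sqnorm n g)) \<partial>lborel)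
        = (\<integral>\<^sup>+s. ennreal ((2 * Re (g 0)) ^ (2 * m) / fact k) * (ennreal (s ^ k * exp (- sqnorm n g * s)) * indicator {0<..} s) \<partial>lborel)"
        by (intro nn_integral_cong) (auto simp: indicator_def ennreal_mult'[symmetric] mult_ac)
      also have "\<dots> = ennreal ((2 * Re (g 0)) ^ (2 * m) / fact k) * ennreal (fact k / sqnorm n g ^ (k + 1))"
        by (subst nn_integral_cmult, measurable) (simp only: nn_integral_Gamma_scaled pos)
      also have "\<dots> = ennreal ((2 * Re (g 0)) ^ (2 * m) / sqnorm n g ^ m)"
        using pos by (subst ennreal_mult'[symmetric], simp) (simp add: Suc)
      finally show ?thesis ..
    qed
  qed
  also have "\<dots> = (\<integral>\<^sup>+s. \<integral>\<^sup>+g. ennreal (s ^ k / fact k) * indicator {0<..} s * ennreal ((2 * Re (g 0)) ^ (2 * m) * exp (- s * sqnorm n g)) \<partial>CN_std_vec n \<partial>lborel)"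
    by (rule pair_sigma_finite.Fubini') (unfold_locales, measurable)
  \<comment> \<open>Since \<open>m = k + 1\<close>, the exponent \<open>m + n\<close> is
    \<open>k + (n - 1) + 2\<close>, and a Beta integral with second parameter \<open>n - 1\<close>
    appears.\<close>
  also have "\<dots> = (\<integral>\<^sup>+s. ennreal (fact (2 * m) / (fact m * fact k)) * (ennreal (s ^ k / (1 + s) ^ (k + (n - 1) + 2)) * indicator {0<..} s) \<partial>lborel)"
  proof (rule nn_integral_cong)
    fix s :: real
    show "(\<integral>\<^sup>+g. ennreal (s ^ k / fact k) * indicator {0<..} s * ennreal ((2 * Re (g 0)) ^ (2 * m) * exp (- s * sqnorm n g)) \<partial>CN_std_vec n)
      = ennreal (fact (2 * m) / (fact m * fact k)) * (ennreal (s ^ k / (1 + s) ^ (k + (n - 1) + 2)) * indicator {0<..} s)"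
    proof (cases "s > 0")
      case True
      have "(\<integral>\<^sup>+g. ennreal (s ^ k / fact k) * indicator {0<..} s * ennreal ((2 * Re (g 0)) ^ (2 * m) * exp (- s * sqnorm n g)) \<partial>CN_std_vec n)
        = ennreal (s ^ k / fact k) * indicator {0<..} s * ennreal (fact (2 * m) / (fact m * (1 + s) ^ (m + n)))"
        using True n by (subst nn_integral_cmult, measurable) (subst nn_integral_CN_std_vec_gauss_weight, auto)
      also have "\<dots> = ennreal (s ^ k / fact k * (fact (2 * m) / (fact m * (1 + s) ^ (m + n))))"
        using True by (simp add: ennreal_mult'[symmetric])
      also have "s ^ k / fact k * (fact (2 * m) / (fact m * (1 + s) ^ (m + n)))
          = fact (2 * m) / (fact m * fact k) * (s ^ k / (1 + s) ^ (k + (n - 1) + 2))"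
        using n by (simp add: Suc mult_ac del: fact_Suc)
      finally show ?thesis using True by (simp add: ennreal_mult'[symmetric] del: fact_Suc)
    qed simp
  qed
  also have "\<dots> = ennreal (fact (2 * m) / (fact m * fact k)) * ennreal (fact k * fact (n - 1) / fact (k + (n - 1) + 1))"
    by (subst nn_integral_cmult, measurable) (simp only: nn_integral_Beta_prime)
  also have "\<dots> = ennreal (fact (2 * m) / fact m * (fact (n - 1) / fact (m + n - 1)))"
    using n by (subst ennreal_mult'[symmetric]) (auto simp: Suc simp del: fact_Suc)
  finally show ?thesis .
qed

lemma cosh_sums_even: "(\<lambda>m. x ^ (2 * m) / fact (2 * m)) sums cosh (x :: real)"
proof -
  have "(\<lambda>m. if even (2 * m) then x ^ (2 * m) /\<^sub>R fact (2 * m) else 0) sums cosh x"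
    by (subst sums_mono_reindex[of "\<lambda>m. 2 * m" "\<lambda>n. if even n then x ^ n /\<^sub>R fact n else 0"])
       (auto simp: strict_mono_def cosh_converges elim!: evenE)
  then show ?thesis by (simp add: field_simps)
qed

text \<open>The direction of a Gaussian vector is uniform on the sphere. Symmetrising replaces the exponential
  by \<open>cosh\<close>, whose power series has nonnegative terms, so that sum and integral commute.\<close>
lemma nn_integral_CN_std_vec_direction_exp:
  assumes n: "n \<ge> 1"
  shows "(\<integral>\<^sup>+g. ennreal (exp (2 * Re (cinner n v g) / sqrt (sqnorm n g))) \<partial>CN_std_vec n)
       = ennreal (sph_exp n (sqnorm n v))"
proof -
  have [simp]: "0 < n" using n by simp
  define r where "r = sqrt (sqnorm n v)"
  have r2: "r\<^sup>2 = sqnorm n v" by (simp add: r_def sqnorm_nonneg)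
  have rot: "(\<integral>\<^sup>+g. ennreal (exp (c * Re (cinner n v g) / sqrt (sqnorm n g))) \<partial>CN_std_vec n)
      = (\<integral>\<^sup>+g. ennreal (exp (c * r * Re (g 0) / sqrt (sqnorm n g))) \<partial>CN_std_vec n)"
    if "r = sqrt (sqnorm n v)" for c r :: real and v
    using nn_integral_CN_std_vec_rotate[of "\<lambda>t z. ennreal (exp (c * Re z / sqrt t))" n v] n that
    by (simp add: mult.assoc)
  let ?L = "\<integral>\<^sup>+g. ennreal (exp (2 * Re (cinner n v g) / sqrt (sqnorm n g))) \<partial>CN_std_vec n"
  let ?x = "\<lambda>g. 2 * r * Re (g 0) / sqrt (sqnorm n g)"
  have 1: "?L = (\<integral>\<^sup>+g. ennreal (exp (?x g)) \<partial>CN_std_vec n)"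
    using rot[of r v 2] r_def by simp
  \<comment> \<open>Replacing \<open>v\<close> by its negative keeps the norm. Rotating both
    versions onto coordinate 0 therefore gives the same integral with either sign in the
    exponent.\<close>
  have neg: "cinner n (\<lambda>i. - v i) g = - cinner n v g" "sqnorm n (\<lambda>i. - v i) = sqnorm n v" for g
    by (simp_all add: cinner_def sum_negf sqnorm_def)
  have "?L = (\<integral>\<^sup>+g. ennreal (exp ((-2) * Re (cinner n (\<lambda>i. - v i) g) / sqrt (sqnorm n g))) \<partial>CN_std_vec n)"
    by (simp add: neg)
  also have "\<dots> = (\<integral>\<^sup>+g. ennreal (exp ((-2) * r * Re (g 0) / sqrt (sqnorm n g))) \<partial>CN_std_vec n)"
    by (rule rot) (simp add: neg r_def)
  finally have 2: "?L = (\<integral>\<^sup>+g. ennreal (exp (- ?x g)) \<partial>CN_std_vec n)" by simp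
  \<comment> \<open>The integral is doubled and halved so that its two expressions can be combined
    into \<open>cosh\<close>.\<close>
  have "?L = ennreal (1/2) * (?L + ?L)"
  proof -
    have "ennreal (1/2) * (?L + ?L) = (ennreal (1/2) * ennreal 2) * ?L"
      by (simp only: mult_2[symmetric] ennreal_numeral mult.assoc)
    also have "ennreal (1/2) * ennreal 2 = 1"
      by (subst ennreal_mult'[symmetric]) auto
    finally show ?thesis by simp
  qed
  also have "?L + ?L = (\<integral>\<^sup>+g. ennreal (exp (?x g)) + ennreal (exp (- ?x g)) \<partial>CN_std_vec n)"
    unfolding nn_integral_add[symmetric] by (subst nn_integral_add) (measurable, use 1 2 in simp)
  also have "ennreal (1/2) * \<dots> = (\<integral>\<^sup>+g. ennreal (1/2) * (ennreal (exp (?x g)) + ennreal (exp (- ?x g))) \<partial>CN_std_vec n)"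
    by (rule nn_integral_cmult[symmetric]) measurable
  also have "\<dots> = (\<integral>\<^sup>+g. ennreal (cosh (?x g)) \<partial>CN_std_vec n)"
  proof (rule nn_integral_cong)
    fix g
    have "ennreal (exp (?x g)) + ennreal (exp (- ?x g)) = ennreal (exp (?x g) + exp (- ?x g))"
      by simp
    then show "ennreal (1/2) * (ennreal (exp (?x g)) + ennreal (exp (- ?x g))) = ennreal (cosh (?x g))"
      by (simp only: cosh_def) (subst ennreal_mult'[symmetric], auto)
  qed
  also have "\<dots> = (\<integral>\<^sup>+g. (\<Sum>m. ennreal (?x g ^ (2 * m) / fact (2 * m))) \<partial>CN_std_vec n)"
    by (intro nn_integral_cong suminf_ennreal_eq[symmetric] cosh_sums_even) auto
  also have "\<dots> = (\<Sum>m. \<integral>\<^sup>+g. ennreal (?x g ^ (2 * m) / fact (2 * m)) \<partial>CN_std_vec n)"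
    by (intro nn_integral_suminf) measurable
  also have "\<dots> = (\<Sum>m. ennreal (sqnorm n v ^ m * fact (n - 1) / (fact m * fact (m + n - 1))))"
  proof (rule suminf_cong)
    fix m
    have "?x g ^ (2 * m) / fact (2 * m) = (sqnorm n v ^ m / fact (2 * m)) * ((2 * Re (g 0)) ^ (2 * m) / sqnorm n g ^ m)" for g
    proof -
      have "sqrt (sqnorm n g) ^ (2 * m) = sqnorm n g ^ m"
        by (simp add: power_mult sqnorm_nonneg)
      moreover have "r ^ (2 * m) = sqnorm n v ^ m" by (simp add: power_mult r2)
      ultimately show ?thesis by (simp add: power_divide power_mult_distrib mult_ac)
    qed
    then have "(\<integral>\<^sup>+g. ennreal (?x g ^ (2 * m) / fact (2 * m)) \<partial>CN_std_vec n)
      = (\<integral>\<^sup>+g. ennreal (sqnorm n v ^ m / fact (2 * m)) * ennreal ((2 * Re (g 0)) ^ (2 * m) / sqnorm n g ^ m) \<partial>CN_std_vec n)"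
      by (simp add: ennreal_mult'[symmetric] sqnorm_nonneg)
    also have "\<dots> = ennreal (sqnorm n v ^ m / fact (2 * m)) * ennreal (fact (2 * m) / fact m * (fact (n - 1) / fact (m + n - 1)))"
      by (subst nn_integral_cmult, measurable) (simp only: nn_integral_CN_std_vec_direction_moment n)
    also have "\<dots> = ennreal (sqnorm n v ^ m * fact (n - 1) / (fact m * fact (m + n - 1)))"
      by (subst ennreal_mult'[symmetric]) (auto simp: sqnorm_nonneg)
    finally show "(\<integral>\<^sup>+g. ennreal (?x g ^ (2 * m) / fact (2 * m)) \<partial>CN_std_vec n) = ennreal (sqnorm n v ^ m * fact (n - 1) / (fact m * fact (m + n - 1)))" .
  qed
  also have "\<dots> = ennreal (sph_exp n (sqnorm n v))"
    unfolding sph_exp_def by (intro suminf_ennreal2 summable_sph_exp) (auto simp: sqnorm_nonneg)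
  finally show ?thesis .
qed

text \<open>A disc of radius \<open>sqrt a\<close> has area \<open>pi * a\<close>, so the squared
  modulus has constant density \<open>pi\<close> on the positive half-line. Comparing the half-lines
  \<open>{..a}\<close> takes the place of polar coordinates.\<close>

lemma nn_integral_lborel_cmod_sq:
  assumes [measurable]: "f \<in> borel_measurable borel"
  shows "(\<integral>\<^sup>+h. f ((cmod h)\<^sup>2) \<partial>lborel) = ennreal pi * (\<integral>\<^sup>+z. f z * indicator {0<..} z \<partial>lborel)"
proof -
  let ?M = "distr lborel borel (\<lambda>h :: complex. (cmod h)\<^sup>2)"
  let ?N = "density lborel (\<lambda>z :: real. ennreal pi * indicator {0<..} z)"
  have M: "emeasure ?M {..a} = ennreal (if a \<ge> 0 then pi * a else 0)" for a
  proof (cases "a \<ge> 0")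
    case True
    have "(\<lambda>h :: complex. (cmod h)\<^sup>2) -` {..a} = cball 0 (sqrt a)"
      using True by (auto simp: real_le_rsqrt sqrt_le_D real_sqrt_ge_abs1 intro: real_le_rsqrt)
        (metis real_sqrt_pow2 power_mono norm_ge_zero)
    then show ?thesis using True by (simp add: emeasure_distr emeasure_cball unit_ball_vol_2)
  next
    case False
    then have "(\<lambda>h :: complex. (cmod h)\<^sup>2) -` {..a} = {}"
      by (auto simp: not_le dest: order.strict_trans1[of _ a 0])
    then show ?thesis using False by (simp add: emeasure_distr)
  qed
  have N: "emeasure ?N {..a} = ennreal (if a \<ge> 0 then pi * a else 0)" for a
  proof -
    have "emeasure ?N {..a} = (\<integral>\<^sup>+z. ennreal pi * indicator {0<..a} z \<partial>lborel)"
      by (subst emeasure_density) (auto intro!: nn_integral_cong split: split_indicator)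
    also have "\<dots> = ennreal pi * emeasure lborel {0<..a}"
      by (subst nn_integral_cmult_indicator) auto
    finally show ?thesis by (auto simp: ennreal_mult')
  qed
  have "?M = ?N"
  proof (rule measure_eqI_generator_eq[where E = "range (\<lambda>a. {..a})" and \<Omega> = UNIV and A = "\<lambda>i. {..real i}"])
    show "Int_stable (range (\<lambda>a::real. {..a}))" by (auto simp: Int_stable_def)
    show "sets ?M = sigma_sets UNIV (range (\<lambda>a. {..a}))" "sets ?N = sigma_sets UNIV (range (\<lambda>a. {..a}))"
      by (simp_all add: borel_eq_atMost)
    show "(\<Union>i. {..real i}) = UNIV" using real_arch_simple by auto
  qed (auto simp: M N)
  then have "(\<integral>\<^sup>+z. f z \<partial>?M) = (\<integral>\<^sup>+z. f z \<partial>?N)" by simp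
  also have "\<dots> = (\<integral>\<^sup>+z. ennreal pi * (f z * indicator {0<..} z) \<partial>lborel)"
    by (subst nn_integral_density) (auto intro!: nn_integral_cong simp: mult_ac)
  finally show ?thesis by (simp add: nn_integral_distr nn_integral_cmult)
qed

lemma AE_CN01_nonzero: "AE z in CN 0 1. z \<noteq> 0"
  unfolding CN_def using AE_lborel_singleton[of "0::complex"] by (subst AE_density) (auto elim!: eventually_mono)

lemma AE_CN_std_vec_nonzero:
  assumes "n \<ge> 1"
  shows "AE g in CN_std_vec n. sqnorm n g \<noteq> 0"
proof -
  have "AE g in CN_std_vec n. g 0 \<noteq> 0"
    unfolding CN_std_vec_def using assms
    by (intro AE_PiM_component[where P = "\<lambda>z. z \<noteq> 0"] prob_space_CN01 AE_CN01_nonzero) auto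
  then show ?thesis
    using assms by (auto elim!: eventually_mono simp: sqnorm_def sum_nonneg_eq_0_iff)
qed

text \<open>Lebesgue measure on the plane is invariant under multiplication by the uniform phase
  \<open>g 0 / |g 0|\<close> of a Gaussian \<open>g\<close>.\<close>
lemma nn_integral_lborel_phase_average:
  assumes [measurable]: "F \<in> borel_measurable borel"
  shows "(\<integral>\<^sup>+h. F ((cmod h)\<^sup>2) * ennreal (exp (2 * Re (h * cnj m))) \<partial>lborel)
       = (\<integral>\<^sup>+h. F ((cmod h)\<^sup>2) * ennreal (sph_exp 1 ((cmod h)\<^sup>2 * (cmod m)\<^sup>2)) \<partial>lborel)"
proof -
  interpret G: prob_space "CN_std_vec 1" by (rule prob_space_CN_std_vec)
  let ?L = "\<integral>\<^sup>+h. F ((cmod h)\<^sup>2) * ennreal (exp (2 * Re (h * cnj m))) \<partial>lborel"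
  have sq: "sqrt (sqnorm 1 g) = cmod (g 0)" for g by (simp add: sqnorm_def)
  \<comment> \<open>A constant integrated against a probability measure introduces the random
    phase.\<close>
  have "?L = (\<integral>\<^sup>+g. ?L \<partial>CN_std_vec 1)"
    by (simp only: nn_integral_const G.emeasure_space_1 mult_1_right)
  also have "\<dots> = (\<integral>\<^sup>+g. (\<integral>\<^sup>+h. F ((cmod h)\<^sup>2) * ennreal (exp (2 * Re (h * cnj m * g 0) / sqrt (sqnorm 1 g))) \<partial>lborel) \<partial>CN_std_vec 1)"
  proof (rule nn_integral_cong_AE, use AE_CN_std_vec_nonzero[OF order_refl] in eventually_elim)
    fix g assume "sqnorm 1 g \<noteq> 0"
    then have g: "g 0 \<noteq> 0" by (simp add: sqnorm_def)
    define u where "u = g 0 / complex_of_real (cmod (g 0))"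
    have u: "cmod u = 1" using g by (simp add: u_def norm_divide)
    have "?L = (\<integral>\<^sup>+h. F ((cmod (u * h))\<^sup>2) * ennreal (exp (2 * Re ((u * h) * cnj m))) \<partial>lborel)"
      by (rule nn_integral_lborel_complex_rotate[OF _ u, symmetric]) measurable
    also have "\<dots> = (\<integral>\<^sup>+h. F ((cmod h)\<^sup>2) * ennreal (exp (2 * Re (h * cnj m * g 0) / sqrt (sqnorm 1 g))) \<partial>lborel)"
    proof (rule nn_integral_cong)
      fix h
      have "u * h * cnj m = (h * cnj m * g 0) / complex_of_real (cmod (g 0))"
        by (simp add: u_def)
      then have "Re (u * h * cnj m) = Re (h * cnj m * g 0) / cmod (g 0)"
        by (simp only: Re_divide_of_real)
      then show "F ((cmod (u * h))\<^sup>2) * ennreal (exp (2 * Re (u * h * cnj m))) = F ((cmod h)\<^sup>2) * ennreal (exp (2 * Re (h * cnj m * g 0) / sqrt (sqnorm 1 g)))"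
        by (simp only: sq norm_mult u) simp
    qed
    finally show "?L = (\<integral>\<^sup>+h. F ((cmod h)\<^sup>2) * ennreal (exp (2 * Re (h * cnj m * g 0) / sqrt (sqnorm 1 g))) \<partial>lborel)" .
  qed
  also have "\<dots> = (\<integral>\<^sup>+h. (\<integral>\<^sup>+g. F ((cmod h)\<^sup>2) * ennreal (exp (2 * Re (h * cnj m * g 0) / sqrt (sqnorm 1 g))) \<partial>CN_std_vec 1) \<partial>lborel)"
    by (rule pair_sigma_finite.Fubini') (unfold_locales, measurable)
  also have "\<dots> = (\<integral>\<^sup>+h. F ((cmod h)\<^sup>2) * ennreal (sph_exp 1 ((cmod h)\<^sup>2 * (cmod m)\<^sup>2)) \<partial>lborel)"
  proof (rule nn_integral_cong)
    fix h
    \<comment> \<open>For fixed \<open>h\<close> the phase average is the sphere average in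
      dimension one, with \<open>cnj (h * cnj m)\<close> as the vector.\<close>
    have "(\<integral>\<^sup>+g. F ((cmod h)\<^sup>2) * ennreal (exp (2 * Re (h * cnj m * g 0) / sqrt (sqnorm 1 g))) \<partial>CN_std_vec 1)
      = F ((cmod h)\<^sup>2) * (\<integral>\<^sup>+g. ennreal (exp (2 * Re (cinner 1 (\<lambda>_. cnj (h * cnj m)) g) / sqrt (sqnorm 1 g))) \<partial>CN_std_vec 1)"
      by (subst nn_integral_cmult, measurable) (simp add: cinner_def)
    also have "\<dots> = F ((cmod h)\<^sup>2) * ennreal (sph_exp 1 (sqnorm 1 (\<lambda>_. cnj (h * cnj m))))"
      by (subst nn_integral_CN_std_vec_direction_exp) auto
    also have "sqnorm 1 (\<lambda>_. cnj (h * cnj m)) = (cmod h)\<^sup>2 * (cmod m)\<^sup>2"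
      by (simp add: sqnorm_def norm_mult power_mult_distrib)
    finally show "(\<integral>\<^sup>+g. F ((cmod h)\<^sup>2) * ennreal (exp (2 * Re (h * cnj m * g 0) / sqrt (sqnorm 1 g))) \<partial>CN_std_vec 1)
      = F ((cmod h)\<^sup>2) * ennreal (sph_exp 1 ((cmod h)\<^sup>2 * (cmod m)\<^sup>2))" .
  qed
  finally show ?thesis .
qed

section \<open>Conditional output density of one block\<close>

lemma nn_integral_lborel_complex_affine:
  fixes f :: "complex \<Rightarrow> ennreal"
  assumes [measurable]: "f \<in> borel_measurable borel" and c: "c > 0"
  shows "(\<integral>\<^sup>+z. f z \<partial>lborel) = ennreal (c\<^sup>2) * (\<integral>\<^sup>+z. f (m + complex_of_real c * z) \<partial>lborel)"
proof -
  have "(\<integral>\<^sup>+z. f z \<partial>lborel) = (\<integral>\<^sup>+z. f z \<partial>density (distr lborel borel (\<lambda>z. m + c *\<^sub>R z)) (\<lambda>_. \<bar>c\<bar>^DIM(complex)))"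
    using lborel_affine[of c m] c by simp
  also have "\<dots> = ennreal (c\<^sup>2) * (\<integral>\<^sup>+z. f (m + complex_of_real c * z) \<partial>lborel)"
    using c by (simp add: nn_integral_density nn_integral_distr nn_integral_cmult scaleR_conv_of_real)
  finally show ?thesis .
qed

lemma CN_affine:
  assumes c: "c > 0"
  shows "distr (CN 0 1) borel (\<lambda>z. m + complex_of_real c * z) = CN m (c\<^sup>2)"
proof (rule measure_eqI)
  fix A assume "A \<in> sets (distr (CN 0 1) borel (\<lambda>z. m + complex_of_real c * z))"
  then have [measurable]: "A \<in> sets borel" by simp
  have "emeasure (CN m (c\<^sup>2)) A = (\<integral>\<^sup>+z. indicator A z \<partial>CN m (c\<^sup>2))"
    by simp
  also have "\<dots> = (\<integral>\<^sup>+z. ennreal (exp (- (cmod (z - m))\<^sup>2 / c\<^sup>2) / (pi * c\<^sup>2)) * indicator A z \<partial>lborel)"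
    by (rule nn_integral_CN) measurable
  also have "\<dots> = ennreal (c\<^sup>2) * (\<integral>\<^sup>+z. ennreal (exp (- (cmod ((m + complex_of_real c * z) - m))\<^sup>2 / c\<^sup>2) / (pi * c\<^sup>2))
       * indicator A (m + complex_of_real c * z) \<partial>lborel)"
    by (rule nn_integral_lborel_complex_affine[OF _ c]) measurable
  also have "\<dots> = (\<integral>\<^sup>+z. ennreal (c\<^sup>2) * (ennreal (exp (- (cmod ((m + complex_of_real c * z) - m))\<^sup>2 / c\<^sup>2) / (pi * c\<^sup>2))
       * indicator A (m + complex_of_real c * z)) \<partial>lborel)"
    by (rule nn_integral_cmult[symmetric]) measurable
  also have "\<dots> = (\<integral>\<^sup>+z. ennreal (exp (- (cmod (z - 0))\<^sup>2 / 1) / (pi * 1)) * indicator A (m + complex_of_real c * z) \<partial>lborel)"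
    using c by (intro nn_integral_cong)
      (simp add: norm_mult power_mult_distrib ennreal_mult'[symmetric] mult.assoc[symmetric] del: ennreal_power)
  also have "\<dots> = (\<integral>\<^sup>+z. indicator A (m + complex_of_real c * z) \<partial>CN 0 1)"
    by (rule nn_integral_CN[symmetric]) measurable
  also have "\<dots> = (\<integral>\<^sup>+z. indicator A z \<partial>distr (CN 0 1) borel (\<lambda>z. m + complex_of_real c * z))"
    by (subst nn_integral_distr) auto
  also have "\<dots> = emeasure (distr (CN 0 1) borel (\<lambda>z. m + complex_of_real c * z)) A"
    by (simp del: nn_integral_distr)
  finally show "emeasure (distr (CN 0 1) borel (\<lambda>z. m + complex_of_real c * z)) A = emeasure (CN m (c\<^sup>2)) A" ..
qed simp

abbreviation lborel_vec :: "nat \<Rightarrow> (nat \<Rightarrow> complex) measure" where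
  "lborel_vec n \<equiv> PiM {..<n} (\<lambda>_. lborel)"

abbreviation borel_vec :: "nat \<Rightarrow> (nat \<Rightarrow> complex) measure" where
  "borel_vec n \<equiv> PiM {..<n} (\<lambda>_. borel)"

lemma product_sigma_finite_lborel: "product_sigma_finite (\<lambda>_. lborel)"
  by unfold_locales

lemma sets_lborel_vec[measurable_cong]: "sets (lborel_vec n) = sets (borel_vec n)"
  by (auto intro!: sets_PiM_cong)

lemma sigma_finite_lborel_vec: "sigma_finite_measure (lborel_vec n)"
  by (rule product_sigma_finite.sigma_finite[OF product_sigma_finite_lborel]) simp

text \<open>Parameters vary with the coordinate because the noise shifted by a codeword has
  different means, and \<open>W_tilde\<close> has a special coordinate 0.\<close>

lemma PiM_CN_eq_density:
  assumes "\<And>i. s i > 0"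
  shows "PiM {..<n} (\<lambda>i. CN (m i) (s i))
    = density (lborel_vec n) (\<lambda>y. ennreal (\<Prod>i<n. exp (- (cmod (y i - m i))\<^sup>2 / s i) / (pi * s i)))"
proof -
  have "product_sigma_finite (\<lambda>i. CN (m i) (s i))"
  proof
    fix i
    interpret prob_space "CN (m i) (s i)" by (rule prob_space_CN) (rule assms)
    show "\<exists>A. countable A \<and> A \<subseteq> sets (CN (m i) (s i)) \<and> \<Union> A = space (CN (m i) (s i)) \<and> (\<forall>a\<in>A. emeasure (CN (m i) (s i)) a \<noteq> \<infinity>)"
      by (rule sigma_finite_countable)
  qed
  then have "density (lborel_vec n) (\<lambda>y. \<Prod>i<n. ennreal (exp (- (cmod (y i - m i))\<^sup>2 / s i) / (pi * s i)))
     = PiM {..<n} (\<lambda>i. CN (m i) (s i))"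
    unfolding CN_def
    by (intro density_PiM_prod[where f = "\<lambda>i z. ennreal (exp (- (cmod (z - m i))\<^sup>2 / s i) / (pi * s i))"] product_sigma_finite_lborel)
       auto
  then show ?thesis
    using assms by (subst (asm) prod_ennreal) (auto simp: less_imp_le)
qed

lemma cmod_diff_sq: "(cmod (h - w))\<^sup>2 = (cmod h)\<^sup>2 - 2 * Re (cnj h * w) + (cmod w)\<^sup>2"
  unfolding cmod_power2 by (simp add: power2_eq_square algebra_simps)

locale rician_block =
  fixes n :: nat and \<rho> \<sigma>2 :: real and \<mu> :: complex
  assumes n_pos: "n \<ge> 1" and rho_pos: "\<rho> > 0" and sigma_pos: "\<sigma>2 > 0"
begin

definition P :: real where "P = real n * \<rho>"

lemma P_pos: "P > 0"
  using n_pos rho_pos by (simp add: P_def)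

text \<open>The output density given the codeword \<open>x\<close> is \<open>q (sqnorm n y) (cinner n x y)\<close>.\<close>
definition q :: "real \<Rightarrow> complex \<Rightarrow> real" where
  "q a t = exp (- a - (cmod \<mu>)\<^sup>2 / \<sigma>2 + (cmod (t + \<mu> / complex_of_real \<sigma>2))\<^sup>2 / (P + 1 / \<sigma>2)) / (pi ^ n * (\<sigma>2 * P + 1))"

lemma q_pos: "q a t > 0"
  using P_pos sigma_pos by (simp add: q_def add_pos_pos)

lemma measurable_q[measurable]: "case_prod q \<in> borel_measurable (borel \<Otimes>\<^sub>M borel)"
  unfolding q_def by measurable

text \<open>The integrand is the density of \<open>h * x + w\<close> at \<open>y\<close> for given
  \<open>h\<close>, with \<open>a = |y|^2\<close>, \<open>t = <x, y>\<close> and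
  \<open>|x|^2 = P\<close>. Completing the square in \<open>h\<close> gives a Gaussian with
  coefficient \<open>c\<close> and centre \<open>m / c\<close>, whose mass is
  \<open>pi / c\<close>.\<close>

lemma nn_integral_CN_eq_q:
  "(\<integral>\<^sup>+h. ennreal (exp (- a + 2 * Re (cnj h * t) - (cmod h)\<^sup>2 * P) / pi ^ n) \<partial>CN \<mu> \<sigma>2) = ennreal (q a t)"
proof -
  define c where "c = P + 1 / \<sigma>2"
  define m where "m = t + \<mu> / complex_of_real \<sigma>2"
  define K where "K = exp (- a - (cmod \<mu>)\<^sup>2 / \<sigma>2 + (cmod m)\<^sup>2 / c) / (pi ^ n * (pi * \<sigma>2))"
  have c: "c > 0" using P_pos sigma_pos by (simp add: c_def add_pos_pos)
  have e: "- (cmod (h - \<mu>))\<^sup>2 / \<sigma>2 + (- a + 2 * Re (cnj h * t) - (cmod h)\<^sup>2 * P)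
     = (- a - (cmod \<mu>)\<^sup>2 / \<sigma>2 + (cmod m)\<^sup>2 / c) + (- c * (cmod (h - m / complex_of_real c))\<^sup>2)" for h
  proof -
    have 1: "c * (cmod (h - m / complex_of_real c))\<^sup>2 = c * (cmod h)\<^sup>2 - 2 * Re (cnj h * m) + (cmod m)\<^sup>2 / c"
    proof -
      have "Re (cnj h * (m / complex_of_real c)) = Re (cnj h * m) / c"
        by (metis Re_divide_of_real times_divide_eq_right)
      then show ?thesis
        using c unfolding cmod_diff_sq by (simp add: norm_divide power_divide power2_eq_square field_simps)
    qed
    have 2: "Re (cnj h * m) = Re (cnj h * t) + Re (cnj h * \<mu>) / \<sigma>2"
      unfolding m_def by (metis Re_divide_of_real distrib_left plus_complex.simps(1) times_divide_eq_right)
    have 3: "c * (cmod h)\<^sup>2 = (cmod h)\<^sup>2 * P + (cmod h)\<^sup>2 / \<sigma>2"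
      by (simp add: c_def algebra_simps)
    have 4: "- (cmod (h - \<mu>))\<^sup>2 / \<sigma>2 = - (cmod h)\<^sup>2 / \<sigma>2 + 2 * (Re (cnj h * \<mu>) / \<sigma>2) - (cmod \<mu>)\<^sup>2 / \<sigma>2"
      using sigma_pos unfolding cmod_diff_sq by (simp add: field_simps)
    show ?thesis unfolding mult_minus_left 1 2 3 4 by (simp add: algebra_simps)
  qed
  have "(\<integral>\<^sup>+h. ennreal (exp (- a + 2 * Re (cnj h * t) - (cmod h)\<^sup>2 * P) / pi ^ n) \<partial>CN \<mu> \<sigma>2)
      = (\<integral>\<^sup>+h. ennreal (exp (- (cmod (h - \<mu>))\<^sup>2 / \<sigma>2) / (pi * \<sigma>2)) * ennreal (exp (- a + 2 * Re (cnj h * t) - (cmod h)\<^sup>2 * P) / pi ^ n) \<partial>lborel)"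
    by (rule nn_integral_CN) measurable
  also have "\<dots> = (\<integral>\<^sup>+h. ennreal K * ennreal (exp (- c * (cmod (h - m / complex_of_real c))\<^sup>2)) \<partial>lborel)"
  proof (rule nn_integral_cong)
    fix h
    have "exp (- (cmod (h - \<mu>))\<^sup>2 / \<sigma>2) / (pi * \<sigma>2) * (exp (- a + 2 * Re (cnj h * t) - (cmod h)\<^sup>2 * P) / pi ^ n)
       = K * exp (- c * (cmod (h - m / complex_of_real c))\<^sup>2)"
    proof -
      have "exp A / X * (exp B / Y) = exp (A + B) / (Y * X)" "exp A / X * exp B = exp (A + B) / X" for A B X Y :: real
        by (simp_all add: exp_add)
      then show ?thesis unfolding K_def by (simp only: e)
    qed
    then show "ennreal (exp (- (cmod (h - \<mu>))\<^sup>2 / \<sigma>2) / (pi * \<sigma>2)) * ennreal (exp (- a + 2 * Re (cnj h * t) - (cmod h)\<^sup>2 * P) / pi ^ n)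
       = ennreal K * ennreal (exp (- c * (cmod (h - m / complex_of_real c))\<^sup>2))"
      by (subst (1 2) ennreal_mult''[symmetric]) auto
  qed
  also have "\<dots> = ennreal K * ennreal (pi / c)"
    by (subst nn_integral_cmult, measurable) (simp only: nn_integral_complex_gauss[OF c])
  also have "\<dots> = ennreal (K * (pi / c))"
    using c by (subst ennreal_mult'') auto
  also have "K * (pi / c) = q a t"
  proof -
    have "\<sigma>2 * P + 1 = \<sigma>2 * c" using sigma_pos by (simp add: c_def field_simps)
    then show ?thesis using c sigma_pos unfolding K_def q_def m_def[symmetric] c_def[symmetric] by (simp add: field_simps)
  qed
  finally show ?thesis .
qed

text \<open>The density written with the covariance and the one with the fading integrated out agree
  because the covariance is a rank-one perturbation of the identity. In coordinates this is a scalar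
  identity between exponents, with common denominator \<open>D\<close>.\<close>

lemma f_Y_e1_eq_q: "f_Y_e1 \<mu> \<sigma>2 n \<rho> y = q (sqnorm n y) (complex_of_real (sqrt P) * y 0)"
proof -
  define D where "D = \<sigma>2 * P + 1"
  define R where "R = Re (cnj (y 0) * \<mu>)"
  define T where "T = (\<Sum>i\<in>{1..<n}. (cmod (y i))\<^sup>2)"
  define Y where "Y = (cmod (y 0))\<^sup>2"
  define U where "U = (cmod \<mu>)\<^sup>2"
  have D: "D > 0" using P_pos sigma_pos by (simp add: D_def add_pos_pos)
  have sq: "sqnorm n y = Y + T"
  proof -
    have "{..<n} = insert 0 {1..<n}" using n_pos by auto
    then show ?thesis by (simp add: sqnorm_def Y_def T_def)
  qed
  have sP: "sqrt P * sqrt P = P" using P_pos by simp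
  have 1: "(cmod (y 0 - \<mu> * complex_of_real (sqrt P)))\<^sup>2 = Y - 2 * sqrt P * R + P * U"
  proof -
    have "Re (cnj (y 0) * (\<mu> * complex_of_real (sqrt P))) = sqrt P * R"
      by (simp add: R_def algebra_simps)
    moreover have "(cmod (\<mu> * complex_of_real (sqrt P)))\<^sup>2 = P * U"
      using P_pos by (simp add: norm_mult power_mult_distrib U_def)
    ultimately show ?thesis unfolding cmod_diff_sq Y_def by simp
  qed
  have 2: "(cmod (complex_of_real (sqrt P) * y 0 + \<mu> / complex_of_real \<sigma>2))\<^sup>2 = P * Y + 2 * sqrt P * R / \<sigma>2 + U / \<sigma>2\<^sup>2"
  proof -
    have "complex_of_real (sqrt P) * y 0 + \<mu> / complex_of_real \<sigma>2 = complex_of_real (sqrt P) * y 0 - (- \<mu> / complex_of_real \<sigma>2)"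
      by simp
    moreover have "Re (cnj (complex_of_real (sqrt P) * y 0) * (- \<mu> / complex_of_real \<sigma>2)) = - sqrt P * R / \<sigma>2"
      unfolding R_def times_divide_eq_right Re_divide_of_real by (simp add: algebra_simps)
    moreover have "(cmod (complex_of_real (sqrt P) * y 0))\<^sup>2 = P * Y"
      using P_pos by (simp add: norm_mult power_mult_distrib Y_def)
    moreover have "(cmod (- \<mu> / complex_of_real \<sigma>2))\<^sup>2 = U / \<sigma>2\<^sup>2"
      by (simp add: norm_divide power_divide U_def)
    ultimately show ?thesis by (simp only: cmod_diff_sq)
  qed
  have 3: "P + 1 / \<sigma>2 = D / \<sigma>2" using sigma_pos by (simp add: D_def field_simps)
  have "- ((Y - 2 * sqrt P * R + P * U) / D + T) = - (Y + T) - U / \<sigma>2 + (P * Y + 2 * sqrt P * R / \<sigma>2 + U / \<sigma>2\<^sup>2) / (D / \<sigma>2)"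
  proof -
    have "(P * Y + 2 * sqrt P * R / \<sigma>2 + U / \<sigma>2\<^sup>2) / (D / \<sigma>2) = (\<sigma>2 * P * Y + 2 * sqrt P * R + U / \<sigma>2) / D"
      using sigma_pos D by (simp add: field_simps power2_eq_square)
    \<comment> \<open>Writing \<open>U\<close> as \<open>\<sigma>2 * Z\<close> removes the division
      by the variance, so that only the denominator \<open>D\<close> is left to clear.\<close>
    moreover have "- ((Y - 2 * sqrt P * R + P * (\<sigma>2 * Z)) / D + T) = - (Y + T) - Z + (\<sigma>2 * P * Y + 2 * sqrt P * R + Z) / D" for Z
      using D by (simp add: field_simps) (simp add: D_def algebra_simps)
    from this[of "U / \<sigma>2"] have "- ((Y - 2 * sqrt P * R + P * U) / D + T) = - (Y + T) - U / \<sigma>2 + (\<sigma>2 * P * Y + 2 * sqrt P * R + U / \<sigma>2) / D"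
      using sigma_pos by simp
    ultimately show ?thesis by (simp only:)
  qed
  moreover have "f_Y_e1 \<mu> \<sigma>2 n \<rho> y = exp (- ((Y - 2 * sqrt P * R + P * U) / D + T)) / (pi ^ n * D)"
    unfolding f_Y_e1_def mult.assoc[of \<sigma>2] P_def[symmetric] D_def[symmetric] T_def[symmetric] 1 ..
  moreover have "q (sqnorm n y) (complex_of_real (sqrt P) * y 0)
      = exp (- (Y + T) - U / \<sigma>2 + (P * Y + 2 * sqrt P * R / \<sigma>2 + U / \<sigma>2\<^sup>2) / (D / \<sigma>2)) / (pi ^ n * D)"
    unfolding q_def sq 2 3 U_def[symmetric] D_def[symmetric] ..
  ultimately show ?thesis by (simp only:)
qed

end

section \<open>Law of the output of one block\<close>

lemma exp_neg_sum:
  fixes f :: "'a \<Rightarrow> real"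
  shows "finite A \<Longrightarrow> exp (- (\<Sum>i\<in>A. f i)) = (\<Prod>i\<in>A. exp (- f i))"
  unfolding sum_negf[symmetric] by (rule exp_sum)

lemma sqnorm_lincomb:
  "sqnorm n (\<lambda>i. h * x i + w i) = (cmod h)\<^sup>2 * sqnorm n x + 2 * Re (cnj h * cinner n x w) + sqnorm n w"
proof -
  have *: "(cmod (h * x i + w i))\<^sup>2 = (cmod h)\<^sup>2 * (cmod (x i))\<^sup>2 + 2 * Re (cnj h * (cnj (x i) * w i)) + (cmod (w i))\<^sup>2" for i
    using cmod_diff_sq[of "h * x i" "- w i"] by (simp add: norm_mult power_mult_distrib algebra_simps)
  show ?thesis
    unfolding sqnorm_def cinner_def * by (simp add: sum.distrib sum_distrib_left Re_sum)
qed

lemma sqnorm_restrict[simp]: "sqnorm n (restrict y {..<n}) = sqnorm n y"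
  by (simp add: sqnorm_def)

lemma cinner_restrict[simp]:
  "cinner n x (restrict y {..<n}) = cinner n x y" "cinner n (restrict x {..<n}) y = cinner n x y"
  by (simp_all add: cinner_def)

context rician_block
begin

definition block_law :: "(nat \<Rightarrow> complex) \<Rightarrow> (nat \<Rightarrow> complex) measure" where
  "block_law x = distr (CN \<mu> \<sigma>2 \<Otimes>\<^sub>M CN_std_vec n) (borel_vec n) (\<lambda>(h, w). \<lambda>i\<in>{..<n}. h * x i + w i)"

lemma measurable_block_map[measurable]:
  "(\<lambda>(h, w). \<lambda>i\<in>{..<n}. h * x i + w i) \<in> CN \<mu> \<sigma>2 \<Otimes>\<^sub>M CN_std_vec n \<rightarrow>\<^sub>M borel_vec n"
  by measurable

lemma prob_space_pair: "prob_space (CN \<mu> \<sigma>2 \<Otimes>\<^sub>M CN_std_vec n)"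
proof -
  interpret H: prob_space "CN \<mu> \<sigma>2" by (rule prob_space_CN) (rule sigma_pos)
  interpret W: prob_space "CN_std_vec n" by (rule prob_space_CN_std_vec)
  interpret pair_prob_space "CN \<mu> \<sigma>2" "CN_std_vec n" ..
  show ?thesis by unfold_locales
qed

lemma sets_block_law[measurable_cong, simp]: "sets (block_law x) = sets (borel_vec n)"
  by (simp add: block_law_def)

lemma prob_space_block_law: "prob_space (block_law x)"
  unfolding block_law_def by (rule prob_space.prob_space_distr[OF prob_space_pair]) measurable

lemma nn_integral_block_law:
  assumes [measurable]: "f \<in> borel_measurable (borel_vec n)"
  shows "(\<integral>\<^sup>+y. f y \<partial>block_law x) = (\<integral>\<^sup>+h. \<integral>\<^sup>+w. f (\<lambda>i\<in>{..<n}. h * x i + w i) \<partial>CN_std_vec n \<partial>CN \<mu> \<sigma>2)"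
proof -
  interpret W: prob_space "CN_std_vec n" by (rule prob_space_CN_std_vec)
  have "(\<integral>\<^sup>+y. f y \<partial>block_law x) = (\<integral>\<^sup>+p. f (case p of (h, w) \<Rightarrow> \<lambda>i\<in>{..<n}. h * x i + w i) \<partial>(CN \<mu> \<sigma>2 \<Otimes>\<^sub>M CN_std_vec n))"
    unfolding block_law_def by (rule nn_integral_distr) measurable
  also have "\<dots> = (\<integral>\<^sup>+h. \<integral>\<^sup>+w. f (\<lambda>i\<in>{..<n}. h * x i + w i) \<partial>CN_std_vec n \<partial>CN \<mu> \<sigma>2)"
    using measurable_compose[OF measurable_block_map assms, of x]
    by (subst W.nn_integral_fst[symmetric]) simp_all
  finally show ?thesis .
qed

lemma nn_integral_CN_std_vec_shift:
  assumes [measurable]: "f \<in> borel_measurable (borel_vec n)"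
  shows "(\<integral>\<^sup>+w. f (\<lambda>i\<in>{..<n}. m i + w i) \<partial>CN_std_vec n)
    = (\<integral>\<^sup>+y. ennreal (exp (- (\<Sum>i<n. (cmod (y i - m i))\<^sup>2)) / pi ^ n) * f y \<partial>lborel_vec n)"
proof -
  have "distr (CN_std_vec n) (borel_vec n) (\<lambda>w. \<lambda>i\<in>{..<n}. m i + w i)
      = PiM {..<n} (\<lambda>i. distr (CN 0 1) borel (\<lambda>z. m i + z))"
    unfolding CN_std_vec_def by (rule distr_PiM_componentwise) (auto intro: prob_space_CN01)
  also have "\<dots> = PiM {..<n} (\<lambda>i. CN (m i) 1)"
    using CN_affine[of 1] by simp
  also have "\<dots> = density (lborel_vec n) (\<lambda>y. ennreal (\<Prod>i<n. exp (- (cmod (y i - m i))\<^sup>2 / 1) / (pi * 1)))"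
    by (rule PiM_CN_eq_density) simp
  also have "(\<lambda>y. ennreal (\<Prod>i<n. exp (- (cmod (y i - m i))\<^sup>2 / 1) / (pi * 1)))
      = (\<lambda>y. ennreal (exp (- (\<Sum>i<n. (cmod (y i - m i))\<^sup>2)) / pi ^ n))"
    by (simp add: prod_dividef exp_neg_sum)
  finally have D: "distr (CN_std_vec n) (borel_vec n) (\<lambda>w. \<lambda>i\<in>{..<n}. m i + w i)
      = density (lborel_vec n) (\<lambda>y. ennreal (exp (- (\<Sum>i<n. (cmod (y i - m i))\<^sup>2)) / pi ^ n))" .
  have "(\<integral>\<^sup>+w. f (\<lambda>i\<in>{..<n}. m i + w i) \<partial>CN_std_vec n)
     = (\<integral>\<^sup>+y. f y \<partial>distr (CN_std_vec n) (borel_vec n) (\<lambda>w. \<lambda>i\<in>{..<n}. m i + w i))"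
    by (rule nn_integral_distr[symmetric]) measurable
  also have "\<dots> = (\<integral>\<^sup>+y. ennreal (exp (- (\<Sum>i<n. (cmod (y i - m i))\<^sup>2)) / pi ^ n) * f y \<partial>lborel_vec n)"
    unfolding D by (rule nn_integral_density) measurable
  finally show ?thesis .
qed

text \<open>For given \<open>h\<close> the output is Gaussian around \<open>h * x\<close>. Expanding
  the square leaves \<open>y\<close> only in \<open>sqnorm n y\<close> and
  \<open>cinner n x y\<close>, and Tonelli brings the fading integral inside.\<close>

lemma nn_integral_block_law_density:
  assumes [measurable]: "f \<in> borel_measurable (borel_vec n)" and x: "sqnorm n x = P"
  shows "(\<integral>\<^sup>+y. f y \<partial>block_law x) = (\<integral>\<^sup>+y. ennreal (q (sqnorm n y) (cinner n x y)) * f y \<partial>lborel_vec n)"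
proof -
  interpret H: prob_space "CN \<mu> \<sigma>2" by (rule prob_space_CN) (rule sigma_pos)
  interpret L: sigma_finite_measure "lborel_vec n" by (rule sigma_finite_lborel_vec)
  have "(\<integral>\<^sup>+y. f y \<partial>block_law x) = (\<integral>\<^sup>+h. \<integral>\<^sup>+w. f (\<lambda>i\<in>{..<n}. h * x i + w i) \<partial>CN_std_vec n \<partial>CN \<mu> \<sigma>2)"
    by (rule nn_integral_block_law) measurable
  also have "\<dots> = (\<integral>\<^sup>+h. \<integral>\<^sup>+y. ennreal (exp (- (\<Sum>i<n. (cmod (y i - h * x i))\<^sup>2)) / pi ^ n) * f y \<partial>lborel_vec n \<partial>CN \<mu> \<sigma>2)"
    by (intro nn_integral_cong nn_integral_CN_std_vec_shift) measurable
  also have "\<dots> = (\<integral>\<^sup>+h. \<integral>\<^sup>+y. ennreal (exp (- sqnorm n y + 2 * Re (cnj h * cinner n x y) - (cmod h)\<^sup>2 * P) / pi ^ n) * f y \<partial>lborel_vec n \<partial>CN \<mu> \<sigma>2)"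
  proof -
    have "(\<Sum>i<n. (cmod (y i - h * x i))\<^sup>2) = sqnorm n y - 2 * Re (cnj h * cinner n x y) + (cmod h)\<^sup>2 * P" for y h
      using sqnorm_lincomb[of n "- h" x y] x by (simp add: sqnorm_def)
    then show ?thesis by simp
  qed
  also have "\<dots> = (\<integral>\<^sup>+y. \<integral>\<^sup>+h. ennreal (exp (- sqnorm n y + 2 * Re (cnj h * cinner n x y) - (cmod h)\<^sup>2 * P) / pi ^ n) * f y \<partial>CN \<mu> \<sigma>2 \<partial>lborel_vec n)"
    by (rule pair_sigma_finite.Fubini') (unfold_locales, measurable)
  also have "\<dots> = (\<integral>\<^sup>+y. ennreal (q (sqnorm n y) (cinner n x y)) * f y \<partial>lborel_vec n)"
    by (intro nn_integral_cong, subst nn_integral_multc, measurable) (simp only: nn_integral_CN_eq_q)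
  finally show ?thesis .
qed

lemma block_law_eq_density:
  assumes x: "sqnorm n x = P"
  shows "block_law x = density (lborel_vec n) (\<lambda>y. ennreal (q (sqnorm n y) (cinner n x y)))"
proof (rule measure_eqI)
  fix A assume "A \<in> sets (block_law x)"
  then have [measurable]: "A \<in> sets (borel_vec n)" by simp
  have "emeasure (block_law x) A = (\<integral>\<^sup>+y. indicator A y \<partial>block_law x)" by simp
  also have "\<dots> = (\<integral>\<^sup>+y. ennreal (q (sqnorm n y) (cinner n x y)) * indicator A y \<partial>lborel_vec n)"
    by (rule nn_integral_block_law_density[OF _ x]) measurable
  also have "\<dots> = emeasure (density (lborel_vec n) (\<lambda>y. ennreal (q (sqnorm n y) (cinner n x y)))) A"
    by (rule emeasure_density[symmetric]) measurable
  finally show "emeasure (block_law x) A = emeasure (density (lborel_vec n) (\<lambda>y. ennreal (q (sqnorm n y) (cinner n x y)))) A" .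
qed (simp add: sets_lborel_vec)

text \<open>Both statistics of \<open>h * x + w\<close> are functions of \<open>h\<close>,
  \<open>|w|^2\<close>, \<open><x, w>\<close> and \<open>|x|^2 = P\<close>. For fixed
  \<open>h\<close>, unitary invariance of the noise replaces \<open><x, w>\<close> by
  \<open>sqrt P\<close> times \<open>w 0\<close>, an expression that no longer mentions
  \<open>x\<close>.\<close>

lemma nn_integral_block_law_invariant:
  assumes [measurable]: "case_prod f \<in> borel_measurable (borel \<Otimes>\<^sub>M borel)" and x: "sqnorm n x = P" and x': "sqnorm n x' = P"
  shows "(\<integral>\<^sup>+y. f (sqnorm n y) (cinner n x y) \<partial>block_law x) = (\<integral>\<^sup>+y. f (sqnorm n y) (cinner n x' y) \<partial>block_law x')"
proof -
  have "(\<integral>\<^sup>+y. f (sqnorm n y) (cinner n x y) \<partial>block_law x)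
    = (\<integral>\<^sup>+h. \<integral>\<^sup>+w. f ((cmod h)\<^sup>2 * P + 2 * Re (cnj h * (complex_of_real (sqrt P) * w 0)) + sqnorm n w)
           (h * complex_of_real P + complex_of_real (sqrt P) * w 0) \<partial>CN_std_vec n \<partial>CN \<mu> \<sigma>2)" if x: "sqnorm n x = P" for x
  proof -
    have "(\<integral>\<^sup>+y. f (sqnorm n y) (cinner n x y) \<partial>block_law x)
      = (\<integral>\<^sup>+h. \<integral>\<^sup>+w. f ((cmod h)\<^sup>2 * P + 2 * Re (cnj h * cinner n x w) + sqnorm n w)
           (h * complex_of_real P + cinner n x w) \<partial>CN_std_vec n \<partial>CN \<mu> \<sigma>2)"
      by (subst nn_integral_block_law, measurable) (simp only: sqnorm_restrict cinner_restrict sqnorm_lincomb cinner_lincomb_right cinner_self x)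
    also have "\<dots> = (\<integral>\<^sup>+h. \<integral>\<^sup>+w. f ((cmod h)\<^sup>2 * P + 2 * Re (cnj h * (complex_of_real (sqrt P) * w 0)) + sqnorm n w)
           (h * complex_of_real P + complex_of_real (sqrt P) * w 0) \<partial>CN_std_vec n \<partial>CN \<mu> \<sigma>2)"
    proof (rule nn_integral_cong)
      fix h
      show "(\<integral>\<^sup>+w. f ((cmod h)\<^sup>2 * P + 2 * Re (cnj h * cinner n x w) + sqnorm n w)
           (h * complex_of_real P + cinner n x w) \<partial>CN_std_vec n)
         = (\<integral>\<^sup>+w. f ((cmod h)\<^sup>2 * P + 2 * Re (cnj h * (complex_of_real (sqrt P) * w 0)) + sqnorm n w)
           (h * complex_of_real P + complex_of_real (sqrt P) * w 0) \<partial>CN_std_vec n)"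
        by (rule nn_integral_CN_std_vec_rotate[OF _ n_pos, of "\<lambda>t z. f ((cmod h)\<^sup>2 * P + 2 * Re (cnj h * z) + t) (h * complex_of_real P + z)" x, unfolded x])
           measurable
    qed
    finally show ?thesis .
  qed
  from this[OF x] this[OF x'] show ?thesis by simp
qed

section \<open>The law of \<open>W_tilde\<close> as the output law of a particular codeword
  block\<close>

definition W_mean :: "nat \<Rightarrow> complex" where
  "W_mean i = (if i = 0 then \<mu> * complex_of_real (sqrt P) else 0)"

definition W_var :: "nat \<Rightarrow> real" where
  "W_var i = (if i = 0 then \<sigma>2 * P + 1 else 1)"

lemma W_var_pos: "W_var i > 0"
  using P_pos sigma_pos by (simp add: W_var_def add_pos_pos)

text \<open>\<open>W_tilde\<close> is not restricted to the index set, but beyond it returns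
  \<open>w i\<close>, which is \<open>undefined\<close> on the product space. Index 0, where it
  differs from \<open>w\<close>, is inside since \<open>n\<close> is positive.\<close>

lemma W_tilde_eq:
  assumes "w \<in> space (borel_vec n)"
  shows "W_tilde \<mu> \<sigma>2 n \<rho> w = (\<lambda>i\<in>{..<n}. W_mean i + complex_of_real (sqrt (W_var i)) * w i)"
proof
  fix i
  have "i \<ge> n \<Longrightarrow> w i = undefined" using assms
    by (auto simp: space_PiM PiE_iff extensional_def)
  then show "W_tilde \<mu> \<sigma>2 n \<rho> w i = (\<lambda>i\<in>{..<n}. W_mean i + complex_of_real (sqrt (W_var i)) * w i) i"
    using n_pos by (auto simp: W_tilde_def W_mean_def W_var_def P_def mult.assoc)
qed

lemma measurable_W_tilde[measurable]: "W_tilde \<mu> \<sigma>2 n \<rho> \<in> borel_vec n \<rightarrow>\<^sub>M borel_vec n"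
proof -
  have "(\<lambda>w. \<lambda>i\<in>{..<n}. W_mean i + complex_of_real (sqrt (W_var i)) * w i) \<in> borel_vec n \<rightarrow>\<^sub>M borel_vec n"
    by (intro measurable_restrict) measurable
  then show ?thesis
    by (simp add: W_tilde_eq cong: measurable_cong)
qed

text \<open>Scaled to squared norm \<open>P\<close>: a codeword block, not a unit vector.\<close>

definition e1 :: "nat \<Rightarrow> complex" where
  "e1 = (\<lambda>i\<in>{..<n}. if i = 0 then complex_of_real (sqrt P) else 0)"

lemma sqnorm_e1: "sqnorm n e1 = P"
proof -
  have "sqnorm n e1 = (\<Sum>i<n. if i = 0 then P else 0)"
    unfolding sqnorm_def e1_def using P_pos by (intro sum.cong) auto
  then show ?thesis using n_pos by simp
qed

lemma cinner_e1: "cinner n e1 y = complex_of_real (sqrt P) * y 0"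
proof -
  have "cinner n e1 y = (\<Sum>i<n. if i = 0 then complex_of_real (sqrt P) * y 0 else 0)"
    unfolding cinner_def e1_def by (intro sum.cong) auto
  then show ?thesis using n_pos by simp
qed

text \<open>The output of the block \<open>e1\<close> involves a fading variable besides the noise,
  while \<open>W_tilde\<close> transforms the noise alone. The laws agree because both have the
  Lebesgue density \<open>f_Y_e1\<close>.\<close>

lemma distr_W_tilde: "distr (CN_std_vec n) (borel_vec n) (W_tilde \<mu> \<sigma>2 n \<rho>) = block_law e1"
proof -
  have "distr (CN_std_vec n) (borel_vec n) (W_tilde \<mu> \<sigma>2 n \<rho>)
     = distr (CN_std_vec n) (borel_vec n) (\<lambda>w. \<lambda>i\<in>{..<n}. W_mean i + complex_of_real (sqrt (W_var i)) * w i)"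
    by (intro distr_cong refl W_tilde_eq) (simp add: sets_eq_imp_space_eq[OF sets_CN_std_vec])
  also have "\<dots> = PiM {..<n} (\<lambda>i. distr (CN 0 1) borel (\<lambda>z. W_mean i + complex_of_real (sqrt (W_var i)) * z))"
    unfolding CN_std_vec_def by (rule distr_PiM_componentwise) (auto intro: prob_space_CN01)
  also have "\<dots> = PiM {..<n} (\<lambda>i. CN (W_mean i) (W_var i))"
    using W_var_pos by (subst CN_affine) (auto simp: less_imp_le)
  also have "\<dots> = density (lborel_vec n) (\<lambda>y. ennreal (\<Prod>i<n. exp (- (cmod (y i - W_mean i))\<^sup>2 / W_var i) / (pi * W_var i)))"
    by (rule PiM_CN_eq_density) (rule W_var_pos)
  also have "(\<lambda>y. ennreal (\<Prod>i<n. exp (- (cmod (y i - W_mean i))\<^sup>2 / W_var i) / (pi * W_var i))) = (\<lambda>y. ennreal (f_Y_e1 \<mu> \<sigma>2 n \<rho> y))"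
  proof (rule ext, rule arg_cong[where f = ennreal])
    fix y
    have I: "{..<n} = insert 0 {1..<n}" using n_pos by auto
    have "(\<Prod>i<n. exp (- (cmod (y i - W_mean i))\<^sup>2 / W_var i) / (pi * W_var i))
        = exp (- (cmod (y 0 - W_mean 0))\<^sup>2 / W_var 0) / (pi * W_var 0) * (\<Prod>i\<in>{1..<n}. exp (- (cmod (y i))\<^sup>2) / pi)"
      unfolding I by (simp add: W_mean_def W_var_def)
    also have "(\<Prod>i\<in>{1..<n}. exp (- (cmod (y i))\<^sup>2) / pi) = exp (- (\<Sum>i\<in>{1..<n}. (cmod (y i))\<^sup>2)) / pi ^ (n - 1)"
      by (simp add: prod_dividef exp_neg_sum)
    also have "exp (- (cmod (y 0 - W_mean 0))\<^sup>2 / W_var 0) / (pi * W_var 0) * \<dots> = f_Y_e1 \<mu> \<sigma>2 n \<rho> y"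
    proof -
      have 1: "pi ^ n = pi * pi ^ (n - 1)" using n_pos by (cases n) auto
      have 2: "exp (- (A / V + B)) = exp (- A / V) * exp (- B)" for A V B :: real
        by (simp flip: exp_add)
      show ?thesis
        unfolding f_Y_e1_def W_mean_def W_var_def P_def 1 2 by (simp add: mult_ac)
    qed
    finally show "(\<Prod>i<n. exp (- (cmod (y i - W_mean i))\<^sup>2 / W_var i) / (pi * W_var i)) = f_Y_e1 \<mu> \<sigma>2 n \<rho> y" .
  qed
  also have "density (lborel_vec n) (\<lambda>y. ennreal (f_Y_e1 \<mu> \<sigma>2 n \<rho> y)) = block_law e1"
    unfolding block_law_eq_density[OF sqnorm_e1] cinner_e1 f_Y_e1_eq_q ..
  finally show ?thesis .
qed

end

section \<open>Output density for a uniform input\<close>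

lemma besselI_eq_sph_exp:
  assumes x: "x \<ge> 0" and n: "n \<ge> 1"
  shows "besselI (n - 1) (2 * sqrt x) = sqrt x ^ (n - 1) / fact (n - 1) * sph_exp n x"
proof -
  have "besselI (n - 1) (2 * sqrt x) = (\<Sum>m. sqrt x ^ (n - 1) / fact (n - 1) * (x ^ m * fact (n - 1) / (fact m * fact (m + n - 1))))"
    unfolding besselI_def
  proof (rule suminf_cong)
    fix m
    have "sqrt x ^ (2 * m) = x ^ m" using x by (simp add: power_mult)
    then have "(2 * sqrt x / 2) ^ (2 * m + (n - 1)) = x ^ m * sqrt x ^ (n - 1)"
      by (simp add: power_add)
    moreover have "m + (n - 1) = m + n - 1" using n by simp
    ultimately show "(2 * sqrt x / 2) ^ (2 * m + (n - 1)) / (fact m * fact (m + (n - 1)))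
        = sqrt x ^ (n - 1) / fact (n - 1) * (x ^ m * fact (n - 1) / (fact m * fact (m + n - 1)))"
      by simp
  qed
  also have "\<dots> = sqrt x ^ (n - 1) / fact (n - 1) * sph_exp n x"
    unfolding sph_exp_def by (rule suminf_mult[OF summable_sph_exp[OF x]])
  finally show ?thesis .
qed

lemma measurable_besselI[measurable]: "besselI \<nu> \<in> borel_measurable borel"
  unfolding besselI_def[abs_def] by measurable

lemma cnj_cinner: "cnj (cinner n x y) = cinner n y x"
  by (simp add: cinner_def mult.commute)

text \<open>The Gaussian density is positive everywhere, so a Gaussian null set is a Lebesgue null
  set.\<close>

lemma AE_lborel_vec_nonzero:
  assumes "n \<ge> 1"
  shows "AE y in lborel_vec n. sqnorm n y \<noteq> 0"
proof -
  have "CN_std_vec n = density (lborel_vec n) (\<lambda>y. ennreal (\<Prod>i<n. exp (- (cmod (y i - 0))\<^sup>2 / 1) / (pi * 1)))"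
    unfolding CN_std_vec_def by (rule PiM_CN_eq_density) simp
  with AE_CN_std_vec_nonzero[OF assms]
  have "AE y in density (lborel_vec n) (\<lambda>y. ennreal (\<Prod>i<n. exp (- (cmod (y i - 0))\<^sup>2 / 1) / (pi * 1))). sqnorm n y \<noteq> 0"
    by (simp only:)
  then show ?thesis
    by (subst (asm) AE_density) (auto simp: prod_pos)
qed

context rician_block
begin

text \<open>Under \<open>CN_std_vec n\<close> this is a uniform point of the sphere of radius
  \<open>sqrt P\<close>. A zero vector, which has probability 0, is sent to zero through division by
  zero.\<close>

definition sphere_point :: "(nat \<Rightarrow> complex) \<Rightarrow> nat \<Rightarrow> complex" where
  "sphere_point g = (\<lambda>i\<in>{..<n}. complex_of_real (sqrt P / sqrt (sqnorm n g)) * g i)"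

lemma measurable_sphere_point[measurable]: "sphere_point \<in> borel_vec n \<rightarrow>\<^sub>M borel_vec n"
  unfolding sphere_point_def by measurable

lemma sqnorm_sphere_point:
  assumes "sqnorm n g \<noteq> 0"
  shows "sqnorm n (sphere_point g) = P"
proof -
  define r where "r = sqrt P / sqrt (sqnorm n g)"
  have "sqnorm n (sphere_point g) = r\<^sup>2 * sqnorm n g"
    unfolding sphere_point_def r_def[symmetric]
    by (simp add: sqnorm_def norm_mult power_mult_distrib sum_distrib_left)
  then show ?thesis
    using assms P_pos sqnorm_nonneg[of n g] by (simp add: r_def power_divide)
qed

lemma cinner_sphere_point:
  "cinner n (sphere_point g) y = complex_of_real (sqrt P / sqrt (sqnorm n g)) * cinner n g y"
  unfolding sphere_point_def cinner_def by (simp add: sum_distrib_left mult.assoc)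

text \<open>The value of \<open>f_Y\<close> at squared norm \<open>a\<close>, except that \<open>f_Y\<close> has a junk value at the origin
  (a division by zero if \<open>n > 1\<close>).\<close>
definition Phi :: "real \<Rightarrow> ennreal" where
  "Phi a = ennreal (exp (- a - (cmod \<mu>)\<^sup>2 / \<sigma>2) / (pi ^ n * \<sigma>2)) *
     (\<integral>\<^sup>+z. ennreal (exp (- (P + 1 / \<sigma>2) * z) * sph_exp n (z * P * a) * sph_exp 1 (z * (cmod \<mu>)\<^sup>2 / \<sigma>2\<^sup>2)) * indicator {0<..} z \<partial>lborel)"

lemma measurable_Phi[measurable]: "Phi \<in> borel_measurable borel"
  unfolding Phi_def by measurable

lemma nn_integral_sphere_exp:
  assumes y: "y \<in> space (borel_vec n)"
  shows "(\<integral>\<^sup>+g. ennreal (exp (- sqnorm n y + 2 * Re (cnj h * cinner n (sphere_point g) y) - (cmod h)\<^sup>2 * P) / pi ^ n) \<partial>CN_std_vec n)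
    = ennreal (exp (- sqnorm n y - (cmod h)\<^sup>2 * P) / pi ^ n * sph_exp n ((cmod h)\<^sup>2 * P * sqnorm n y))"
proof -
  \<comment> \<open>In \<open>cinner\<close> the random direction occupies the conjugated slot. Real
    parts do not change under conjugation, so the direction can be moved to the other slot, and
    \<open>v\<close> collects the rest.\<close>
  define v where "v i = complex_of_real (sqrt P) * cnj h * y i" for i
  have v: "sqnorm n v = (cmod h)\<^sup>2 * P * sqnorm n y"
    using P_pos by (simp add: v_def sqnorm_def norm_mult power_mult_distrib sum_distrib_left mult_ac)
  have "cinner n v g = complex_of_real (sqrt P) * (h * cinner n y g)" for g
    by (simp add: v_def cinner_def sum_distrib_left mult_ac)
  then have vg: "Re (cinner n v g) = sqrt P * Re (cnj h * cinner n g y)" for g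
    by (subst cnj_cinner[of n y g, symmetric]) simp
  have "(\<integral>\<^sup>+g. ennreal (exp (- sqnorm n y + 2 * Re (cnj h * cinner n (sphere_point g) y) - (cmod h)\<^sup>2 * P) / pi ^ n) \<partial>CN_std_vec n)
    = (\<integral>\<^sup>+g. ennreal (exp (- sqnorm n y - (cmod h)\<^sup>2 * P) / pi ^ n) * ennreal (exp (2 * Re (cinner n v g) / sqrt (sqnorm n g))) \<partial>CN_std_vec n)"
  proof (rule nn_integral_cong)
    fix g
    have "cnj h * cinner n (sphere_point g) y = complex_of_real (sqrt P / sqrt (sqnorm n g)) * (cnj h * cinner n g y)"
      unfolding cinner_sphere_point by (simp only: mult_ac)
    then have "Re (cnj h * cinner n (sphere_point g) y) = Re (cinner n v g) / sqrt (sqnorm n g)"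
      by (simp only: vg Re_complex_of_real Im_complex_of_real times_complex.simps) simp
    then have "exp (- sqnorm n y + 2 * Re (cnj h * cinner n (sphere_point g) y) - (cmod h)\<^sup>2 * P) / pi ^ n
      = exp (- sqnorm n y - (cmod h)\<^sup>2 * P) / pi ^ n * exp (2 * Re (cinner n v g) / sqrt (sqnorm n g))"
      by (simp add: exp_add[symmetric])
    then show "ennreal (exp (- sqnorm n y + 2 * Re (cnj h * cinner n (sphere_point g) y) - (cmod h)\<^sup>2 * P) / pi ^ n)
      = ennreal (exp (- sqnorm n y - (cmod h)\<^sup>2 * P) / pi ^ n) * ennreal (exp (2 * Re (cinner n v g) / sqrt (sqnorm n g)))"
      by (subst ennreal_mult''[symmetric]) auto
  qed
  also have "\<dots> = ennreal (exp (- sqnorm n y - (cmod h)\<^sup>2 * P) / pi ^ n) * ennreal (sph_exp n (sqnorm n v))"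
    by (subst nn_integral_cmult, measurable) (simp only: nn_integral_CN_std_vec_direction_exp[OF n_pos])
  also have "\<dots> = ennreal (exp (- sqnorm n y - (cmod h)\<^sup>2 * P) / pi ^ n * sph_exp n ((cmod h)\<^sup>2 * P * sqnorm n y))"
    unfolding v using P_pos by (subst ennreal_mult'') (auto intro!: sph_exp_nonneg simp: sqnorm_nonneg less_imp_le)
  finally show ?thesis .
qed

text \<open>\<open>q\<close> is unfolded into its fading integral so that the direction can be
  averaged for fixed \<open>h\<close>. The result depends on \<open>h\<close> only through its
  modulus, except for the cross term in the density of the fading; the phase average removes that as
  well, and an integral over \<open>z = |h|^2\<close> remains.\<close>

lemma nn_integral_q_sphere_point:
  assumes y: "y \<in> space (borel_vec n)"
  shows "(\<integral>\<^sup>+g. ennreal (q (sqnorm n y) (cinner n (sphere_point g) y)) \<partial>CN_std_vec n) = Phi (sqnorm n y)"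
proof -
  interpret H: prob_space "CN \<mu> \<sigma>2" by (rule prob_space_CN) (rule sigma_pos)
  interpret W: prob_space "CN_std_vec n" by (rule prob_space_CN_std_vec)
  define a where "a = sqnorm n y"
  have a: "a \<ge> 0" by (simp add: a_def sqnorm_nonneg)
  define K where "K = exp (- a - (cmod \<mu>)\<^sup>2 / \<sigma>2) / (pi ^ n * (pi * \<sigma>2))"
  define F where "F z = exp (- (P + 1 / \<sigma>2) * z) * sph_exp n (z * P * a)" for z
  have [measurable]: "F \<in> borel_measurable borel" unfolding F_def by measurable
  have F0: "F z \<ge> 0" if "z \<ge> 0" for z unfolding F_def using that a P_pos by (auto intro!: mult_nonneg_nonneg sph_exp_nonneg)
  note y[simp]
  have "(\<integral>\<^sup>+g. ennreal (q a (cinner n (sphere_point g) y)) \<partial>CN_std_vec n)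
      = (\<integral>\<^sup>+g. \<integral>\<^sup>+h. ennreal (exp (- a + 2 * Re (cnj h * cinner n (sphere_point g) y) - (cmod h)\<^sup>2 * P) / pi ^ n) \<partial>CN \<mu> \<sigma>2 \<partial>CN_std_vec n)"
    by (simp only: nn_integral_CN_eq_q)
  also have "\<dots> = (\<integral>\<^sup>+h. \<integral>\<^sup>+g. ennreal (exp (- a + 2 * Re (cnj h * cinner n (sphere_point g) y) - (cmod h)\<^sup>2 * P) / pi ^ n) \<partial>CN_std_vec n \<partial>CN \<mu> \<sigma>2)"
    by (rule pair_sigma_finite.Fubini') (unfold_locales, measurable)
  also have "\<dots> = (\<integral>\<^sup>+h. ennreal (exp (- a - (cmod h)\<^sup>2 * P) / pi ^ n * sph_exp n ((cmod h)\<^sup>2 * P * a)) \<partial>CN \<mu> \<sigma>2)"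
    unfolding a_def by (simp only: nn_integral_sphere_exp[OF y])
  also have "\<dots> = (\<integral>\<^sup>+h. ennreal (exp (- (cmod (h - \<mu>))\<^sup>2 / \<sigma>2) / (pi * \<sigma>2)) *
       ennreal (exp (- a - (cmod h)\<^sup>2 * P) / pi ^ n * sph_exp n ((cmod h)\<^sup>2 * P * a)) \<partial>lborel)"
    by (rule nn_integral_CN) measurable
  also have "\<dots> = (\<integral>\<^sup>+h. ennreal K * (ennreal (F ((cmod h)\<^sup>2)) * ennreal (exp (2 * Re (h * cnj (\<mu> / complex_of_real \<sigma>2))))) \<partial>lborel)"
  proof (rule nn_integral_cong)
    fix h
    have "Re (h * cnj (\<mu> / complex_of_real \<sigma>2)) = Re (cnj h * \<mu>) / \<sigma>2"
      by (simp add: Re_divide_of_real add_divide_distrib)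
    then have "- (cmod (h - \<mu>))\<^sup>2 / \<sigma>2 + (- a - (cmod h)\<^sup>2 * P)
       = (- a - (cmod \<mu>)\<^sup>2 / \<sigma>2) + (- (P + 1 / \<sigma>2) * (cmod h)\<^sup>2 + 2 * Re (h * cnj (\<mu> / complex_of_real \<sigma>2)))"
      using sigma_pos unfolding cmod_diff_sq by (simp add: field_simps)
    then have e: "exp (- (cmod (h - \<mu>))\<^sup>2 / \<sigma>2) * exp (- a - (cmod h)\<^sup>2 * P)
       = exp (- a - (cmod \<mu>)\<^sup>2 / \<sigma>2) * (exp (- (P + 1 / \<sigma>2) * (cmod h)\<^sup>2) * exp (2 * Re (h * cnj (\<mu> / complex_of_real \<sigma>2))))"
      by (simp only: exp_add[symmetric])
    have g: "A / X * (B / Y * S) = (A * B) * S / (Y * X)" "A / X * (B * S * C) = (A * (B * C)) * S / X" for A B C S X Y :: real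
      by (simp_all add: mult_ac)
    have "exp (- (cmod (h - \<mu>))\<^sup>2 / \<sigma>2) / (pi * \<sigma>2) * (exp (- a - (cmod h)\<^sup>2 * P) / pi ^ n * sph_exp n ((cmod h)\<^sup>2 * P * a))
       = K * (F ((cmod h)\<^sup>2) * exp (2 * Re (h * cnj (\<mu> / complex_of_real \<sigma>2))))"
      unfolding K_def F_def g e ..
    moreover have "0 \<le> exp (- a - (cmod h)\<^sup>2 * P) / pi ^ n * sph_exp n ((cmod h)\<^sup>2 * P * a)"
      using a P_pos by (intro mult_nonneg_nonneg sph_exp_nonneg) auto
    moreover have "0 \<le> F ((cmod h)\<^sup>2)" by (rule F0) simp
    ultimately show "ennreal (exp (- (cmod (h - \<mu>))\<^sup>2 / \<sigma>2) / (pi * \<sigma>2)) *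
       ennreal (exp (- a - (cmod h)\<^sup>2 * P) / pi ^ n * sph_exp n ((cmod h)\<^sup>2 * P * a))
      = ennreal K * (ennreal (F ((cmod h)\<^sup>2)) * ennreal (exp (2 * Re (h * cnj (\<mu> / complex_of_real \<sigma>2)))))"
      by (simp only: ennreal_mult''[symmetric] exp_ge_zero mult_nonneg_nonneg)
  qed
  also have "\<dots> = ennreal K * (\<integral>\<^sup>+h. ennreal (F ((cmod h)\<^sup>2)) * ennreal (exp (2 * Re (h * cnj (\<mu> / complex_of_real \<sigma>2)))) \<partial>lborel)"
    by (rule nn_integral_cmult) measurable
  also have "\<dots> = ennreal K * (\<integral>\<^sup>+h. ennreal (F ((cmod h)\<^sup>2)) * ennreal (sph_exp 1 ((cmod h)\<^sup>2 * (cmod (\<mu> / complex_of_real \<sigma>2))\<^sup>2)) \<partial>lborel)"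
    by (rule arg_cong[where f = "(*) (ennreal K)"], rule nn_integral_lborel_phase_average[of "\<lambda>z. ennreal (F z)"]) measurable
  also have "\<dots> = ennreal K * (ennreal pi * (\<integral>\<^sup>+z. ennreal (F z) * ennreal (sph_exp 1 (z * (cmod (\<mu> / complex_of_real \<sigma>2))\<^sup>2)) * indicator {0<..} z \<partial>lborel))"
    by (rule arg_cong[where f = "(*) (ennreal K)"],
        rule nn_integral_lborel_cmod_sq[of "\<lambda>z. ennreal (F z) * ennreal (sph_exp 1 (z * (cmod (\<mu> / complex_of_real \<sigma>2))\<^sup>2))"]) measurable
  also have "\<dots> = Phi a"
  proof -
    \<comment> \<open>The \<open>pi\<close> gained in passing to the squared modulus cancels the one
      in the density of the fading.\<close>
    have "ennreal K * ennreal pi = ennreal (exp (- a - (cmod \<mu>)\<^sup>2 / \<sigma>2) / (pi ^ n * \<sigma>2))"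
      unfolding K_def by (subst ennreal_mult''[symmetric]) auto
    moreover have "(\<integral>\<^sup>+z. ennreal (F z) * ennreal (sph_exp 1 (z * (cmod (\<mu> / complex_of_real \<sigma>2))\<^sup>2)) * indicator {0<..} z \<partial>lborel)
      = (\<integral>\<^sup>+z. ennreal (exp (- (P + 1 / \<sigma>2) * z) * sph_exp n (z * P * a) * sph_exp 1 (z * (cmod \<mu>)\<^sup>2 / \<sigma>2\<^sup>2)) * indicator {0<..} z \<partial>lborel)"
    proof (rule nn_integral_cong)
      fix z :: real
      show "ennreal (F z) * ennreal (sph_exp 1 (z * (cmod (\<mu> / complex_of_real \<sigma>2))\<^sup>2)) * indicator {0<..} z
        = ennreal (exp (- (P + 1 / \<sigma>2) * z) * sph_exp n (z * P * a) * sph_exp 1 (z * (cmod \<mu>)\<^sup>2 / \<sigma>2\<^sup>2)) * indicator {0<..} z"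
        using F0[of z] by (cases "z > 0") (auto simp: F_def norm_divide power_divide ennreal_mult'[symmetric])
    qed
    ultimately show ?thesis unfolding Phi_def by (simp only: mult.assoc[symmetric])
  qed
  finally show ?thesis unfolding a_def .
qed

text \<open>An average of the positive \<open>q\<close> cannot vanish. Positivity keeps the
  logarithm in \<open>S_fun\<close> meaningful.\<close>

lemma Phi_pos:
  assumes y: "y \<in> space (borel_vec n)"
  shows "Phi (sqnorm n y) > 0"
proof (rule ccontr)
  interpret W: prob_space "CN_std_vec n" by (rule prob_space_CN_std_vec)
  have [measurable]: "(\<lambda>g. cinner n (sphere_point g) y) \<in> borel_measurable (borel_vec n)"
    using y by measurable
  assume "\<not> Phi (sqnorm n y) > 0"
  then have "(\<integral>\<^sup>+g. ennreal (q (sqnorm n y) (cinner n (sphere_point g) y)) \<partial>CN_std_vec n) = 0"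
    by (simp add: nn_integral_q_sphere_point[OF y])
  then have "AE g in CN_std_vec n. ennreal (q (sqnorm n y) (cinner n (sphere_point g) y)) = 0"
    by (subst (asm) nn_integral_0_iff_AE) measurable
  then have "AE g in CN_std_vec n. False"
    by eventually_elim (metis q_pos ennreal_eq_0_iff not_le)
  then show False by simp
qed

text \<open>Tonelli gives the averaged density total mass 1, which takes the place of a growth
  estimate for the Bessel functions.\<close>

lemma AE_Phi_finite: "AE y in lborel_vec n. Phi (sqnorm n y) \<noteq> \<infinity>"
proof -
  interpret W: prob_space "CN_std_vec n" by (rule prob_space_CN_std_vec)
  interpret L: sigma_finite_measure "lborel_vec n" by (rule sigma_finite_lborel_vec)
  have sp: "y \<in> space (borel_vec n)" if "y \<in> space (lborel_vec n)" for y
    using that by (simp add: space_PiM)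
  have "(\<integral>\<^sup>+y. Phi (sqnorm n y) \<partial>lborel_vec n)
     = (\<integral>\<^sup>+y. \<integral>\<^sup>+g. ennreal (q (sqnorm n y) (cinner n (sphere_point g) y)) \<partial>CN_std_vec n \<partial>lborel_vec n)"
    by (intro nn_integral_cong) (simp add: nn_integral_q_sphere_point sp)
  also have "\<dots> = (\<integral>\<^sup>+g. \<integral>\<^sup>+y. ennreal (q (sqnorm n y) (cinner n (sphere_point g) y)) \<partial>lborel_vec n \<partial>CN_std_vec n)"
    by (rule pair_sigma_finite.Fubini') (unfold_locales, measurable)
  also have "\<dots> = (\<integral>\<^sup>+g. 1 \<partial>CN_std_vec n)"
  proof (rule nn_integral_cong_AE, use AE_CN_std_vec_nonzero[OF n_pos] in eventually_elim)
    fix g assume "sqnorm n g \<noteq> 0"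
    from nn_integral_block_law_density[OF _ sqnorm_sphere_point[OF this], of "\<lambda>_. 1"]
    show "(\<integral>\<^sup>+y. ennreal (q (sqnorm n y) (cinner n (sphere_point g) y)) \<partial>lborel_vec n) = 1"
      using prob_space.emeasure_space_1[OF prob_space_block_law] by simp
  qed
  also have "\<dots> = 1" by (simp add: W.emeasure_space_1)
  finally show ?thesis
    by (intro nn_integral_PInf_AE) auto
qed

lemma measurable_f_Y[measurable]: "f_Y \<mu> \<sigma>2 n \<rho> \<in> borel_measurable (borel_vec n)"
  unfolding f_Y_def set_lebesgue_integral_def by measurable

lemma f_Y_eq_Phi:
  assumes y: "sqnorm n y \<noteq> 0"
  shows "f_Y \<mu> \<sigma>2 n \<rho> y = enn2real (Phi (sqnorm n y))"
proof -
  define a where "a = sqnorm n y"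
  have a: "a > 0" using y sqnorm_nonneg[of n y] by (simp add: a_def)
  define J where "J z = exp (- (P + 1 / \<sigma>2) * z) * sph_exp n (z * P * a) * sph_exp 1 (z * (cmod \<mu>)\<^sup>2 / \<sigma>2\<^sup>2)" for z
  have [measurable]: "J \<in> borel_measurable borel" unfolding J_def by measurable
  have J0: "J z \<ge> 0" if "z \<ge> 0" for z
    unfolding J_def using that a P_pos by (auto intro!: mult_nonneg_nonneg sph_exp_nonneg divide_nonneg_nonneg)
  define L where "L z = exp (- (\<rho> * real n + 1 / \<sigma>2) * z) / (sqrt (a * \<rho> * real n * z)) ^ (n - 1)
        * besselI 0 (2 * sqrt (z * (cmod \<mu>)\<^sup>2 / \<sigma>2 ^ 2)) * besselI (n - 1) (2 * sqrt (a * \<rho> * real n * z))" for z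
  have [measurable]: "L \<in> borel_measurable borel" unfolding L_def by measurable
  have J: "L z = J z / fact (n - 1)" if z: "z > 0" for z
  proof -
    have 1: "a * \<rho> * real n * z = z * P * a" "\<rho> * real n = P" by (simp_all add: P_def)
    have p: "z * P * a > 0" using z P_pos a by simp
    have 2: "besselI 0 (2 * sqrt (z * (cmod \<mu>)\<^sup>2 / \<sigma>2 ^ 2)) = sph_exp 1 (z * (cmod \<mu>)\<^sup>2 / \<sigma>2\<^sup>2)"
      using besselI_eq_sph_exp[of "z * (cmod \<mu>)\<^sup>2 / \<sigma>2\<^sup>2" 1] z by simp
    have 3: "besselI (n - 1) (2 * sqrt (z * P * a)) = sqrt (z * P * a) ^ (n - 1) / fact (n - 1) * sph_exp n (z * P * a)"
      using p by (intro besselI_eq_sph_exp n_pos) simp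
    \<comment> \<open>The power in the denominator cancels the leading factor of the Bessel
      function; positivity of \<open>a\<close> enters here.\<close>
    have "sqrt (z * P * a) ^ (n - 1) \<noteq> 0" using z P_pos a by simp
    then show ?thesis unfolding L_def 1 2 3 J_def using z P_pos a by (auto simp: field_simps)
  qed
  define I where "I = (\<integral>\<^sup>+z. ennreal (J z) * indicator {0<..} z \<partial>lborel)"
  have "(LBINT z:{0..}. L z) = (\<integral>z. J z / fact (n - 1) * indicator {0<..} z \<partial>lborel)"
    unfolding set_lebesgue_integral_def
  proof (rule integral_cong_AE)
    show "AE z in lborel. indicator {0..} z *\<^sub>R L z = J z / fact (n - 1) * indicator {0<..} z"
      using AE_lborel_singleton[of "0::real"]
    proof eventually_elim
      case (elim z)
      then show ?case using J[of z] by (cases "z > 0") (auto simp: indicator_def)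
    qed
  qed measurable
  \<comment> \<open>Finiteness is not at issue: for an infinite integral both the Bochner integral
    and \<open>enn2real\<close> give 0.\<close>
  also have "\<dots> = enn2real (\<integral>\<^sup>+z. ennreal (J z / fact (n - 1) * indicator {0<..} z) \<partial>lborel)"
    by (intro integral_eq_nn_integral) (auto intro!: AE_I2 simp: J0 indicator_def)
  also have "(\<integral>\<^sup>+z. ennreal (J z / fact (n - 1) * indicator {0<..} z) \<partial>lborel) = ennreal (1 / fact (n - 1)) * I"
    unfolding I_def
    by (subst nn_integral_cmult[symmetric]) (auto intro!: nn_integral_cong simp: ennreal_mult'[symmetric] indicator_def)
  finally have LB: "(LBINT z:{0..}. L z) = enn2real I / fact (n - 1)"
    by (simp add: enn2real_mult)
  have G: "Gamma (real n) = fact (n - 1)"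
    using n_pos Gamma_fact[of "n - 1", where 'a = real] by (simp add: of_nat_diff)
  have e: "exp (- a - (cmod \<mu>)\<^sup>2 / \<sigma>2) = exp (- a) * exp (- (cmod \<mu>)\<^sup>2 / \<sigma>2)"
    by (simp flip: exp_add)
  have "f_Y \<mu> \<sigma>2 n \<rho> y = exp (- a - (cmod \<mu>)\<^sup>2 / \<sigma>2) / (pi ^ n * \<sigma>2) * enn2real I"
    unfolding f_Y_def a_def[symmetric] L_def[symmetric] LB G e by (simp add: mult_ac)
  also have "\<dots> = enn2real (Phi a)"
    unfolding Phi_def J_def[symmetric] I_def[symmetric] using sigma_pos by (simp add: enn2real_mult)
  finally show ?thesis unfolding a_def .
qed

end

section \<open>Dependence testing\<close>

text \<open>A function above its mean almost everywhere would have too large an integral.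
  \<open>Q\<close> lets the point be chosen outside a null set.\<close>

lemma (in prob_space) exists_le_nn_integral:
  assumes [measurable]: "f \<in> borel_measurable M" and Q: "AE x in M. Q x"
  shows "\<exists>x\<in>space M. Q x \<and> f x \<le> (\<integral>\<^sup>+x. f x \<partial>M)"
proof (rule ccontr)
  define I where "I = (\<integral>\<^sup>+x. f x \<partial>M)"
  assume neg: "\<not> (\<exists>x\<in>space M. Q x \<and> f x \<le> (\<integral>\<^sup>+x. f x \<partial>M))"
  have less: "AE x in M. I < f x"
    using Q AE_space
  proof eventually_elim
    case (elim x)
    then show ?case using neg by (auto simp: I_def not_le)
  qed
  \<comment> \<open>A value above the mean shows that the mean is finite, as the strict comparison
    of integrals requires.\<close>
  have "\<exists>x. I < f x"
  proof (rule ccontr)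
    assume "\<not> ?thesis"
    with less have "AE x in M. False" by simp
    then show False by simp
  qed
  then have I: "I \<noteq> \<infinity>" by auto
  have "(\<integral>\<^sup>+x. I \<partial>M) < (\<integral>\<^sup>+x. f x \<partial>M)"
  proof (rule nn_integral_less)
    show "(\<integral>\<^sup>+x. I \<partial>M) \<noteq> \<infinity>" using I by (simp add: emeasure_space_1)
    show "AE x in M. I \<le> f x" using less by eventually_elim simp
    show "\<not> (AE x in M. f x \<le> I)"
    proof
      assume "AE x in M. f x \<le> I"
      with less have "AE x in M. False" by eventually_elim simp
      then show False by simp
    qed
  qed auto
  then show False by (simp add: emeasure_space_1 I_def)
qed

text \<open>Random coding derandomised one codeword at a time: the next codeword is chosen so that the
  expected cost of completing the codebook with independent codewords does not increase.\<close>
lemma (in prob_space) exists_codebook: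
  assumes A: "A \<in> borel_measurable M" and B[measurable]: "case_prod B \<in> borel_measurable (M \<Otimes>\<^sub>M M)"
    and Q: "AE x in M. Q x"
  shows "\<exists>c. (\<forall>j<m. c j \<in> space M \<and> Q (c j)) \<and>
    (\<Sum>j<m. A (c j)) + (\<Sum>j<m. \<Sum>i<j. B (c i) (c j))
      \<le> of_nat m * (\<integral>\<^sup>+x. A x \<partial>M) + of_nat (m choose 2) * (\<integral>\<^sup>+x. \<integral>\<^sup>+y. B x y \<partial>M \<partial>M)"
  using A
proof (induction m arbitrary: A)
  case 0
  then show ?case by simp
next
  case (Suc m)
  note [measurable] = Suc.prems
  define a where "a = (\<integral>\<^sup>+x. A x \<partial>M)"
  define b where "b = (\<integral>\<^sup>+x. \<integral>\<^sup>+y. B x y \<partial>M \<partial>M)"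
  \<comment> \<open>The part of the expected total cost that depends on the first codeword
    \<open>x\<close>: its own cost and its expected interaction with the \<open>m\<close> codewords
    to come.\<close>
  have "\<exists>x\<in>space M. Q x \<and> A x + of_nat m * (\<integral>\<^sup>+y. B x y \<partial>M) \<le> (\<integral>\<^sup>+x. A x + of_nat m * (\<integral>\<^sup>+y. B x y \<partial>M) \<partial>M)"
    by (rule exists_le_nn_integral[OF _ Q]) measurable
  also have "(\<integral>\<^sup>+x. A x + of_nat m * (\<integral>\<^sup>+y. B x y \<partial>M) \<partial>M) = a + of_nat m * b"
    unfolding a_def b_def by (subst nn_integral_add) (auto simp: nn_integral_cmult)
  finally obtain x where x: "x \<in> space M" "Q x" "A x + of_nat m * (\<integral>\<^sup>+y. B x y \<partial>M) \<le> a + of_nat m * b"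
    by blast
  have [measurable]: "B x \<in> borel_measurable M"
    using measurable_compose[OF measurable_Pair1'[OF x(1)] B] by simp
  \<comment> \<open>Once \<open>x\<close> is fixed, its interaction with a later codeword is a cost
    of that codeword alone. This is why the induction lets \<open>A\<close> vary.\<close>
  have "(\<lambda>y. A y + B x y) \<in> borel_measurable M" by measurable
  from Suc.IH[OF this] obtain c where c: "\<forall>j<m. c j \<in> space M \<and> Q (c j)"
    "(\<Sum>j<m. A (c j) + B x (c j)) + (\<Sum>j<m. \<Sum>i<j. B (c i) (c j))
      \<le> of_nat m * (\<integral>\<^sup>+y. A y + B x y \<partial>M) + of_nat (m choose 2) * b"
    unfolding b_def by blast
  define d where "d = case_nat x c"
  have d: "d 0 = x" "d (Suc j) = c j" for j by (simp_all add: d_def)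
  have "(\<Sum>j<Suc m. A (d j)) + (\<Sum>j<Suc m. \<Sum>i<j. B (d i) (d j))
     = A x + ((\<Sum>j<m. A (c j) + B x (c j)) + (\<Sum>j<m. \<Sum>i<j. B (c i) (c j)))"
    unfolding sum.lessThan_Suc_shift d by (simp add: sum.distrib add_ac)
  also have "\<dots> \<le> A x + (of_nat m * (a + (\<integral>\<^sup>+y. B x y \<partial>M)) + of_nat (m choose 2) * b)"
    using c(2) unfolding a_def by (subst (asm) nn_integral_add) (auto intro: add_left_mono)
  also have "\<dots> = (A x + of_nat m * (\<integral>\<^sup>+y. B x y \<partial>M)) + of_nat m * a + of_nat (m choose 2) * b"
    by (simp add: distrib_left add_ac)
  also have "\<dots> \<le> (a + of_nat m * b) + of_nat m * a + of_nat (m choose 2) * b"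
    by (intro add_right_mono x(3))
  also have "\<dots> = of_nat (Suc m) * a + of_nat (Suc m choose 2) * b"
    by (simp add: numeral_2_eq_2 distrib_right add_ac)
  finally have "(\<Sum>j<Suc m. A (d j)) + (\<Sum>j<Suc m. \<Sum>i<j. B (d i) (d j)) \<le> of_nat (Suc m) * a + of_nat (Suc m choose 2) * b" .
  moreover have "\<forall>j<Suc m. d j \<in> space M \<and> Q (d j)"
    using c(1) x by (auto simp: d_def split: nat.split)
  ultimately show ?case unfolding a_def b_def by blast
qed

text \<open>The dependence-testing bound: the decoder picks the first codeword whose likelihood exceeds
  \<open>(m - 1) / 2\<close> times the average likelihood.\<close>
lemma dependence_testing_bound:
  assumes "prob_space M" "sigma_finite_measure N"
    and p[measurable]: "case_prod p \<in> borel_measurable (M \<Otimes>\<^sub>M N)"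
    and F[measurable]: "F \<in> borel_measurable N"
    and Fp: "\<And>y. y \<in> space N \<Longrightarrow> F y = (\<integral>\<^sup>+x. p x y \<partial>M)"
    and Q: "AE x in M. Q x" and m: "m \<ge> 1"
  shows "\<exists>c g. (\<forall>j<m. c j \<in> space M \<and> Q (c j)) \<and> g \<in> N \<rightarrow>\<^sub>M count_space (UNIV :: nat set) \<and>
    (\<Sum>j<m. emeasure (density N (p (c j))) {y \<in> space N. g y \<noteq> j})
      \<le> of_nat m * (\<integral>\<^sup>+x. \<integral>\<^sup>+y. min (p x y) (ennreal ((real m - 1) / 2) * F y) \<partial>N \<partial>M)"
proof -
  interpret M: prob_space M by fact
  interpret N: sigma_finite_measure N by fact
  interpret MN: pair_sigma_finite M N ..
  define \<beta> where "\<beta> = ennreal ((real m - 1) / 2)"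
  \<comment> \<open>\<open>A x\<close> is the probability that the sent \<open>x\<close> fails its
    test, and \<open>B x x'\<close> that \<open>x\<close> passes when \<open>x'\<close> is sent. A
    codeword is lost only if it fails or an earlier one passes, hence sums over
    \<open>i < j\<close>.\<close>
  define A where "A x = (\<integral>\<^sup>+y. (if p x y \<le> \<beta> * F y then p x y else 0) \<partial>N)" for x
  define B where "B x x' = (\<integral>\<^sup>+y. (if \<beta> * F y < p x y then p x' y else 0) \<partial>N)" for x x'
  have [measurable]: "A \<in> borel_measurable M" unfolding A_def by measurable
  have [measurable]: "case_prod B \<in> borel_measurable (M \<Otimes>\<^sub>M M)" unfolding B_def by measurable
  obtain c where c: "\<forall>j<m. c j \<in> space M \<and> Q (c j)" and
    le: "(\<Sum>j<m. A (c j)) + (\<Sum>j<m. \<Sum>i<j. B (c i) (c j))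
      \<le> of_nat m * (\<integral>\<^sup>+x. A x \<partial>M) + of_nat (m choose 2) * (\<integral>\<^sup>+x. \<integral>\<^sup>+x'. B x x' \<partial>M \<partial>M)"
    using M.exists_codebook[of A B Q m] Q by auto
  have [measurable]: "p (c j) \<in> borel_measurable N" if "j < m" for j
    using measurable_compose[OF measurable_Pair1' p, of "c j"] c that by simp
  \<comment> \<open>the value \<open>m\<close> stands for a decoding failure\<close>
  define g where "g y = (LEAST j. m \<le> j \<or> \<beta> * F y < p (c j) y)" for y
  have g[measurable]: "g \<in> N \<rightarrow>\<^sub>M count_space (UNIV :: nat set)"
  proof -
    have "Measurable.pred N (\<lambda>y. m \<le> j \<or> \<beta> * F y < p (c j) y)" for j
      by (cases "j < m") auto
    then show ?thesis unfolding g_def by (rule measurable_Least)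
  qed
  have err: "emeasure (density N (p (c j))) {y \<in> space N. g y \<noteq> j} \<le> A (c j) + (\<Sum>i<j. B (c i) (c j))" if j: "j < m" for j
  proof -
    have [measurable]: "p (c j) \<in> borel_measurable N" using j by simp
    have mi[measurable]: "(\<lambda>y. if \<beta> * F y < p (c i) y then p (c j) y else 0) \<in> borel_measurable N" if "i \<in> {..<j}" for i
    proof -
      have [measurable]: "p (c i) \<in> borel_measurable N" using j that by simp
      show ?thesis by measurable
    qed
    have "emeasure (density N (p (c j))) {y \<in> space N. g y \<noteq> j} = (\<integral>\<^sup>+y. p (c j) y * indicator {y \<in> space N. g y \<noteq> j} y \<partial>N)"
      using j by (intro emeasure_density) auto
    also have "\<dots> \<le> (\<integral>\<^sup>+y. (if p (c j) y \<le> \<beta> * F y then p (c j) y else 0) + (\<Sum>i<j. if \<beta> * F y < p (c i) y then p (c j) y else 0) \<partial>N)"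
    proof (rule nn_integral_mono)
      fix y
      show "p (c j) y * indicator {y \<in> space N. g y \<noteq> j} y
         \<le> (if p (c j) y \<le> \<beta> * F y then p (c j) y else 0) + (\<Sum>i<j. if \<beta> * F y < p (c i) y then p (c j) y else 0)"
      proof (cases "\<beta> * F y < p (c j) y \<and> g y \<noteq> j")
        case True
        have "\<exists>i<j. \<beta> * F y < p (c i) y"
        proof (rule ccontr)
          assume "\<not> ?thesis"
          then have "g y = j"
            unfolding g_def using True j by (intro Least_equality) (auto simp: not_less[symmetric] intro: leI)
          then show False using True by simp
        qed
        then obtain i where i: "i < j" "\<beta> * F y < p (c i) y" by blast
        have "p (c j) y \<le> (\<Sum>i<j. if \<beta> * F y < p (c i) y then p (c j) y else 0)"
          using member_le_sum[of i "{..<j}" "\<lambda>i. if \<beta> * F y < p (c i) y then p (c j) y else 0"] i by simp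
        then show ?thesis by (auto split: split_indicator intro: order_trans add_increasing)
      next
        case False
        then show ?thesis by (auto split: split_indicator)
      qed
    qed
    also have "\<dots> = A (c j) + (\<Sum>i<j. B (c i) (c j))"
    proof -
      have "(\<integral>\<^sup>+y. (\<Sum>i<j. if \<beta> * F y < p (c i) y then p (c j) y else 0) \<partial>N) = (\<Sum>i<j. B (c i) (c j))"
        unfolding B_def by (rule nn_integral_sum) (rule mi)
      moreover have "(\<lambda>y. \<Sum>i<j. if \<beta> * F y < p (c i) y then p (c j) y else 0) \<in> borel_measurable N"
        by (rule borel_measurable_sum) (rule mi)
      ultimately show ?thesis
        unfolding A_def by (subst nn_integral_add) simp_all
    qed
    finally show ?thesis .
  qed
  \<comment> \<open>Averaging over the independent sent codeword turns its likelihood into the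
    output density.\<close>
  have BF: "(\<integral>\<^sup>+x'. B x x' \<partial>M) = (\<integral>\<^sup>+y. (if \<beta> * F y < p x y then F y else 0) \<partial>N)" if x: "x \<in> space M" for x
  proof -
    have [measurable]: "p x \<in> borel_measurable N"
      using measurable_compose[OF measurable_Pair1'[OF x] p] by simp
    have "(\<integral>\<^sup>+x'. B x x' \<partial>M) = (\<integral>\<^sup>+y. \<integral>\<^sup>+x'. (if \<beta> * F y < p x y then p x' y else 0) \<partial>M \<partial>N)"
      unfolding B_def by (rule MN.Fubini'[symmetric]) measurable
    also have "\<dots> = (\<integral>\<^sup>+y. (if \<beta> * F y < p x y then F y else 0) \<partial>N)"
      by (intro nn_integral_cong) (simp add: Fp)
    finally show ?thesis .
  qed
  \<comment> \<open>This count of ordered pairs \<open>i < j\<close>, spread over the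
    \<open>m\<close> messages, dictates the threshold constant.\<close>
  have "of_nat (m choose 2) = of_nat m * \<beta>"
  proof -
    have "real (m choose 2) = real m * ((real m - 1) / 2)"
      using m by (simp add: choose_two real_of_nat_div of_nat_diff)
    then have "ennreal (real (m choose 2)) = ennreal (real m) * \<beta>"
      unfolding \<beta>_def using m by (simp add: ennreal_mult'[symmetric])
    then show ?thesis by (simp add: ennreal_of_nat_eq_real_of_nat)
  qed
  then have "of_nat m * (\<integral>\<^sup>+x. A x \<partial>M) + of_nat (m choose 2) * (\<integral>\<^sup>+x. \<integral>\<^sup>+x'. B x x' \<partial>M \<partial>M)
     = of_nat m * ((\<integral>\<^sup>+x. A x \<partial>M) + \<beta> * (\<integral>\<^sup>+x. \<integral>\<^sup>+y. (if \<beta> * F y < p x y then F y else 0) \<partial>N \<partial>M))"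
    by (simp add: distrib_left mult.assoc BF cong: nn_integral_cong)
  also have "(\<integral>\<^sup>+x. A x \<partial>M) + \<beta> * (\<integral>\<^sup>+x. \<integral>\<^sup>+y. (if \<beta> * F y < p x y then F y else 0) \<partial>N \<partial>M)
     = (\<integral>\<^sup>+x. A x + \<beta> * (\<integral>\<^sup>+y. (if \<beta> * F y < p x y then F y else 0) \<partial>N) \<partial>M)"
    by (subst nn_integral_add) (auto simp: nn_integral_cmult)
  \<comment> \<open>At each \<open>y\<close> exactly one of the two terms is present: the likelihood
    if it is at most \<open>\<beta> * F y\<close>, otherwise \<open>\<beta> * F y\<close>.\<close>
  also have "\<dots> = (\<integral>\<^sup>+x. \<integral>\<^sup>+y. min (p x y) (\<beta> * F y) \<partial>N \<partial>M)"
  proof (rule nn_integral_cong)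
    fix x assume x: "x \<in> space M"
    have [measurable]: "p x \<in> borel_measurable N"
      using measurable_compose[OF measurable_Pair1'[OF x] p] by simp
    have "A x + \<beta> * (\<integral>\<^sup>+y. (if \<beta> * F y < p x y then F y else 0) \<partial>N)
       = (\<integral>\<^sup>+y. (if p x y \<le> \<beta> * F y then p x y else 0) + \<beta> * (if \<beta> * F y < p x y then F y else 0) \<partial>N)"
      unfolding A_def by (subst nn_integral_add) (auto simp: nn_integral_cmult)
    also have "\<dots> = (\<integral>\<^sup>+y. min (p x y) (\<beta> * F y) \<partial>N)"
      by (intro nn_integral_cong) (auto simp: min_def)
    finally show "A x + \<beta> * (\<integral>\<^sup>+y. (if \<beta> * F y < p x y then F y else 0) \<partial>N) = (\<integral>\<^sup>+y. min (p x y) (\<beta> * F y) \<partial>N)" .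
  qed
  finally have "(\<Sum>j<m. A (c j)) + (\<Sum>j<m. \<Sum>i<j. B (c i) (c j)) \<le> of_nat m * (\<integral>\<^sup>+x. \<integral>\<^sup>+y. min (p x y) (\<beta> * F y) \<partial>N \<partial>M)"
    using le by simp
  moreover have "(\<Sum>j<m. emeasure (density N (p (c j))) {y \<in> space N. g y \<noteq> j}) \<le> (\<Sum>j<m. A (c j)) + (\<Sum>j<m. \<Sum>i<j. B (c i) (c j))"
    unfolding sum.distrib[symmetric] by (intro sum_mono err) simp
  ultimately show ?thesis
    using c g unfolding \<beta>_def by (intro exI[of _ c] exI[of _ g]) auto
qed

section \<open>Several blocks\<close>

lemma ennreal_mult_min: "(p::ennreal) * min a b = min (p * a) (p * b)"
  by (cases "a \<le> b") (auto simp: min_def mult_left_mono intro: antisym)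

text \<open>Turns the positive part in \<open>eps_ub\<close> into the minimum delivered by the
  decoder.\<close>

lemma exp_neg_max_ln:
  fixes b s :: real
  assumes "b > 0"
  shows "exp (- max 0 (s - ln b)) = min 1 (b * exp (- s))"
proof (cases "s \<le> ln b")
  case True
  then have "1 \<le> exp (ln b - s)" by simp
  also have "exp (ln b - s) = b * exp (- s)" using assms by (simp add: exp_diff exp_minus field_simps)
  finally show ?thesis using True by simp
next
  case False
  then have "exp (ln b - s) \<le> 1" by simp
  moreover have "exp (ln b - s) = b * exp (- s)" using assms by (simp add: exp_diff exp_minus field_simps)
  ultimately show ?thesis using False by (simp add: max_def min_def)
qed

context rician_block
begin

text \<open>The inverse likelihood ratio. Taking values in \<open>ennreal\<close>, it remains
  defined where \<open>Phi\<close> is infinite.\<close>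

definition tau :: "real \<Rightarrow> complex \<Rightarrow> ennreal" where
  "tau a t = Phi a * ennreal (1 / q a t)"

lemma measurable_tau[measurable]: "case_prod tau \<in> borel_measurable (borel \<Otimes>\<^sub>M borel)"
  unfolding tau_def by measurable

lemma q_tau: "ennreal (q a t) * tau a t = Phi a"
proof -
  have "ennreal (q a t) * ennreal (1 / q a t) = 1"
    using q_pos[of a t] by (subst ennreal_mult'[symmetric]) auto
  then show ?thesis unfolding tau_def by (metis mult.left_commute mult_1_right)
qed

definition tau_law :: "ennreal measure" where
  "tau_law = distr (block_law e1) borel (\<lambda>y. tau (sqnorm n y) (cinner n e1 y))"

lemma distr_block_law_tau:
  assumes x: "sqnorm n x = P"
  shows "distr (block_law x) borel (\<lambda>y. tau (sqnorm n y) (cinner n x y)) = tau_law"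
proof (rule measure_eqI)
  fix A assume "A \<in> sets (distr (block_law x) borel (\<lambda>y. tau (sqnorm n y) (cinner n x y)))"
  then have [measurable]: "A \<in> sets borel" by simp
  have *: "emeasure (distr (block_law x) borel (\<lambda>y. tau (sqnorm n y) (cinner n x y))) A
     = (\<integral>\<^sup>+y. indicator A (tau (sqnorm n y) (cinner n x y)) \<partial>block_law x)" for x
    by (subst nn_integral_indicator[symmetric], simp, subst nn_integral_distr) auto
  show "emeasure (distr (block_law x) borel (\<lambda>y. tau (sqnorm n y) (cinner n x y))) A = emeasure tau_law A"
    unfolding tau_law_def *
    by (rule nn_integral_block_law_invariant[OF _ x sqnorm_e1, of "\<lambda>a t. indicator A (tau a t)"]) measurable
qed (simp add: tau_law_def)

abbreviation lborel_blocks :: "nat \<Rightarrow> (nat \<Rightarrow> nat \<Rightarrow> complex) measure" where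
  "lborel_blocks l \<equiv> PiM {..<l} (\<lambda>_. lborel_vec n)"

lemma product_sigma_finite_lborel_vec: "product_sigma_finite (\<lambda>_. lborel_vec n)"
  using sigma_finite_lborel_vec by (simp add: product_sigma_finite_def)

lemma sets_lborel_blocks[measurable_cong]: "sets (lborel_blocks l) = sets (PiM {..<l} (\<lambda>_. borel_vec n))"
  by (intro sets_PiM_cong sets_lborel_vec refl)

lemma PiM_block_law:
  assumes x: "\<And>k. k < l \<Longrightarrow> sqnorm n (x k) = P"
  shows "PiM {..<l} (\<lambda>k. block_law (x k))
     = density (lborel_blocks l) (\<lambda>y. \<Prod>k<l. ennreal (q (sqnorm n (y k)) (cinner n (x k) (y k))))"
proof -
  \<comment> \<open>\<open>product_sigma_finite\<close> speaks about all indices, so the codeword is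
    continued by \<open>e1\<close> beyond the \<open>l\<close> blocks.\<close>
  define x' where "x' k = (if k < l then x k else e1)" for k
  have x': "sqnorm n (x' k) = P" for k using x sqnorm_e1 by (simp add: x'_def)
  have "PiM {..<l} (\<lambda>k. block_law (x k)) = PiM {..<l} (\<lambda>k. block_law (x' k))"
    by (intro PiM_cong) (auto simp: x'_def)
  also have "\<dots> = PiM {..<l} (\<lambda>k. density (lborel_vec n) (\<lambda>y. ennreal (q (sqnorm n y) (cinner n (x' k) y))))"
    by (simp add: block_law_eq_density x')
  also have "\<dots> = density (lborel_blocks l) (\<lambda>y. \<Prod>k<l. ennreal (q (sqnorm n (y k)) (cinner n (x' k) (y k))))"
  proof (rule density_PiM_prod[symmetric, where f = "\<lambda>k y. ennreal (q (sqnorm n y) (cinner n (x' k) y))"])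
    show "product_sigma_finite (\<lambda>k. density (lborel_vec n) (\<lambda>y. ennreal (q (sqnorm n y) (cinner n (x' k) y))))"
      unfolding block_law_eq_density[OF x', symmetric]
      using prob_space_block_law by (auto simp: product_sigma_finite_def intro: prob_space_imp_sigma_finite)
  qed (auto intro: product_sigma_finite_lborel_vec)
  also have "\<dots> = density (lborel_blocks l) (\<lambda>y. \<Prod>k<l. ennreal (q (sqnorm n (y k)) (cinner n (x k) (y k))))"
    by (simp add: x'_def)
  finally show ?thesis .
qed

lemma distr_chan_blocks:
  "distr (PiM {..<l} (\<lambda>_. CN \<mu> \<sigma>2 \<Otimes>\<^sub>M CN_std_vec n)) (PiM {..<l} (\<lambda>_. borel_vec n)) (chan_out l n x)
     = PiM {..<l} (\<lambda>k. block_law (x k))"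
proof -
  have "chan_out l n x = (\<lambda>\<omega>. \<lambda>k\<in>{..<l}. (\<lambda>(h, w). \<lambda>i\<in>{..<n}. h * x k i + w i) (\<omega> k))"
    unfolding chan_out_def by (auto simp: case_prod_beta intro!: ext)
  then show ?thesis
    unfolding block_law_def
    by (simp only:) (rule distr_PiM_componentwise[where f = "\<lambda>k. \<lambda>(h, w). \<lambda>i\<in>{..<n}. h * x k i + w i"],
        auto intro: prob_space_pair)
qed

lemma measurable_chan_out:
  "chan_out l n x \<in> PiM {..<l} (\<lambda>_. CN \<mu> \<sigma>2 \<Otimes>\<^sub>M CN_std_vec n) \<rightarrow>\<^sub>M PiM {..<l} (\<lambda>_. borel_vec n)"
  unfolding chan_out_def by measurable

text \<open>No codeword appears as an argument: every admissible one has the same law of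
  \<open>tau\<close>.\<close>

definition dt_error :: "nat \<Rightarrow> real \<Rightarrow> ennreal" where
  "dt_error l b = (\<integral>\<^sup>+t. min 1 (ennreal b * (\<Prod>k<l. t k)) \<partial>PiM {..<l} (\<lambda>_. tau_law))"

text \<open>Pulling the likelihood out of the minimum turns the Lebesgue integral into an
  expectation under the true output law, where the block ratios are independent with law
  \<open>tau_law\<close>.\<close>

lemma nn_integral_min_likelihood:
  assumes x: "\<And>k. k < l \<Longrightarrow> sqnorm n (x k) = P"
  shows "(\<integral>\<^sup>+y. min (\<Prod>k<l. ennreal (q (sqnorm n (y k)) (cinner n (x k) (y k)))) (ennreal b * (\<Prod>k<l. Phi (sqnorm n (y k)))) \<partial>lborel_blocks l)
     = dt_error l b"
proof -
  let ?p = "\<lambda>y. \<Prod>k<l. ennreal (q (sqnorm n (y k)) (cinner n (x k) (y k)))"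
  let ?T = "\<lambda>k y. tau (sqnorm n y) (cinner n (x k) y)"
  have "min (?p y) (ennreal b * (\<Prod>k<l. Phi (sqnorm n (y k)))) = ?p y * min 1 (ennreal b * (\<Prod>k<l. ?T k (y k)))" for y
  proof -
    have "(\<Prod>k<l. Phi (sqnorm n (y k))) = ?p y * (\<Prod>k<l. ?T k (y k))"
      by (simp only: q_tau prod.distrib[symmetric])
    then show ?thesis by (simp only: ennreal_mult_min mult_1_right mult.left_commute)
  qed
  then have "(\<integral>\<^sup>+y. min (?p y) (ennreal b * (\<Prod>k<l. Phi (sqnorm n (y k)))) \<partial>lborel_blocks l)
     = (\<integral>\<^sup>+y. ?p y * min 1 (ennreal b * (\<Prod>k<l. ?T k (y k))) \<partial>lborel_blocks l)"
    by simp
  also have "\<dots> = (\<integral>\<^sup>+y. min 1 (ennreal b * (\<Prod>k<l. ?T k (y k))) \<partial>density (lborel_blocks l) ?p)"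
    by (rule nn_integral_density[symmetric]) measurable
  also have "\<dots> = (\<integral>\<^sup>+y. min 1 (ennreal b * (\<Prod>k<l. ?T k (y k))) \<partial>PiM {..<l} (\<lambda>k. block_law (x k)))"
    by (simp only: PiM_block_law[OF x])
  \<comment> \<open>The restriction makes the family of ratios a point of the product space, so that
    it can be pushed forward.\<close>
  also have "\<dots> = (\<integral>\<^sup>+y. min 1 (ennreal b * (\<Prod>k<l. (\<lambda>k\<in>{..<l}. ?T k (y k)) k)) \<partial>PiM {..<l} (\<lambda>k. block_law (x k)))"
    by simp
  also have "\<dots> = (\<integral>\<^sup>+t. min 1 (ennreal b * (\<Prod>k<l. t k)) \<partial>distr (PiM {..<l} (\<lambda>k. block_law (x k))) (PiM {..<l} (\<lambda>_. borel)) (\<lambda>y. \<lambda>k\<in>{..<l}. ?T k (y k)))"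
    by (rule nn_integral_distr[symmetric]) measurable
  also have "distr (PiM {..<l} (\<lambda>k. block_law (x k))) (PiM {..<l} (\<lambda>_. borel)) (\<lambda>y. \<lambda>k\<in>{..<l}. ?T k (y k))
     = PiM {..<l} (\<lambda>k. distr (block_law (x k)) borel (?T k))"
    by (rule distr_PiM_componentwise) (auto intro: prob_space_block_law)
  also have "\<dots> = PiM {..<l} (\<lambda>_. tau_law)"
    by (intro PiM_cong) (auto simp: distr_block_law_tau x)
  finally show ?thesis unfolding dt_error_def .
qed

lemma f_Y_e1_eq: "f_Y_e1 \<mu> \<sigma>2 n \<rho> y = q (sqnorm n y) (cinner n e1 y)"
  by (simp add: f_Y_e1_eq_q cinner_e1)

lemma measurable_S_fun[measurable]: "S_fun \<mu> \<sigma>2 n \<rho> \<in> borel_measurable (borel_vec n)"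
  unfolding S_fun_def f_Y_e1_eq by measurable

text \<open>The exceptions are outputs that are zero or where \<open>Phi\<close> is infinite. They
  are Lebesgue null, hence null for the law of \<open>W_tilde\<close>, which has a density.\<close>

lemma AE_exp_S_fun:
  "AE w in CN_std_vec n. ennreal (exp (- S_fun \<mu> \<sigma>2 n \<rho> w))
     = tau (sqnorm n (W_tilde \<mu> \<sigma>2 n \<rho> w)) (cinner n e1 (W_tilde \<mu> \<sigma>2 n \<rho> w))"
proof -
  have sp: "space (lborel_vec n) = space (borel_vec n)" by (simp add: space_PiM)
  have "AE y in lborel_vec n. ennreal (exp (- ln (f_Y_e1 \<mu> \<sigma>2 n \<rho> y / f_Y \<mu> \<sigma>2 n \<rho> y))) = tau (sqnorm n y) (cinner n e1 y)"
    using AE_Phi_finite AE_lborel_vec_nonzero[OF n_pos] AE_space[of "lborel_vec n"]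
  proof eventually_elim
    case (elim y)
    obtain r where r: "r \<ge> 0" "Phi (sqnorm n y) = ennreal r"
      using elim(1) by (cases "Phi (sqnorm n y)") auto
    have "r > 0" using Phi_pos[of y] elim(3) r sp by (auto simp: less_le)
    have f: "f_Y \<mu> \<sigma>2 n \<rho> y = r" using f_Y_eq_Phi[OF elim(2)] r by simp
    have "exp (- ln (q (sqnorm n y) (cinner n e1 y) / r)) = r * (1 / q (sqnorm n y) (cinner n e1 y))"
      using \<open>r > 0\<close> q_pos[of "sqnorm n y" "cinner n e1 y"] by (simp add: exp_minus)
    then show ?case
      unfolding f f_Y_e1_eq tau_def r(2) using r(1) by (simp only: ennreal_mult')
  qed
  then have "AE y in block_law e1. ennreal (exp (- ln (f_Y_e1 \<mu> \<sigma>2 n \<rho> y / f_Y \<mu> \<sigma>2 n \<rho> y))) = tau (sqnorm n y) (cinner n e1 y)"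
    unfolding block_law_eq_density[OF sqnorm_e1]
    by (subst AE_density) (measurable, auto elim: eventually_mono)
  then show ?thesis
    unfolding distr_W_tilde[symmetric] S_fun_def
    by (intro AE_distrD[of "W_tilde \<mu> \<sigma>2 n \<rho>" "CN_std_vec n" "borel_vec n"
          "\<lambda>y. ennreal (exp (- ln (f_Y_e1 \<mu> \<sigma>2 n \<rho> y / f_Y \<mu> \<sigma>2 n \<rho> y))) = tau (sqnorm n y) (cinner n e1 y)"])
       measurable
qed

lemma distr_tau_W_tilde:
  "distr (CN_std_vec n) borel (\<lambda>w. tau (sqnorm n (W_tilde \<mu> \<sigma>2 n \<rho> w)) (cinner n e1 (W_tilde \<mu> \<sigma>2 n \<rho> w))) = tau_law"
  unfolding tau_law_def distr_W_tilde[symmetric] by (subst distr_distr) (auto simp: comp_def)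

lemma eps_eq_dt_error:
  assumes b: "b > 0"
  shows "ennreal (\<integral>W. exp (- max 0 ((\<Sum>k<l. S_fun \<mu> \<sigma>2 n \<rho> (W k)) - ln b)) \<partial>PiM {..<l} (\<lambda>_. CN_std_vec n)) = dt_error l b"
proof -
  let ?M = "PiM {..<l} (\<lambda>_::nat. CN_std_vec n)"
  let ?U = "\<lambda>w. tau (sqnorm n (W_tilde \<mu> \<sigma>2 n \<rho> w)) (cinner n e1 (W_tilde \<mu> \<sigma>2 n \<rho> w))"
  interpret M: prob_space ?M by (intro prob_space_PiM prob_space_CN_std_vec)
  have [measurable_cong]: "sets ?M = sets (PiM {..<l} (\<lambda>_. borel_vec n))"
    by (intro sets_PiM_cong refl sets_CN_std_vec)
  \<comment> \<open>The integrand lies between 0 and 1, so the Bochner integral in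
    \<open>eps_ub\<close> is a genuine expectation.\<close>
  have "ennreal (\<integral>W. exp (- max 0 ((\<Sum>k<l. S_fun \<mu> \<sigma>2 n \<rho> (W k)) - ln b)) \<partial>?M)
     = (\<integral>\<^sup>+W. ennreal (exp (- max 0 ((\<Sum>k<l. S_fun \<mu> \<sigma>2 n \<rho> (W k)) - ln b))) \<partial>?M)"
    by (intro nn_integral_eq_integral[symmetric] M.integrable_const_bound[where B = 1]) (auto intro!: AE_I2)
  also have "\<dots> = (\<integral>\<^sup>+W. min 1 (ennreal b * (\<Prod>k<l. (\<lambda>k\<in>{..<l}. ?U (W k)) k)) \<partial>?M)"
  proof (rule nn_integral_cong_AE)
    have "AE W in ?M. \<forall>k\<in>{..<l}. ennreal (exp (- S_fun \<mu> \<sigma>2 n \<rho> (W k))) = ?U (W k)"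
      by (intro AE_finite_allI AE_PiM_component[where P = "\<lambda>w. ennreal (exp (- S_fun \<mu> \<sigma>2 n \<rho> w)) = ?U w"]
          prob_space_CN_std_vec AE_exp_S_fun) auto
    then show "AE W in ?M. ennreal (exp (- max 0 ((\<Sum>k<l. S_fun \<mu> \<sigma>2 n \<rho> (W k)) - ln b)))
       = min 1 (ennreal b * (\<Prod>k<l. (\<lambda>k\<in>{..<l}. ?U (W k)) k))"
    proof eventually_elim
      case (elim W)
      have "(\<Prod>k<l. (\<lambda>k\<in>{..<l}. ?U (W k)) k) = (\<Prod>k<l. ennreal (exp (- S_fun \<mu> \<sigma>2 n \<rho> (W k))))"
        using elim by (intro prod.cong) auto
      also have "\<dots> = ennreal (exp (- (\<Sum>k<l. S_fun \<mu> \<sigma>2 n \<rho> (W k))))"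
        by (simp add: prod_ennreal exp_neg_sum)
      finally show ?case
        using b unfolding exp_neg_max_ln[OF b] by (simp add: ennreal_mult'[symmetric] min_def ennreal_le_1)
    qed
  qed
  also have "\<dots> = (\<integral>\<^sup>+t. min 1 (ennreal b * (\<Prod>k<l. t k)) \<partial>distr ?M (PiM {..<l} (\<lambda>_. borel)) (\<lambda>W. \<lambda>k\<in>{..<l}. ?U (W k)))"
    by (rule nn_integral_distr[symmetric]) measurable
  also have "distr ?M (PiM {..<l} (\<lambda>_. borel)) (\<lambda>W. \<lambda>k\<in>{..<l}. ?U (W k)) = PiM {..<l} (\<lambda>_. distr (CN_std_vec n) borel ?U)"
    by (rule distr_PiM_componentwise) (auto intro: prob_space_CN_std_vec)
  finally show ?thesis unfolding dt_error_def distr_tau_W_tilde .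
qed

end

lemma (in rician_block) exists_code:
  assumes M: "m \<ge> 2"
  shows "\<exists>c g. (\<forall>j<m. \<forall>k<l. sqnorm n (c j k) = P) \<and>
    g \<in> PiM {..<l} (\<lambda>_. borel_vec n) \<rightarrow>\<^sub>M count_space (UNIV :: nat set) \<and>
    (\<Sum>j<m. emeasure (PiM {..<l} (\<lambda>k. block_law (c j k))) {y \<in> space (PiM {..<l} (\<lambda>_. borel_vec n)). g y \<noteq> j})
      \<le> of_nat m * dt_error l ((real m - 1) / 2)"
proof -
  let ?M = "PiM {..<l} (\<lambda>_::nat. CN_std_vec n)"
  let ?N = "lborel_blocks l"
  define b where "b = (real m - 1) / 2"
  \<comment> \<open>The random objects are Gaussian matrices; the projection to the sphere is part
    of the likelihood.\<close>
  define p where "p \<gamma> y = (\<Prod>k<l. ennreal (q (sqnorm n (y k)) (cinner n (sphere_point (\<gamma> k)) (y k))))" for \<gamma> y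
  define F where "F y = (\<Prod>k<l. Phi (sqnorm n (y k)))" for y
  \<comment> \<open>Excludes the null event of a zero block, for which the projection would violate
    the power constraint.\<close>
  define Q where "Q \<gamma> \<longleftrightarrow> (\<forall>k\<in>{..<l}. sqnorm n (\<gamma> k) \<noteq> 0)" for \<gamma> :: "nat \<Rightarrow> nat \<Rightarrow> complex"
  interpret M: prob_space ?M by (intro prob_space_PiM prob_space_CN_std_vec)
  interpret G: product_sigma_finite "\<lambda>_::nat. CN_std_vec n"
    using prob_space_CN_std_vec by (auto simp: product_sigma_finite_def intro: prob_space_imp_sigma_finite)
  have [measurable_cong]: "sets ?M = sets (PiM {..<l} (\<lambda>_. borel_vec n))"
    by (intro sets_PiM_cong refl sets_CN_std_vec)
  have N: "sigma_finite_measure ?N"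
    by (rule product_sigma_finite.sigma_finite[OF product_sigma_finite_lborel_vec]) simp
  have sN: "space ?N = space (PiM {..<l} (\<lambda>_. borel_vec n))"
    by (rule sets_eq_imp_space_eq[OF sets_lborel_blocks])
  have p: "case_prod p \<in> borel_measurable (?M \<Otimes>\<^sub>M ?N)"
    unfolding p_def by measurable
  have F: "F \<in> borel_measurable ?N" unfolding F_def by measurable
  have Fp: "F y = (\<integral>\<^sup>+\<gamma>. p \<gamma> y \<partial>?M)" if y: "y \<in> space ?N" for y
  proof -
    have yk: "y k \<in> space (borel_vec n)" if "k < l" for k
      using y that unfolding sN by (auto simp: space_PiM)
    have "(\<integral>\<^sup>+\<gamma>. p \<gamma> y \<partial>?M) = (\<Prod>k<l. \<integral>\<^sup>+g. ennreal (q (sqnorm n (y k)) (cinner n (sphere_point g) (y k))) \<partial>CN_std_vec n)"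
      unfolding p_def
    proof (rule G.product_nn_integral_prod[where f = "\<lambda>k g. ennreal (q (sqnorm n (y k)) (cinner n (sphere_point g) (y k)))"])
      fix k assume "k \<in> {..<l}"
      then have [simp]: "y k \<in> space (borel_vec n)" using yk by simp
      show "(\<lambda>g. ennreal (q (sqnorm n (y k)) (cinner n (sphere_point g) (y k)))) \<in> borel_measurable (CN_std_vec n)"
        by measurable
    qed simp
    also have "\<dots> = F y"
      unfolding F_def by (intro prod.cong refl nn_integral_q_sphere_point yk) simp
    finally show ?thesis ..
  qed
  have Q: "AE \<gamma> in ?M. Q \<gamma>"
    unfolding Q_def
    by (intro AE_finite_allI AE_PiM_component[where P = "\<lambda>g. sqnorm n g \<noteq> 0"] prob_space_CN_std_vec AE_CN_std_vec_nonzero n_pos) auto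
  obtain \<gamma> g where \<gamma>: "\<forall>j<m. \<gamma> j \<in> space ?M \<and> Q (\<gamma> j)" and g: "g \<in> ?N \<rightarrow>\<^sub>M count_space (UNIV :: nat set)"
    and le: "(\<Sum>j<m. emeasure (density ?N (p (\<gamma> j))) {y \<in> space ?N. g y \<noteq> j})
      \<le> of_nat m * (\<integral>\<^sup>+\<gamma>. \<integral>\<^sup>+y. min (p \<gamma> y) (ennreal b * F y) \<partial>?N \<partial>?M)"
    using dependence_testing_bound[OF M.prob_space_axioms N p F Fp Q, of m] M unfolding b_def by auto
  define c where "c j k = sphere_point (\<gamma> j k)" for j k
  have c: "sqnorm n (c j k) = P" if "j < m" "k < l" for j k
    using \<gamma> that unfolding c_def Q_def by (intro sqnorm_sphere_point) auto
  \<comment> \<open>The inner integral has the same value for almost every codeword, so the outer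
    average is trivial.\<close>
  have "(\<integral>\<^sup>+\<gamma>. \<integral>\<^sup>+y. min (p \<gamma> y) (ennreal b * F y) \<partial>?N \<partial>?M) = (\<integral>\<^sup>+\<gamma>. dt_error l b \<partial>?M)"
  proof (rule nn_integral_cong_AE, use Q in eventually_elim)
    case (elim \<gamma>)
    then show ?case
      unfolding p_def F_def Q_def by (intro nn_integral_min_likelihood sqnorm_sphere_point) auto
  qed
  also have "\<dots> = dt_error l b" by (simp add: M.emeasure_space_1)
  finally have "(\<Sum>j<m. emeasure (density ?N (p (\<gamma> j))) {y \<in> space ?N. g y \<noteq> j}) \<le> of_nat m * dt_error l b"
    using le by simp
  moreover have "density ?N (p (\<gamma> j)) = PiM {..<l} (\<lambda>k. block_law (c j k))" if "j < m" for j
    unfolding p_def[abs_def] c_def[symmetric] by (rule PiM_block_law[symmetric]) (use c that in auto)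
  ultimately have "(\<Sum>j<m. emeasure (PiM {..<l} (\<lambda>k. block_law (c j k))) {y \<in> space ?N. g y \<noteq> j}) \<le> of_nat m * dt_error l b"
    by simp
  moreover have "g \<in> PiM {..<l} (\<lambda>_. borel_vec n) \<rightarrow>\<^sub>M count_space UNIV"
    using g by (simp cong: measurable_cong_sets add: sets_lborel_blocks)
  ultimately show ?thesis
    using c unfolding b_def sN by blast
qed

text \<open>With values in \<open>ereal\<close>, the bound reads \<open>-\<infinity>\<close> if no
  \<open>M\<close> meets the error constraint.\<close>

theorem theorem1:
  fixes l nc :: nat and \<epsilon> \<rho> \<kappa> :: real
  assumes "l \<ge> 1" and "nc \<ge> 1" and "0 < \<epsilon>" and "\<epsilon> < 1" and "\<rho> > 0" and "\<kappa> \<ge> 0"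
  shows "Rstar \<kappa> l nc \<epsilon> \<rho> \<ge>
           Sup {ereal (log 2 (real M) / (real nc * real l)) | M :: nat. M \<ge> 2 \<and> eps_ub \<kappa> l nc \<rho> M \<le> \<epsilon>}"
proof -
  interpret rician_block nc \<rho> "sigma2H \<kappa>" "muH \<kappa>"
    using assms by unfold_locales (auto simp: sigma2H_def)
  have code: "is_code \<kappa> l nc M \<epsilon> \<rho>" if M: "M \<ge> 2" and eps: "eps_ub \<kappa> l nc \<rho> M \<le> \<epsilon>" for M
  proof -
    obtain c g where c: "\<forall>j<M. \<forall>k<l. sqnorm nc (c j k) = P"
      and g: "g \<in> PiM {..<l} (\<lambda>_. borel_vec nc) \<rightarrow>\<^sub>M count_space (UNIV :: nat set)"
      and le: "(\<Sum>j<M. emeasure (PiM {..<l} (\<lambda>k. block_law (c j k))) {y \<in> space (PiM {..<l} (\<lambda>_. borel_vec nc)). g y \<noteq> j})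
        \<le> of_nat M * dt_error l ((real M - 1) / 2)"
      using exists_code[OF M] by blast
    define C where "C = chan_space \<kappa> l nc"
    have C: "C = PiM {..<l} (\<lambda>_. CN (muH \<kappa>) (sigma2H \<kappa>) \<Otimes>\<^sub>M CN_std_vec nc)"
      by (simp add: C_def chan_space_def)
    interpret C: prob_space C unfolding C by (intro prob_space_PiM prob_space_pair)
    define e where "e j = measure C {\<omega> \<in> space C. g (chan_out l nc (c j) \<omega>) \<noteq> j}" for j
    have e: "ennreal (e j) = emeasure (PiM {..<l} (\<lambda>k. block_law (c j k))) {y \<in> space (PiM {..<l} (\<lambda>_. borel_vec nc)). g y \<noteq> j}" for j
    proof -
      let ?A = "{y \<in> space (PiM {..<l} (\<lambda>_. borel_vec nc)). g y \<noteq> j}"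
      have [measurable]: "?A \<in> sets (PiM {..<l} (\<lambda>_. borel_vec nc))" using g by measurable
      have m: "chan_out l nc (c j) \<in> C \<rightarrow>\<^sub>M PiM {..<l} (\<lambda>_. borel_vec nc)"
        unfolding C by (rule measurable_chan_out)
      have "emeasure (PiM {..<l} (\<lambda>k. block_law (c j k))) ?A = emeasure C (chan_out l nc (c j) -` ?A \<inter> space C)"
        unfolding distr_chan_blocks[symmetric] C[symmetric] using m by (intro emeasure_distr) auto
      also have "chan_out l nc (c j) -` ?A \<inter> space C = {\<omega> \<in> space C. g (chan_out l nc (c j) \<omega>) \<noteq> j}"
        using measurable_space[OF m] by auto
      finally show ?thesis by (simp add: e_def C.emeasure_eq_measure)
    qed
    have "ennreal (\<Sum>j<M. e j) = (\<Sum>j<M. ennreal (e j))"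
      by (simp add: e_def)
    also have "\<dots> \<le> of_nat M * dt_error l ((real M - 1) / 2)" using le by (simp add: e)
    \<comment> \<open>\<open>M \<ge> 2\<close> makes \<open>(M - 1) / 2\<close> positive, so its
      logarithm in \<open>eps_ub\<close> is genuine.\<close>
    also have "dt_error l ((real M - 1) / 2) = ennreal (eps_ub \<kappa> l nc \<rho> M)"
      unfolding eps_ub_def using M by (intro eps_eq_dt_error[symmetric]) simp
    also have "of_nat M * ennreal (eps_ub \<kappa> l nc \<rho> M) \<le> of_nat M * ennreal \<epsilon>"
      using eps by (intro mult_left_mono ennreal_leI) auto
    also have "\<dots> = ennreal (real M * \<epsilon>)"
      using assms by (simp add: ennreal_mult ennreal_of_nat_eq_real_of_nat)
    finally have sum: "(\<Sum>j<M. e j) \<le> real M * \<epsilon>"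
      using assms by (simp add: ennreal_le_iff)
    \<comment> \<open>Codewords were numbered from 0 and messages start at 1, hence
      \<open>Suc\<close> on the decoder and \<open>j - 1\<close> in the encoder. A decoding failure
      becomes \<open>M + 1\<close>, which is no message and counts as an error.\<close>
    have "(\<Sum>j=1..M. measure C {\<omega> \<in> space C. Suc (g (chan_out l nc (c (j - 1)) \<omega>)) \<noteq> j}) = (\<Sum>j<M. e j)"
      by (simp add: sum.atLeast1_atMost_eq e_def)
    with sum have "1 / real M * (\<Sum>j=1..M. measure C {\<omega> \<in> space C. Suc (g (chan_out l nc (c (j - 1)) \<omega>)) \<noteq> j}) \<le> \<epsilon>"
      using M by (simp add: field_simps)
    moreover have "\<forall>j\<in>{1..M}. \<forall>k<l. sqnorm nc (c (j - 1) k) = real nc * \<rho>"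
      using c by (auto simp: P_def)
    moreover have "(\<lambda>y. Suc (g y)) \<in> out_space l nc \<rightarrow>\<^sub>M count_space UNIV"
      unfolding out_space_def using g by measurable
    ultimately show ?thesis
      unfolding is_code_def C_def by (intro exI[of _ "\<lambda>j. c (j - 1)"] exI[of _ "\<lambda>y. Suc (g y)"]) auto
  qed
  show ?thesis
    unfolding Rstar_def
  proof (rule Sup_subset_mono, safe)
    fix M :: nat assume "M \<ge> 2" "eps_ub \<kappa> l nc \<rho> M \<le> \<epsilon>"
    then show "\<exists>M'. ereal (log 2 (real M) / (real nc * real l)) = ereal (log 2 (real M') / (real l * real nc)) \<and> M' \<ge> 1 \<and> is_code \<kappa> l nc M' \<epsilon> \<rho>"
      using code by (intro exI[of _ M]) (auto simp: mult.commute)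
  qed
qed

end
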